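(* Let $n\ge 2$ and let $H$ be a graph with vertex set $[n]$. The following are equivalent: (1) $H$ is Laman; (2) $H$ is Henneberg; (3) there exist rooted binary trees $T_1,T_2$ on leaf set $[n]$ such that the restricted clade graph $G^H_{T_1,T_2}$ is a tree; (4) $H$ is generically minimally rigid in the plane $\mathbb{R}^2$.
   Context: A graph $H$ on $n$ vertices is Laman if it has $2n-3$ edges and every subgraph of $H$ with $v\ge 2$ vertices has at most $2v-3$ edges. A graph is Henneberg if it is the complete graph $K_2$, or it can be obtained from a smaller Henneberg graph by one of the two Henneberg moves: (i) adding a new vertex adjacent to two existing vertices; (ii) removing an existing edge $ij$ and adding a new vertex adjacent to $i$, $j$ and one other existing vertex. A rooted tree on leaf set $[n]$ has leaves labeled bijectively by $[n]$ and each internal vertex has at least two children; it is binary if each internal vertex has exactly two children. A clade of $T$ is the set of leaves below an internal vertex; $\mathrm{clade}(T)$ is the set of clades. For $S\subseteq[n]$, $c_T(S)$ is the smallest clade of $T$ containing $S$. The restricted clade graph $G^H_{T_1,T_2}$ is the bipartite multigraph whose vertex set is the disjoint union of $\mathrm{clade}(T_1)$ and $\mathrm{clade}(T_2)$ and which has, for each edge $ij$ of $H$, one edge $e_{ij}$ joining $c_{T_1}(\{i,j\})$ to $c_{T_2}(\{i,j\})$. A bar-and-joint framework $(V,E,\mathbf p)$ with $\mathbf p:V\to\mathbb{R}^d$ injective is rigid if there is $\varepsilon>0$ such that every injective $\mathbf q:V\to\mathbb{R}^d$ with $\sum_{u\in V}\|\mathbf p(u)-\mathbf q(u)\|^2\le\varepsilon$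 and $\|\mathbf q(u)-\mathbf q(v)\|=\|\mathbf p(u)-\mathbf p(v)\|$ for all $uv\in E$ has image related to the image of $\mathbf p$ by a Euclidean isometry. A graph $(V,E)$ is generically rigid in $\mathbb{R}^d$ if $(V,E,\mathbf p)$ is rigid for generic $\mathbf p$; it is generically minimally rigid if it is generically rigid and deleting any edge yields a graph that is not generically rigid. *)

theory Defs
  imports "HOL-Analysis.Analysis"
begin

definition simple_graph :: "'a set \<Rightarrow> 'a set set \<Rightarrow> bool" where
  "simple_graph V E \<longleftrightarrow> (\<forall>e\<in>E. \<exists>i j. e = {i, j} \<and> i \<noteq> j \<and> i \<in> V \<and> j \<in> V)"

definition laman :: "'a set \<Rightarrow> 'a set set \<Rightarrow> bool" where
  "laman V E \<longleftrightarrow> finite V \<and> card E = 2 * card V - 3 \<and>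
     (\<forall>S F. S \<subseteq> V \<and> F \<subseteq> E \<and> (\<forall>e\<in>F. e \<subseteq> S) \<and> card S \<ge> 2
        \<longrightarrow> card F \<le> 2 * card S - 3)"

inductive henneberg :: "'a set \<Rightarrow> 'a set set \<Rightarrow> bool" where
  K2: "a \<noteq> b \<Longrightarrow> henneberg {a, b} {{a, b}}"
| move1: "\<lbrakk>henneberg V E; v \<notin> V; a \<in> V; b \<in> V; a \<noteq> b\<rbrakk>
           \<Longrightarrow> henneberg (insert v V) (E \<union> {{v, a}, {v, b}})"
| move2: "\<lbrakk>henneberg V E; {i, j} \<in> E; i \<noteq> j; k \<in> V; k \<noteq> i; k \<noteq> j; v \<notin> V\<rbrakk>
           \<Longrightarrow> henneberg (insert v V) ((E - {{i, j}}) \<union> {{v, i}, {v, j}, {v, k}})"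

datatype btree = Leaf nat | Node btree btree

fun leaf_list :: "btree \<Rightarrow> nat list" where
  "leaf_list (Leaf i) = [i]"
| "leaf_list (Node l r) = leaf_list l @ leaf_list r"

definition binary_tree_on :: "btree \<Rightarrow> nat set \<Rightarrow> bool" where
  "binary_tree_on T L \<longleftrightarrow> distinct (leaf_list T) \<and> set (leaf_list T) = L"

fun clades :: "btree \<Rightarrow> nat set set" where
  "clades (Leaf i) = {}"
| "clades (Node l r) = insert (set (leaf_list l) \<union> set (leaf_list r)) (clades l \<union> clades r)"

definition clade_of :: "btree \<Rightarrow> nat set \<Rightarrow> nat set" where
  "clade_of T S = (THE C. C \<in> clades T \<and> S \<subseteq> C \<and> (\<forall>C'\<in>clades T. S \<subseteq> C' \<longrightarrow> C \<subseteq> C'))"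

text \<open>A multigraph: vertex set W, edge index set Ed, and endpoint map ends (edge to set of endpoints).\<close>

definition mg_adj :: "'e set \<Rightarrow> ('e \<Rightarrow> 'w set) \<Rightarrow> 'w \<Rightarrow> 'w \<Rightarrow> bool" where
  "mg_adj Ed ends u w \<longleftrightarrow> (\<exists>e\<in>Ed. ends e = {u, w})"

definition mg_connected :: "'w set \<Rightarrow> 'e set \<Rightarrow> ('e \<Rightarrow> 'w set) \<Rightarrow> bool" where
  "mg_connected W Ed ends \<longleftrightarrow> W \<noteq> {} \<and> (\<forall>u\<in>W. \<forall>w\<in>W. (mg_adj Ed ends)\<^sup>*\<^sup>* u w)"

text \<open>A cycle: distinct vertices vs and distinct edges es, edge i joining vs!i and vs!(i+1 mod len).
  (Length 1 = loop, length 2 = pair of parallel edges.)\<close>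
definition mg_cycle :: "'w set \<Rightarrow> 'e set \<Rightarrow> ('e \<Rightarrow> 'w set) \<Rightarrow> 'w list \<Rightarrow> 'e list \<Rightarrow> bool" where
  "mg_cycle W Ed ends vs es \<longleftrightarrow> length vs \<ge> 1 \<and> length es = length vs \<and>
     distinct vs \<and> distinct es \<and> set vs \<subseteq> W \<and> set es \<subseteq> Ed \<and>
     (\<forall>i < length es. ends (es ! i) = {vs ! i, vs ! ((i + 1) mod length vs)})"

definition mg_tree :: "'w set \<Rightarrow> 'e set \<Rightarrow> ('e \<Rightarrow> 'w set) \<Rightarrow> bool" where
  "mg_tree W Ed ends \<longleftrightarrow> finite W \<and> finite Ed \<and> (\<forall>e\<in>Ed. ends e \<subseteq> W) \<and>
     mg_connected W Ed ends \<and> (\<nexists>vs es. mg_cycle W Ed ends vs es)"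

definition clade_graph_vertices :: "btree \<Rightarrow> btree \<Rightarrow> (nat set + nat set) set" where
  "clade_graph_vertices T1 T2 = Inl ` clades T1 \<union> Inr ` clades T2"

definition clade_graph_ends :: "btree \<Rightarrow> btree \<Rightarrow> nat set \<Rightarrow> (nat set + nat set) set" where
  "clade_graph_ends T1 T2 e = {Inl (clade_of T1 e), Inr (clade_of T2 e)}"

definition restricted_clade_graph_is_tree :: "nat set set \<Rightarrow> btree \<Rightarrow> btree \<Rightarrow> bool" where
  "restricted_clade_graph_is_tree E T1 T2 \<longleftrightarrow>
     mg_tree (clade_graph_vertices T1 T2) E (clade_graph_ends T1 T2)"

datatype 'v pexpr = PConst rat | PVar 'v | PAdd "'v pexpr" "'v pexpr" | PMul "'v pexpr" "'v pexpr"
  | PNeg "'v pexpr"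

fun peval :: "('v \<Rightarrow> real) \<Rightarrow> 'v pexpr \<Rightarrow> real" where
  "peval x (PConst c) = of_rat c"
| "peval x (PVar v) = x v"
| "peval x (PAdd a b) = peval x a + peval x b"
| "peval x (PMul a b) = peval x a * peval x b"
| "peval x (PNeg a) = - peval x a"

fun pvars :: "'v pexpr \<Rightarrow> 'v set" where
  "pvars (PConst c) = {}"
| "pvars (PVar v) = {v}"
| "pvars (PAdd a b) = pvars a \<union> pvars b"
| "pvars (PMul a b) = pvars a \<union> pvars b"
| "pvars (PNeg a) = pvars a"

text \<open>p is generic: the coordinates of p on V are algebraically independent over Q, i.e.
  every rational polynomial in them vanishing at p is the zero polynomial (vanishes everywhere).\<close>
definition generic :: "'a set \<Rightarrow> ('a \<Rightarrow> real^2) \<Rightarrow> bool" where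
  "generic V p \<longleftrightarrow> (\<forall>e :: ('a \<times> 2) pexpr. pvars e \<subseteq> V \<times> UNIV \<longrightarrow>
      peval (\<lambda>(u, i). p u $ i) e = 0 \<longrightarrow> (\<forall>x. peval x e = 0))"

definition rigid_framework :: "'a set \<Rightarrow> 'a set set \<Rightarrow> ('a \<Rightarrow> real^2) \<Rightarrow> bool" where
  "rigid_framework V E p \<longleftrightarrow>
     (\<exists>\<epsilon>>0. \<forall>q. inj_on q V \<and> (\<Sum>u\<in>V. (norm (p u - q u))\<^sup>2) \<le> \<epsilon> \<and>
        (\<forall>u v. {u, v} \<in> E \<longrightarrow> dist (q u) (q v) = dist (p u) (p v))
        \<longrightarrow> (\<exists>f :: real^2 \<Rightarrow> real^2. (\<forall>x y. dist (f x) (f y) = dist x y) \<and> f ` (p ` V) = q ` V))"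

definition generically_rigid_2 :: "'a set \<Rightarrow> 'a set set \<Rightarrow> bool" where
  "generically_rigid_2 V E \<longleftrightarrow> (\<forall>p. generic V p \<and> inj_on p V \<longrightarrow> rigid_framework V E p)"

definition generically_minimally_rigid_2 :: "'a set \<Rightarrow> 'a set set \<Rightarrow> bool" where
  "generically_minimally_rigid_2 V E \<longleftrightarrow> generically_rigid_2 V E \<and>
     (\<forall>e\<in>E. \<not> generically_rigid_2 V (E - {e}))"

end

theory Submission
  imports Defs
begin

text \<open>
  Deleting a vertex of degree two or three from a Laman graph, and in the second case joining two
  suitable neighbours by a new edge, leaves a smaller Laman graph; hence Laman graphs are Henneberg.
  A Henneberg move is realised on a pair of trees by attaching the new leaf as a cherry at two
  different leaves; for the second move the two leaves are chosen according to how the clade graph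
  falls apart when \<open>e\<^sub>i\<^sub>j\<close> is deleted. Conversely the clades \<open>c\<^sub>T({i, j})\<close> with \<open>i, j \<in> S\<close>
  number at most \<open>|S| - 1\<close>, and a forest has fewer edges than vertices.

  On the geometric side, a Henneberg graph is infinitesimally rigid at a special position, and
  fraction-free elimination turns independence at one point into the nonvanishing of a rational
  polynomial, hence into independence at and near every generic point. If \<open>p\<close> and \<open>q\<close> have equal edge
  lengths then \<open>q - p\<close> is an infinitesimal motion of \<open>(p + q) / 2\<close>; this gives rigidity without any
  differential calculus. The same identity, read backwards, yields flexes when the generic rank is
  too small, so a generically rigid graph contains a Laman graph given by a basis of rows of its
  rigidity matrix.
\<close>

section \<open>Sparse graphs\<close>

lemma simple_graphE:
  assumes "simple_graph V E" "e \<in> E"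
  obtains a b where "e = {a, b}" "a \<noteq> b" "a \<in> V" "b \<in> V"
  using assms unfolding simple_graph_def by blast

lemma simple_graph_endpoints:
  assumes "simple_graph V E" "{a, b} \<in> E"
  shows "a \<in> V" "b \<in> V" "a \<noteq> b"
  using simple_graphE[OF assms] by (metis doubleton_eq_iff)+

lemma simple_graph_edge_subset: "simple_graph V E \<Longrightarrow> e \<in> E \<Longrightarrow> e \<subseteq> V"
  by (auto simp: simple_graph_def)

lemma simple_graph_card_edge: "simple_graph V E \<Longrightarrow> e \<in> E \<Longrightarrow> card e = 2"
  by (auto elim!: simple_graphE)

lemma simple_graph_finite:
  assumes "simple_graph V E" "finite V"
  shows "finite E"
proof -
  have "E \<subseteq> Pow V" using simple_graph_edge_subset[OF assms(1)] by blast
  then show ?thesis using assms(2) by (meson finite_Pow_iff finite_subset)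
qed

lemma simple_graph_subset: "simple_graph V E \<Longrightarrow> F \<subseteq> E \<Longrightarrow> simple_graph V F"
  unfolding simple_graph_def by blast

definition edges_in :: "'a set set \<Rightarrow> 'a set \<Rightarrow> 'a set set" where
  "edges_in E S = {e \<in> E. e \<subseteq> S}"

definition neighbours :: "'a set set \<Rightarrow> 'a \<Rightarrow> 'a set" where
  "neighbours E v = {u. {v, u} \<in> E}"

lemma edges_in_subset: "edges_in E S \<subseteq> E"
  by (auto simp: edges_in_def)

lemma finite_edges_in: "finite E \<Longrightarrow> finite (edges_in E S)"
  by (simp add: edges_in_def)

lemma edges_in_Int: "edges_in E S \<inter> edges_in E T = edges_in E (S \<inter> T)"
  by (auto simp: edges_in_def)

lemma edges_in_Un_subset: "edges_in E S \<union> edges_in E T \<subseteq> edges_in E (S \<union> T)"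
  by (auto simp: edges_in_def)

lemma edges_in_edges_in: "S \<subseteq> T \<Longrightarrow> edges_in (edges_in E T) S = edges_in E S"
  by (auto simp: edges_in_def)

lemma edges_in_all: "simple_graph V E \<Longrightarrow> edges_in E V = E"
  using simple_graph_edge_subset by (auto simp: edges_in_def)

lemma simple_graph_edges_in:
  assumes "simple_graph V E"
  shows "simple_graph S (edges_in E S)"
  unfolding simple_graph_def
proof
  fix e assume e: "e \<in> edges_in E S"
  then have "e \<in> E" by (simp add: edges_in_def)
  then obtain a b where "e = {a, b}" "a \<noteq> b" by (rule simple_graphE[OF assms])
  then show "\<exists>i j. e = {i, j} \<and> i \<noteq> j \<and> i \<in> S \<and> j \<in> S" using e by (auto simp: edges_in_def)
qed

lemma edges_in_eq_empty:
  assumes "simple_graph V E" "finite S" "card S \<le> 1"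
  shows "edges_in E S = {}"
proof (rule equals0I)
  fix e assume e: "e \<in> edges_in E S"
  then obtain a b where ab: "e = {a, b}" "a \<noteq> b" "a \<in> S" "b \<in> S"
    by (rule simple_graphE[OF simple_graph_edges_in[OF assms(1)]])
  then show False using card_le_Suc0_iff_eq[OF assms(2)] assms(3) by auto
qed

lemma neighbours_subset:
  assumes "simple_graph V E"
  shows "neighbours E v \<subseteq> V - {v}"
proof
  fix u assume "u \<in> neighbours E v"
  then have "{v, u} \<in> E" by (simp add: neighbours_def)
  from simple_graph_endpoints[OF assms this] show "u \<in> V - {v}" by auto
qed

lemma incident_edges_eq_image:
  assumes "simple_graph V E"
  shows "{e \<in> E. v \<in> e} = (\<lambda>u. {v, u}) ` neighbours E v"
proof (intro equalityI subsetI)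
  fix e assume e: "e \<in> {e \<in> E. v \<in> e}"
  then obtain a b where "e = {a, b}" using simple_graphE[OF assms, of e] by blast
  then have "e = {v, a} \<or> e = {v, b}" using e by auto
  then show "e \<in> (\<lambda>u. {v, u}) ` neighbours E v" using e by (auto simp: neighbours_def)
qed (auto simp: neighbours_def)

lemma card_incident_edges: "card ((\<lambda>u. {v, u}) ` N) = card N"
  by (intro card_image) (auto simp: inj_on_def doubleton_eq_iff)

lemma edges_in_insert:
  assumes "simple_graph V E"
  shows "edges_in E (insert v S) = edges_in E S \<union> (\<lambda>u. {v, u}) ` (neighbours E v \<inter> S)"
proof (intro equalityI subsetI)
  fix e assume e: "e \<in> edges_in E (insert v S)"
  show "e \<in> edges_in E S \<union> (\<lambda>u. {v, u}) ` (neighbours E v \<inter> S)"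
  proof (cases "v \<in> e")
    case True
    then have "e \<in> (\<lambda>u. {v, u}) ` neighbours E v"
      unfolding incident_edges_eq_image[OF assms, symmetric] using e by (simp add: edges_in_def)
    then obtain u where u: "u \<in> neighbours E v" "e = {v, u}" by blast
    then have "u \<in> S" using e neighbours_subset[OF assms, of v] by (auto simp: edges_in_def)
    then show ?thesis using u by blast
  qed (use e in \<open>auto simp: edges_in_def\<close>)
next
  fix e assume "e \<in> edges_in E S \<union> (\<lambda>u. {v, u}) ` (neighbours E v \<inter> S)"
  then show "e \<in> edges_in E (insert v S)" by (auto simp: edges_in_def neighbours_def)
qed

lemma card_edges_in_insert:
  assumes "simple_graph V E" "finite V" "v \<notin> S"
  shows "card (edges_in E (insert v S)) = card (edges_in E S) + card (neighbours E v \<inter> S)"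
proof -
  have "finite (neighbours E v \<inter> S)"
    using neighbours_subset[OF assms(1), of v] assms(2)
      by (meson finite_Diff finite_Int finite_subset)
  then show ?thesis
    unfolding edges_in_insert[OF assms(1)]
    using assms(3) finite_edges_in[OF simple_graph_finite[OF assms(1,2)]]
    by (subst card_Un_disjoint) (auto simp: card_incident_edges edges_in_def)
qed

lemma card_edges_remove_vertex:
  assumes "simple_graph V E" "finite V" "v \<in> V"
  shows "card E = card (edges_in E (V - {v})) + card (neighbours E v)"
proof -
  have "neighbours E v \<inter> (V - {v}) = neighbours E v" using neighbours_subset[OF assms(1)] by blast
  moreover have "insert v (V - {v}) = V" using assms(3) by blast
  ultimately show ?thesis
    using card_edges_in_insert[OF assms(1,2), of v "V - {v}"] edges_in_all[OF assms(1)] by simp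
qed

lemma handshake:
  assumes "finite V" "simple_graph V E"
  shows "(\<Sum>v\<in>V. card (neighbours E v)) = 2 * card E"
proof -
  have fin: "finite E" using simple_graph_finite assms by blast
  have "(\<Sum>v\<in>V. card (neighbours E v)) = (\<Sum>v\<in>V. \<Sum>e\<in>E. if v \<in> e then 1 else 0)"
    using fin
      by (simp add: sum.If_cases Int_def incident_edges_eq_image[OF assms(2)] card_incident_edges)
  also have "\<dots> = (\<Sum>e\<in>E. \<Sum>v\<in>V. if v \<in> e then 1 else 0)" by (rule sum.swap)
  also have "\<dots> = (\<Sum>e\<in>E. 2)"
  proof (rule sum.cong)
    fix e assume "e \<in> E"
    then obtain a b where "e = {a, b}" "a \<noteq> b" "a \<in> V" "b \<in> V" by (rule simple_graphE[OF assms(2)])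
    moreover from this have "V \<inter> {v. v \<in> e} = {a, b}" by auto
    ultimately show "(\<Sum>v\<in>V. if v \<in> e then 1 else 0) = (2 :: nat)"
      using assms by (simp add: sum.If_cases)
  qed simp
  finally show ?thesis by simp
qed

definition sparse :: "'a set \<Rightarrow> 'a set set \<Rightarrow> bool" where
  "sparse V E \<longleftrightarrow> (\<forall>S\<subseteq>V. card S \<ge> 2 \<longrightarrow> card (edges_in E S) + 3 \<le> 2 * card S)"

definition tight :: "'a set set \<Rightarrow> 'a set \<Rightarrow> bool" where
  "tight E S \<longleftrightarrow> card S \<ge> 2 \<and> card (edges_in E S) + 3 = 2 * card S"

lemma sparseD: "sparse V E \<Longrightarrow> S \<subseteq> V \<Longrightarrow> card S \<ge> 2 \<Longrightarrow> card (edges_in E S) + 3 \<le> 2 * card S"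
  by (simp add: sparse_def)

lemma laman_iff_sparse:
  assumes "finite V" "simple_graph V E"
  shows "laman V E \<longleftrightarrow> card E = 2 * card V - 3 \<and> sparse V E"
proof -
  have fin: "finite E" using simple_graph_finite assms by blast
  have "(\<forall>F. F \<subseteq> E \<and> (\<forall>e\<in>F. e \<subseteq> S) \<longrightarrow> card F \<le> 2 * card S - 3) \<longleftrightarrow> card (edges_in E S) + 3 \<le> 2 * card S"
    if "card S \<ge> 2" for S :: "'a set"
  proof -
    have "F \<subseteq> E \<and> (\<forall>e\<in>F. e \<subseteq> S) \<longleftrightarrow> F \<subseteq> edges_in E S" for F by (auto simp: edges_in_def)
    moreover have "(\<forall>F\<subseteq>edges_in E S. card F \<le> 2 * card S - 3) \<longleftrightarrow> card (edges_in E S) \<le> 2 * card S - 3"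
      using card_mono[OF finite_edges_in[OF fin]] by (meson order_trans subset_refl)
    ultimately show ?thesis using that by auto
  qed
  then have "(\<forall>S F. S \<subseteq> V \<and> F \<subseteq> E \<and> (\<forall>e\<in>F. e \<subseteq> S) \<and> card S \<ge> 2
      \<longrightarrow> card F \<le> 2 * card S - 3) \<longleftrightarrow> sparse V E"
    unfolding sparse_def by meson
  then show ?thesis using assms(1) by (simp add: laman_def)
qed

lemma sparse_edges_in: "sparse V E \<Longrightarrow> S \<subseteq> V \<Longrightarrow> sparse S (edges_in E S)"
  unfolding sparse_def by (metis edges_in_edges_in order_trans)

lemma tight_edges_in: "S \<subseteq> T \<Longrightarrow> tight (edges_in E T) S \<longleftrightarrow> tight E S"
  by (simp add: tight_def edges_in_edges_in)

lemma tight_Un: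
  assumes "sparse V E" "finite V" "finite E" "tight E S" "tight E T" "S \<union> T \<subseteq> V" "card (S \<inter> T) \<ge> 2"
  shows "tight E (S \<union> T)"
proof -
  have fin: "finite S" "finite T" using assms(2,6) by (auto intro: finite_subset)
  have "card (edges_in E S) + card (edges_in E T) =
      card (edges_in E S \<union> edges_in E T) + card (edges_in E (S \<inter> T))"
    using card_Un_Int[OF finite_edges_in finite_edges_in] assms(3) by (metis edges_in_Int)
  moreover have "card (edges_in E S \<union> edges_in E T) \<le> card (edges_in E (S \<union> T))"
    by (intro card_mono finite_edges_in assms(3) edges_in_Un_subset)
  moreover have "card (edges_in E (S \<inter> T)) + 3 \<le> 2 * card (S \<inter> T)"
    using assms(6,7) by (intro sparseD[OF assms(1)]) auto
  moreover have "card S + card T = card (S \<union> T) + card (S \<inter> T)" by (rule card_Un_Int[OF fin])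
  moreover have "card (S \<inter> T) \<le> card (S \<union> T)" using fin by (intro card_mono) auto
  ultimately show ?thesis
    using sparseD[OF assms(1,6)] assms(4,5,7) unfolding tight_def by linarith
qed

lemma tight_Un_triangle:
  assumes sparse: "sparse V E" "finite V" "simple_graph V E"
    and tight: "tight E S" "tight E T" "tight E U" and sub: "S \<union> T \<union> U \<subseteq> V"
    and meet: "S \<inter> T = {a}" "S \<inter> U = {b}" "T \<inter> U = {c}" "distinct [a, b, c]"
  shows "tight E (S \<union> T \<union> U)"
proof -
  note finE = finite_edges_in[OF simple_graph_finite[OF sparse(3,2)]]
  have fin: "finite S" "finite T" "finite U" using sparse(2) sub by (auto intro: finite_subset)
  have "edges_in E {u} = {}" for u by (intro edges_in_eq_empty[OF sparse(3)]) auto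
  then have disj: "edges_in E S \<inter> edges_in E T = {}" "edges_in E S \<inter> edges_in E U = {}"
      "edges_in E T \<inter> edges_in E U = {}"
    by (simp_all add: edges_in_Int meet)
  have "card (edges_in E S) + card (edges_in E T) + card (edges_in E U) =
      card (edges_in E S \<union> edges_in E T \<union> edges_in E U)"
    using disj by (simp add: finE card_Un_disjoint Int_Un_distrib2)
  also have "\<dots> \<le> card (edges_in E (S \<union> T \<union> U))"
    by (intro card_mono finE) (auto simp: edges_in_def)
  finally have "card (edges_in E S) + card (edges_in E T) + card (edges_in E U)
      \<le> card (edges_in E (S \<union> T \<union> U))" .
  moreover have "card S + card T = card (S \<union> T) + 1" using card_Un_Int[OF fin(1,2)] meet by simp
  moreover have "(S \<union> T) \<inter> U = {b, c}" using meet by blast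
  then have "card (S \<union> T) + card U = card (S \<union> T \<union> U) + 2"
    using card_Un_Int[of "S \<union> T" U] fin meet(4) by simp
  ultimately show ?thesis
    using sparseD[OF sparse(1) sub] tight unfolding tight_def by linarith
qed

lemma tight_hull_of_triple:
  assumes sparse: "sparse V E" "finite V" "simple_graph V E" and "W \<subseteq> V"
    and dist: "distinct [a, b, c]"
    and pairs: "\<exists>S\<subseteq>W. tight E S \<and> {a, b} \<subseteq> S" "\<exists>S\<subseteq>W. tight E S \<and> {a, c} \<subseteq> S"
      "\<exists>S\<subseteq>W. tight E S \<and> {b, c} \<subseteq> S"
  shows "\<exists>S\<subseteq>W. tight E S \<and> {a, b, c} \<subseteq> S"
proof -
  obtain S where S: "S \<subseteq> W" "tight E S" "{a, b} \<subseteq> S" using pairs(1) by blast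
  obtain T where T: "T \<subseteq> W" "tight E T" "{a, c} \<subseteq> T" using pairs(2) by blast
  obtain U where U: "U \<subseteq> W" "tight E U" "{b, c} \<subseteq> U" using pairs(3) by blast
  note Un = tight_Un[OF sparse(1,2) simple_graph_finite[OF sparse(3,2)]]
  have meet: "A \<inter> B = {x} \<or> card (A \<inter> B) \<ge> 2" if "A \<subseteq> W" "x \<in> A" "x \<in> B" for A B and x :: 'a
  proof -
    have "finite (A \<inter> B)" using that(1) \<open>W \<subseteq> V\<close> sparse(2) by (meson finite_Int finite_subset)
    then show ?thesis
      using that(2,3) card_le_Suc0_iff_eq[of "A \<inter> B"]
        by (auto simp: not_le[symmetric] numeral_2_eq_2 less_Suc_eq_le)
  qed
  consider "card (S \<inter> T) \<ge> 2" | "card (S \<inter> U) \<ge> 2" | "card (T \<inter> U) \<ge> 2"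
    | "S \<inter> T = {a}" "S \<inter> U = {b}" "T \<inter> U = {c}"
    using meet[of S a T] meet[of S b U] meet[of T c U] S(1,3) T(1,3) U(3) by auto
  then show ?thesis
  proof cases
    case 1
    then show ?thesis using Un[of S T] S T \<open>W \<subseteq> V\<close> by (intro exI[of _ "S \<union> T"]) auto
  next
    case 2
    then show ?thesis using Un[of S U] S U \<open>W \<subseteq> V\<close> by (intro exI[of _ "S \<union> U"]) auto
  next
    case 3
    then show ?thesis using Un[of T U] T U \<open>W \<subseteq> V\<close> by (intro exI[of _ "T \<union> U"]) auto
  next
    case 4
    have "S \<union> T \<union> U \<subseteq> V" using S(1) T(1) U(1) \<open>W \<subseteq> V\<close> by blast
    from tight_Un_triangle[OF sparse S(2) T(2) U(2) this 4 dist] show ?thesis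
      using S T U by (intro exI[of _ "S \<union> T \<union> U"]) auto
  qed
qed

lemma card_neighbours_in_tight:
  assumes "sparse V E" "finite V" "simple_graph V E" "v \<in> V" "v \<notin> S" "S \<subseteq> V" "tight E S"
  shows "card (neighbours E v \<inter> S) \<le> 2"
proof -
  have "finite S" using assms(2,6) finite_subset by blast
  then have "card (insert v S) = card S + 1" using assms(5) by simp
  moreover have "card (edges_in E (insert v S)) + 3 \<le> 2 * card (insert v S)"
    using assms \<open>card (insert v S) = card S + 1\<close>
      by (intro sparseD[OF assms(1)]) (auto simp: tight_def)
  ultimately show ?thesis
    using card_edges_in_insert[OF assms(3,2,5)] assms(7) by (simp add: tight_def)
qed

section \<open>Henneberg graphs\<close>

lemma henneberg_simple_graph:
  assumes "henneberg V E"
  shows "finite V" "simple_graph V E"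
  using assms
proof (induction rule: henneberg.induct)
  case (move1 V E v a b)
  {
    case 2
    then show ?case using move1 unfolding simple_graph_def by (auto; blast)
  }
next
  case (move2 V E i j k v)
  then have ij: "i \<in> V" "j \<in> V" using simple_graph_endpoints[of V E i j] by auto
  {
    case 2
    then show ?case using move2 ij unfolding simple_graph_def by (auto; blast)
  }
qed (auto simp: simple_graph_def)

lemma henneberg_card_edges:
  assumes "henneberg V E"
  shows "card E + 3 = 2 * card V"
  using assms
proof (induction rule: henneberg.induct)
  case (move1 V E v a b)
  note graph = henneberg_simple_graph[OF move1(1)]
  have "{v, u} \<notin> E" for u using simple_graph_edge_subset[OF graph(2)] move1(2) by blast
  moreover have "{v, a} \<noteq> {v, b}" using move1(5) by (auto simp: doubleton_eq_iff)
  ultimately have "card (E \<union> {{v, a}, {v, b}}) = card E + 2"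
    using simple_graph_finite[OF graph(2,1)] by simp
  then show ?case using move1.IH move1(2) graph(1) by simp
next
  case (move2 V E i j k v)
  note graph = henneberg_simple_graph[OF move2(1)]
  have "{v, u} \<notin> E - {{i, j}}" for u using simple_graph_edge_subset[OF graph(2)] move2(7) by blast
  moreover have "{v, i} \<noteq> {v, j}" "{v, i} \<noteq> {v, k}" "{v, j} \<noteq> {v, k}"
    using move2 by (auto simp: doubleton_eq_iff)
  ultimately have "card (E - {{i, j}} \<union> {{v, i}, {v, j}, {v, k}}) = card (E - {{i, j}}) + 3"
    using simple_graph_finite[OF graph(2,1)] by simp
  then show ?case
    using move2.IH move2(7) graph(1) card.remove[OF simple_graph_finite[OF graph(2,1)] move2(2)]
      by simp
qed simp

lemma henneberg_card_ge_2: "henneberg V E \<Longrightarrow> card V \<ge> 2"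
  using henneberg_card_edges[of V E] by linarith

lemma card_ge_2E:
  assumes "card V \<ge> 2"
  obtains a b where "a \<in> V" "b \<in> V" "a \<noteq> b"
proof -
  obtain S where "S \<subseteq> V" "card S = 2" using assms by (meson obtain_subset_with_card_n)
  then show thesis using that by (auto simp: card_2_iff)
qed

lemma henneberg_exists:
  assumes "finite V" "card V \<ge> 2"
  shows "\<exists>E. henneberg V E"
  using assms
proof (induction V rule: finite_induct)
  case (insert v V)
  show ?case
  proof (cases "card V \<ge> 2")
    case True
    then obtain E a b where "henneberg V E" "a \<in> V" "b \<in> V" "a \<noteq> b"
      using insert.IH card_ge_2E by metis
    then show ?thesis using henneberg.move1[of V E v a b] insert.hyps by blast
  next
    case False
    then have "card V = 1" using insert.prems insert.hyps by simp
    then obtain a where "V = {a}" by (rule card_1_singletonE)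
    then show ?thesis using henneberg.K2[of v a] insert.hyps by auto
  qed
qed simp

section \<open>Laman graphs are Henneberg\<close>

lemma laman_finite: "laman V E \<Longrightarrow> finite V"
  by (simp add: laman_def)

lemma laman_card_edges: "laman V E \<Longrightarrow> card E = 2 * card V - 3"
  by (simp add: laman_def)

lemma laman_imp_sparse: "laman V E \<Longrightarrow> simple_graph V E \<Longrightarrow> sparse V E"
  using laman_iff_sparse laman_finite by blast

lemma laman_low_degree_vertex:
  assumes "laman V E" "simple_graph V E" "card V \<ge> 3"
  obtains v where "v \<in> V" "card (neighbours E v) = 2 \<or> card (neighbours E v) = 3"
proof -
  note finite = laman_finite[OF assms(1)] and card_E = laman_card_edges[OF assms(1)]
  have "\<exists>v\<in>V. card (neighbours E v) < 4"
  proof (rule ccontr)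
    assume "\<not> ?thesis"
    then have "(\<Sum>v\<in>V. 4) \<le> (\<Sum>v\<in>V. card (neighbours E v))" by (intro sum_mono) auto
    then show False using handshake[OF finite assms(2)] card_E assms(3) by simp
  qed
  then obtain v where v: "v \<in> V" "card (neighbours E v) < 4" by blast
  have "card (edges_in E (V - {v})) + 3 \<le> 2 * card (V - {v})"
    using v finite assms(3) by (intro sparseD[OF laman_imp_sparse[OF assms(1,2)]]) auto
  then have "card (neighbours E v) \<ge> 2"
    using card_edges_remove_vertex[OF assms(2) finite v(1)] card_E v(1) finite assms(3) by simp
  then have "card (neighbours E v) = 2 \<or> card (neighbours E v) = 3" using v(2) by linarith
  then show thesis using that v(1) by blast
qed

lemma laman_remove_degree_two:
  assumes "laman V E" "simple_graph V E" "v \<in> V" "card (neighbours E v) = 2" "card V \<ge> 3"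
  shows "laman (V - {v}) (edges_in E (V - {v}))"
proof -
  note finite = laman_finite[OF assms(1)]
  have "card (edges_in E (V - {v})) = 2 * card (V - {v}) - 3"
    using card_edges_remove_vertex[OF assms(2) finite assms(3)] laman_card_edges[OF assms(1)]
      assms(3-5) finite
    by simp
  moreover have "sparse (V - {v}) (edges_in E (V - {v}))"
    using sparse_edges_in[OF laman_imp_sparse[OF assms(1,2)]] by blast
  ultimately show ?thesis
    using laman_iff_sparse[OF finite_Diff[OF finite] simple_graph_edges_in[OF assms(2)]] by blast
qed

lemma sparse_insert_edge:
  assumes "sparse V E" "finite E" "\<And>S. S \<subseteq> V \<Longrightarrow> {i, j} \<subseteq> S \<Longrightarrow> \<not> tight E S"
  shows "sparse V (insert {i, j} E)"
  unfolding sparse_def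
proof (intro allI impI)
  fix S assume S: "S \<subseteq> V" "card S \<ge> 2"
  show "card (edges_in (insert {i, j} E) S) + 3 \<le> 2 * card S"
  proof (cases "{i, j} \<subseteq> S")
    case True
    then have "card (edges_in E S) + 3 < 2 * card S"
      using assms(3)[OF S(1)] sparseD[OF assms(1) S] S(2) by (fastforce simp: tight_def)
    moreover have "edges_in (insert {i, j} E) S = insert {i, j} (edges_in E S)"
      using True by (auto simp: edges_in_def)
    ultimately show ?thesis
      using card_insert_le_m1[of "Suc (card (edges_in E S))" "edges_in E S" "{i, j}"] by simp
  next
    case False
    then have "edges_in (insert {i, j} E) S = edges_in E S" by (auto simp: edges_in_def)
    then show ?thesis using sparseD[OF assms(1) S] by simp
  qed
qed

text \<open>If every two neighbours lay in a tight set, uncrossing would produce a tight set containing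
  all three neighbours, and adding \<open>v\<close> to it would violate sparsity.\<close>

lemma sparse_loose_neighbour_pair:
  assumes graph: "sparse V E" "finite V" "simple_graph V E" and v: "v \<in> V" "card (neighbours E v) = 3"
  obtains i j k where "neighbours E v = {i, j, k}" "distinct [i, j, k]"
    "\<And>S. S \<subseteq> V - {v} \<Longrightarrow> {i, j} \<subseteq> S \<Longrightarrow> \<not> tight E S"
proof -
  let ?loose = "\<lambda>i j. \<forall>S\<subseteq>V - {v}. {i, j} \<subseteq> S \<longrightarrow> \<not> tight E S"
  obtain a b c where abc: "neighbours E v = {a, b, c}" "distinct [a, b, c]"
    using v(2) by (auto simp: card_3_iff)
  have "\<not> (\<exists>S\<subseteq>V - {v}. tight E S \<and> {a, b, c} \<subseteq> S)"
  proof
    assume "\<exists>S\<subseteq>V - {v}. tight E S \<and> {a, b, c} \<subseteq> S"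
    then obtain S where S: "S \<subseteq> V - {v}" "tight E S" "neighbours E v \<inter> S = neighbours E v"
      using abc(1) by blast
    then show False using card_neighbours_in_tight[OF graph v(1) _ _ S(2)] v(2) by auto
  qed
  then consider "?loose a b" | "?loose a c" | "?loose b c"
    using tight_hull_of_triple[OF graph Diff_subset abc(2), of "{v}"] by meson
  then show thesis
  proof cases
    case 1
    then show thesis using that[of a b c] abc by blast
  next
    case 2
    then show thesis using that[of a c b] abc by (auto simp: insert_commute)
  next
    case 3
    then show thesis using that[of b c a] abc by (auto simp: insert_commute)
  qed
qed

lemma tight_edge: "sparse V E \<Longrightarrow> finite E \<Longrightarrow> {i, j} \<subseteq> V \<Longrightarrow> i \<noteq> j \<Longrightarrow> {i, j} \<in> E \<Longrightarrow> tight E {i, j}"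
proof -
  assume "sparse V E" "finite E" and ij: "{i, j} \<subseteq> V" "i \<noteq> j" "{i, j} \<in> E"
  then have "card (edges_in E {i, j}) + 3 \<le> 2 * card {i, j}" by (intro sparseD[of V]) auto
  moreover have "{{i, j}} \<subseteq> edges_in E {i, j}" using ij(3) by (simp add: edges_in_def)
  from card_mono[OF finite_edges_in[OF \<open>finite E\<close>] this] have "card (edges_in E {i, j}) \<ge> 1" by simp
  ultimately show ?thesis using ij(2) by (simp add: tight_def)
qed

lemma laman_degree_three_split:
  assumes laman: "laman V E" and graph: "simple_graph V E"
    and v: "v \<in> V" "card (neighbours E v) = 3" and "card V \<ge> 3"
  obtains i j k where "neighbours E v = {i, j, k}" "distinct [i, j, k]"
    "{i, j} \<notin> E" "laman (V - {v}) (insert {i, j} (edges_in E (V - {v})))"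
proof -
  let ?V = "V - {v}" and ?E = "edges_in E (V - {v})"
  note sparse = laman_imp_sparse[OF laman graph]
  have finite: "finite V" "finite E" using laman_finite[OF laman] simple_graph_finite[OF graph]
    by auto
  obtain i j k where ijk: "neighbours E v = {i, j, k}" "distinct [i, j, k]"
    and loose: "\<And>S. S \<subseteq> ?V \<Longrightarrow> {i, j} \<subseteq> S \<Longrightarrow> \<not> tight E S"
    using sparse_loose_neighbour_pair[OF sparse finite(1) graph v] by blast
  have ij: "{i, j} \<subseteq> ?V" using neighbours_subset[OF graph, of v] ijk(1) by blast
  have "{i, j} \<notin> E"
    using tight_edge[OF sparse finite(2), of i j] loose[OF ij] ij ijk(2) by auto
  moreover have "card (insert {i, j} ?E) = 2 * card ?V - 3"
    using card_edges_remove_vertex[OF graph finite(1) v(1)] laman_card_edges[OF laman]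
      v \<open>card V \<ge> 3\<close> finite
      finite_edges_in[OF finite(2)] \<open>{i, j} \<notin> E\<close>
    by (simp add: edges_in_def)
  moreover have "simple_graph ?V (insert {i, j} ?E)"
    using simple_graph_edges_in[OF graph, of ?V] ij ijk(2) unfolding simple_graph_def by auto
  moreover have "sparse ?V (insert {i, j} ?E)"
    using loose sparse_edges_in[OF sparse, of ?V]
    by (intro sparse_insert_edge finite_edges_in finite(2)) (auto simp: tight_edges_in)
  ultimately show thesis using that[OF ijk] laman_iff_sparse[of ?V] finite(1) by blast
qed

lemma laman_on_pair_imp_henneberg:
  assumes "laman V E" "simple_graph V E" "card V = 2"
  shows "henneberg V E"
proof -
  obtain a b where V: "V = {a, b}" "a \<noteq> b" using assms(3) by (auto simp: card_2_iff)
  have "E \<subseteq> {{a, b}}" using assms(2) V(1) by (auto elim!: simple_graphE)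
  moreover have "E \<noteq> {}" using laman_card_edges[OF assms(1)] assms(3) by auto
  ultimately have "E = {{a, b}}" by auto
  then show ?thesis using V henneberg.K2 by auto
qed

lemma laman_imp_henneberg:
  assumes "laman V E" "simple_graph V E" "card V \<ge> 2"
  shows "henneberg V E"
  using assms
proof (induction "card V" arbitrary: V E rule: less_induct)
  case less
  note laman = less.prems(1) and graph = less.prems(2)
  show ?case
  proof (cases "card V = 2")
    case True
    then show ?thesis by (rule laman_on_pair_imp_henneberg[OF laman graph])
  next
    case False
    then have n3: "card V \<ge> 3" using less.prems(3) by simp
    obtain v where v: "v \<in> V" "card (neighbours E v) = 2 \<or> card (neighbours E v) = 3"
      using laman_low_degree_vertex[OF laman graph n3] .
    let ?V = "V - {v}" and ?E = "edges_in E (V - {v})"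
    have V: "card ?V < card V" "card ?V \<ge> 2" "insert v ?V = V"
      using v laman_finite[OF laman] n3 by auto
    have nbrs: "neighbours E v \<subseteq> ?V" by (rule neighbours_subset[OF graph])
    have E: "?E \<union> (\<lambda>u. {v, u}) ` neighbours E v = E"
      using edges_in_insert[OF graph, of v ?V] edges_in_all[OF graph] nbrs V(3)
        by (simp add: Int_absorb2)
    from v(2) show ?thesis
    proof
      assume deg: "card (neighbours E v) = 2"
      then obtain a b where ab: "neighbours E v = {a, b}" "a \<noteq> b" by (auto simp: card_2_iff)
      have "henneberg ?V ?E"
        using laman_remove_degree_two[OF laman graph v(1) deg n3] simple_graph_edges_in[OF graph] V
        by (intro less.hyps)
      then have "henneberg (insert v ?V) (?E \<union> {{v, a}, {v, b}})"
        using ab nbrs by (intro henneberg.move1) auto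
      then show ?thesis using E V(3) ab(1) by simp
    next
      assume "card (neighbours E v) = 3"
      then obtain i j k where ijk: "neighbours E v = {i, j, k}" "distinct [i, j, k]"
        and ij: "{i, j} \<notin> E" "laman ?V (insert {i, j} ?E)"
        using laman_degree_three_split[OF laman graph v(1) _ n3] by metis
      have "simple_graph ?V (insert {i, j} ?E)"
        using simple_graph_edges_in[OF graph, of ?V] nbrs ijk unfolding simple_graph_def by auto
      then have "henneberg ?V (insert {i, j} ?E)" using ij(2) V by (intro less.hyps)
      then have "henneberg (insert v ?V) (insert {i, j} ?E - {{i, j}} \<union> {{v, i}, {v, j}, {v, k}})"
        using ijk nbrs by (intro henneberg.move2) auto
      moreover have "insert {i, j} ?E - {{i, j}} = ?E" using ij(1) edges_in_subset[of E ?V] by auto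
      ultimately show ?thesis using E V(3) ijk(1) by simp
    qed
  qed
qed

section \<open>Fraction-free elimination\<close>

definition indep_rows :: "'r set \<Rightarrow> 'c set \<Rightarrow> ('r \<Rightarrow> 'c \<Rightarrow> 'f::field) \<Rightarrow> bool" where
  "indep_rows R C M \<longleftrightarrow> (\<forall>l. (\<forall>c\<in>C. (\<Sum>r\<in>R. l r * M r c) = 0) \<longrightarrow> (\<forall>r\<in>R. l r = 0))"

definition pivot :: "('r \<Rightarrow> 'c \<Rightarrow> 'f::field) \<Rightarrow> 'r \<Rightarrow> 'c \<Rightarrow> 'r \<Rightarrow> 'c \<Rightarrow> 'f" where
  "pivot M r0 c0 r c = M r0 c0 * M r c - M r c0 * M r0 c"

lemma indep_rowsD:
  assumes "indep_rows R C M" "\<And>c. c \<in> C \<Longrightarrow> (\<Sum>r\<in>R. l r * M r c) = 0" "r \<in> R"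
  shows "l r = 0"
  using assms unfolding indep_rows_def by blast

lemma indep_rows_nonzero_entry:
  assumes "finite R" "r0 \<in> R" "indep_rows R C M"
  obtains c where "c \<in> C" "M r0 c \<noteq> 0"
proof -
  have "\<not> (\<forall>c\<in>C. M r0 c = 0)"
  proof
    assume "\<forall>c\<in>C. M r0 c = 0"
    then have "(\<Sum>r\<in>R. (if r = r0 then 1 else 0) * M r c) = 0" if "c \<in> C" for c
      using that by (intro sum.neutral) auto
    from indep_rowsD[OF assms(3) this assms(2)] show False by simp
  qed
  then show thesis using that by blast
qed

lemma indep_rows_subset:
  assumes "finite R" "R' \<subseteq> R" "indep_rows R C M"
  shows "indep_rows R' C M"
  unfolding indep_rows_def
proof (intro allI impI ballI)
  fix l r assume l: "\<forall>c\<in>C. (\<Sum>r\<in>R'. l r * M r c) = 0" and r: "r \<in> R'"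
  have "(\<Sum>r\<in>R. (if r \<in> R' then l r else 0) * M r c) = (\<Sum>r\<in>R'. l r * M r c)" for c
    using assms by (intro sum.mono_neutral_cong_right) auto
  from indep_rowsD[OF assms(3), of "\<lambda>r. if r \<in> R' then l r else 0" r, unfolded this] l r assms(2)
  show "l r = 0" by auto
qed

lemma sum_pivot:
  "(\<Sum>r\<in>R. l r * pivot M r0 c0 r c) = M r0 c0 * (\<Sum>r\<in>R. l r * M r c) - (\<Sum>r\<in>R. l r * M r c0) * M r0 c"
  by (simp add: pivot_def algebra_simps sum_subtractf sum_distrib_left)

lemma indep_rows_imp_pivot:
  assumes R: "finite R" "r0 \<notin> R" and c0: "M r0 c0 \<noteq> 0" and indep: "indep_rows (insert r0 R) C M"
  shows "indep_rows R (C - {c0}) (pivot M r0 c0)"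
  unfolding indep_rows_def
proof (intro allI impI ballI)
  fix l r assume l: "\<forall>c\<in>C - {c0}. (\<Sum>r\<in>R. l r * pivot M r0 c0 r c) = 0" and r: "r \<in> R"
  define l' where "l' r = (if r = r0 then - (\<Sum>s\<in>R. l s * M s c0) else M r0 c0 * l r)" for r
  have "(\<Sum>r\<in>insert r0 R. l' r * M r c) = 0" if "c \<in> C" for c
  proof -
    have "(\<Sum>r\<in>R. l' r * M r c) = (\<Sum>r\<in>R. M r0 c0 * (l r * M r c))"
      using R(2) by (intro sum.cong) (auto simp: l'_def)
    then have "(\<Sum>r\<in>insert r0 R. l' r * M r c) = (\<Sum>r\<in>R. l r * pivot M r0 c0 r c)"
      using R by (simp add: l'_def sum_pivot sum_distrib_left)
    also have "\<dots> = 0" using l that by (cases "c = c0") (auto simp: pivot_def)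
    finally show ?thesis .
  qed
  from indep_rowsD[OF indep this, of r] r have "l' r = 0" by auto
  then show "l r = 0" using r R(2) c0 by (auto simp: l'_def split: if_splits)
qed

lemma pivot_imp_indep_rows:
  assumes R: "finite R" "r0 \<notin> R" and c0: "c0 \<in> C" "M r0 c0 \<noteq> 0"
    and indep: "indep_rows R (C - {c0}) (pivot M r0 c0)"
  shows "indep_rows (insert r0 R) C M"
  unfolding indep_rows_def
proof (intro allI impI)
  fix l assume l: "\<forall>c\<in>C. (\<Sum>r\<in>insert r0 R. l r * M r c) = 0"
  have row: "(\<Sum>r\<in>R. l r * M r c) = - l r0 * M r0 c" if "c \<in> C" for c
    using l that R by (simp add: eq_neg_iff_add_eq_0 add.commute)
  have "(\<Sum>r\<in>R. l r * pivot M r0 c0 r c) = 0" if "c \<in> C - {c0}" for c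
    unfolding sum_pivot using row[of c] row[of c0] that c0 by simp
  then have zero: "l r = 0" if "r \<in> R" for r using indep_rowsD[OF indep] that by blast
  then have "l r0 * M r0 c0 = 0" using row[OF c0(1)] by simp
  then show "\<forall>r\<in>insert r0 R. l r = 0" using zero c0 by auto
qed

lemma indep_rows_card_le:
  assumes "finite R" "finite C" "indep_rows R C M"
  shows "card R \<le> card C"
  using assms
proof (induction R arbitrary: C M rule: finite_induct)
  case (insert r0 R)
  obtain c0 where c0: "c0 \<in> C" "M r0 c0 \<noteq> 0"
    using indep_rows_nonzero_entry[OF _ _ insert.prems(2), of r0] insert.hyps(1) by auto
  have "card R \<le> card (C - {c0})"
    using indep_rows_imp_pivot[OF insert.hyps c0(2) insert.prems(2)] insert.prems(1)
      by (intro insert.IH) auto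
  then show ?case using insert.hyps insert.prems(1) card.remove[OF insert.prems(1) c0(1)] by simp
qed auto

lemma indep_rows_maximal_subset:
  assumes "finite R"
  obtains F where "F \<subseteq> R" "indep_rows F C M" "\<And>r. r \<in> R - F \<Longrightarrow> \<not> indep_rows (insert r F) C M"
proof -
  let ?I = "\<lambda>F. F \<subseteq> R \<and> indep_rows F C M"
  have empty: "?I {}" by (simp add: indep_rows_def)
  have bound: "\<forall>F. ?I F \<longrightarrow> card F < Suc (card R)"
    using assms by (auto simp: less_Suc_eq_le intro: card_mono)
  obtain F where F: "?I F" and max: "\<And>G. ?I G \<Longrightarrow> card G \<le> card F"
    using Lattices_Big.ex_has_greatest_nat[of ?I "{}" card, OF empty bound] by blast
  have "finite F" using F assms finite_subset by blast
  then have "\<not> indep_rows (insert r F) C M" if "r \<in> R - F" for r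
    using max[of "insert r F"] that F by auto
  then show thesis using that F by blast
qed

lemma sum_combination_swap:
  fixes M :: "'r \<Rightarrow> 'c \<Rightarrow> 'f::comm_semiring_0"
  shows "(\<Sum>c\<in>C. (\<Sum>r\<in>R. l r * M r c) * k c) = (\<Sum>r\<in>R. l r * (\<Sum>c\<in>C. M r c * k c))"
  unfolding sum_distrib_right sum_distrib_left mult.assoc by (rule sum.swap)

lemma dependent_row_kernel:
  assumes "finite F" "e \<notin> F" "indep_rows F C M" "\<not> indep_rows (insert e F) C M"
    and kernel: "\<And>f. f \<in> F \<Longrightarrow> (\<Sum>c\<in>C. M f c * k c) = 0"
  shows "(\<Sum>c\<in>C. M e c * k c) = 0"
proof -
  obtain l where l: "\<And>c. c \<in> C \<Longrightarrow> (\<Sum>r\<in>insert e F. l r * M r c) = 0" "\<exists>r\<in>insert e F. l r \<noteq> 0"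
    using assms(4) unfolding indep_rows_def by blast
  have "l e \<noteq> 0"
  proof
    assume "l e = 0"
    then have "(\<Sum>r\<in>F. l r * M r c) = 0" if "c \<in> C" for c using l(1)[OF that] assms(1,2) by simp
    then have "\<forall>r\<in>F. l r = 0" using indep_rowsD[OF assms(3)] by blast
    then show False using l(2) \<open>l e = 0\<close> by auto
  qed
  have "0 = (\<Sum>c\<in>C. (\<Sum>r\<in>insert e F. l r * M r c) * k c)" using l(1) by simp
  also have "\<dots> = l e * (\<Sum>c\<in>C. M e c * k c)"
    unfolding sum_combination_swap using assms(1,2) kernel by simp
  finally show ?thesis using \<open>l e \<noteq> 0\<close> by simp
qed

section \<open>Matrices of polynomial expressions\<close>

abbreviation PSub :: "'v pexpr \<Rightarrow> 'v pexpr \<Rightarrow> 'v pexpr" where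
  "PSub a b \<equiv> PAdd a (PNeg b)"

abbreviation (input) eval_matrix :: "('v \<Rightarrow> real) \<Rightarrow> ('r \<Rightarrow> 'c \<Rightarrow> 'v pexpr) \<Rightarrow> 'r \<Rightarrow> 'c \<Rightarrow> real" where
  "eval_matrix x A \<equiv> (\<lambda>r c. peval x (A r c))"

definition pexpr_pivot :: "('r \<Rightarrow> 'c \<Rightarrow> 'v pexpr) \<Rightarrow> 'r \<Rightarrow> 'c \<Rightarrow> 'r \<Rightarrow> 'c \<Rightarrow> 'v pexpr" where
  "pexpr_pivot A r0 c0 r c = PSub (PMul (A r0 c0) (A r c)) (PMul (A r c0) (A r0 c))"

lemma eval_matrix_pexpr_pivot:
  "eval_matrix x (pexpr_pivot A r0 c0) = pivot (eval_matrix x A) r0 c0"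
  by (simp add: fun_eq_iff pexpr_pivot_def pivot_def)

lemma elimination_induct [consumes 2, case_names empty pivot]:
  assumes "finite R" "indep_rows R C (eval_matrix x0 A)"
    and empty: "\<And>C A. P {} C A"
    and pivot: "\<And>R C A r0 c0. finite R \<Longrightarrow> r0 \<notin> R \<Longrightarrow> c0 \<in> C \<Longrightarrow> peval x0 (A r0 c0) \<noteq> 0 \<Longrightarrow>
      P R (C - {c0}) (pexpr_pivot A r0 c0) \<Longrightarrow> P (insert r0 R) C A"
  shows "P R C A"
  using assms(1,2)
proof (induction R arbitrary: C A rule: finite_induct)
  case (insert r0 R)
  obtain c0 where c0: "c0 \<in> C" "peval x0 (A r0 c0) \<noteq> 0"
    using indep_rows_nonzero_entry[OF _ _ insert.prems, of r0] insert.hyps(1) by auto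
  have "indep_rows R (C - {c0}) (eval_matrix x0 (pexpr_pivot A r0 c0))"
    unfolding eval_matrix_pexpr_pivot using insert.hyps c0 insert.prems
      by (intro indep_rows_imp_pivot)
  then show ?case using insert.hyps c0 insert.IH by (intro pivot[of R r0 c0])
qed (rule empty)

lemma indep_rows_certificate:
  assumes "finite R" "indep_rows R C (eval_matrix x0 A)" "\<And>r c. r \<in> R \<Longrightarrow> c \<in> C \<Longrightarrow> pvars (A r c) \<subseteq> W"
  obtains D where "pvars D \<subseteq> W" "peval x0 D \<noteq> 0"
    "\<And>x. peval x D \<noteq> 0 \<Longrightarrow> indep_rows R C (eval_matrix x A)"
proof -
  have "(\<forall>r\<in>R. \<forall>c\<in>C. pvars (A r c) \<subseteq> W) \<longrightarrow> (\<exists>D. pvars D \<subseteq> W \<and> peval x0 D \<noteq> 0 \<and>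
      (\<forall>x. peval x D \<noteq> 0 \<longrightarrow> indep_rows R C (eval_matrix x A)))"
    using assms(1,2)
  proof (induction R C A rule: elimination_induct)
    case (empty C A)
    show ?case by (intro impI exI[of _ "PConst 1"]) (auto simp: indep_rows_def)
  next
    case (pivot R C A r0 c0)
    show ?case
    proof
      assume vars: "\<forall>r\<in>insert r0 R. \<forall>c\<in>C. pvars (A r c) \<subseteq> W"
      then have "\<forall>r\<in>R. \<forall>c\<in>C - {c0}. pvars (pexpr_pivot A r0 c0 r c) \<subseteq> W"
        using pivot.hyps(3) by (simp add: pexpr_pivot_def)
      then obtain D where D: "pvars D \<subseteq> W" "peval x0 D \<noteq> 0"
        "\<And>x. peval x D \<noteq> 0 \<Longrightarrow> indep_rows R (C - {c0}) (pivot (eval_matrix x A) r0 c0)"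
        using pivot.IH unfolding eval_matrix_pexpr_pivot by blast
      have "indep_rows (insert r0 R) C (eval_matrix x A)" if "peval x (PMul (A r0 c0) D) \<noteq> 0" for x
        using that D(3) pivot.hyps by (intro pivot_imp_indep_rows[of R r0 c0]) auto
      moreover have "pvars (PMul (A r0 c0) D) \<subseteq> W" using D(1) vars pivot.hyps(3) by simp
      moreover have "peval x0 (PMul (A r0 c0) D) \<noteq> 0" using D(2) pivot.hyps(4) by simp
      ultimately show "\<exists>D. pvars D \<subseteq> W \<and> peval x0 D \<noteq> 0 \<and>
          (\<forall>x. peval x D \<noteq> 0 \<longrightarrow> indep_rows (insert r0 R) C (eval_matrix x A))" by blast
    qed
  qed
  then show thesis using that assms(3) by blast
qed

lemma pexpr_sum_exists:
  assumes "finite C"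
  obtains s where "\<And>x. peval x s = (\<Sum>c\<in>C. peval x (f c))"
proof -
  have "\<exists>s. \<forall>x. peval x s = (\<Sum>c\<in>C. peval x (f c))"
    using assms
  proof (induction C rule: finite_induct)
    case empty
    show ?case by (intro exI[of _ "PConst 0"]) simp
  next
    case (insert c C)
    then obtain s where "\<forall>x. peval x s = (\<Sum>c\<in>C. peval x (f c))" by blast
    then show ?case using insert.hyps by (intro exI[of _ "PAdd (f c) s"]) simp
  qed
  then show thesis using that by blast
qed

lemma pivot_kernel_extend:
  assumes "finite C" "c0 \<in> C"
  obtains k where
    "\<And>x. \<forall>r. (\<Sum>c\<in>C. peval x (A r c) * peval x (k c)) =
        (\<Sum>c\<in>C - {c0}. peval x (pexpr_pivot A r0 c0 r c) * peval x (K c))"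
    "\<And>c. c \<noteq> c0 \<Longrightarrow> k c = PMul (A r0 c0) (K c)"
proof -
  obtain s where s: "\<And>x. peval x s = (\<Sum>c\<in>C - {c0}. peval x (PMul (A r0 c) (K c)))"
    using pexpr_sum_exists[of "C - {c0}" "\<lambda>c. PMul (A r0 c) (K c)"] assms(1) by auto
  define k where "k c = (if c = c0 then PNeg s else PMul (A r0 c0) (K c))" for c
  have "(\<Sum>c\<in>C. peval x (A r c) * peval x (k c)) =
      (\<Sum>c\<in>C - {c0}. peval x (pexpr_pivot A r0 c0 r c) * peval x (K c))" for x r
  proof -
    have "(\<Sum>c\<in>C - {c0}. peval x (A r c) * peval x (k c)) =
       (\<Sum>c\<in>C - {c0}. peval x (A r c) * (peval x (A r0 c0) * peval x (K c)))"
      by (intro sum.cong) (auto simp: k_def)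
    moreover have "(\<Sum>c\<in>C. peval x (A r c) * peval x (k c)) = peval x (A r c0) * peval x (k c0) +
       (\<Sum>c\<in>C - {c0}. peval x (A r c) * peval x (k c))"
      using assms by (rule sum.remove)
    ultimately show ?thesis
      by (simp add: k_def s pexpr_pivot_def algebra_simps sum_distrib_left sum_subtractf
          sum.distrib sum_negf)
  qed
  then show thesis using that[of k] by (simp add: k_def)
qed

lemma polynomial_kernel_vector:
  assumes "finite R" "indep_rows R C (eval_matrix x0 A)" "finite C" "card R < card C"
  obtains K where "\<And>x r. r \<in> R \<Longrightarrow> (\<Sum>c\<in>C. peval x (A r c) * peval x (K c)) = 0"
    "\<exists>c\<in>C. peval x0 (K c) \<noteq> 0"
proof -
  have "finite C \<longrightarrow> card R < card C \<longrightarrow>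
      (\<exists>K. (\<forall>x. \<forall>r\<in>R. (\<Sum>c\<in>C. peval x (A r c) * peval x (K c)) = 0) \<and> (\<exists>c\<in>C. peval x0 (K c) \<noteq> 0))"
    using assms(1,2)
  proof (induction R C A rule: elimination_induct)
    case (empty C A)
    show ?case by (intro impI exI[of _ "\<lambda>_. PConst 1"]) (auto simp: card_gt_0_iff)
  next
    case (pivot R C A r0 c0)
    show ?case
    proof (intro impI)
      assume C: "finite C" "card (insert r0 R) < card C"
      then have "card R < card (C - {c0})" using pivot.hyps by simp
      then obtain K
        where K: "\<And>x r. r \<in> R \<Longrightarrow> (\<Sum>c\<in>C - {c0}. peval x (pexpr_pivot A r0 c0 r c) * peval x (K c)) = 0"
        "\<exists>c\<in>C - {c0}. peval x0 (K c) \<noteq> 0"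
        using pivot.IH C(1) by blast
      then obtain c1 where c1: "c1 \<in> C" "c1 \<noteq> c0" "peval x0 (K c1) \<noteq> 0" by blast
      obtain k where k: "\<And>x. \<forall>r. (\<Sum>c\<in>C. peval x (A r c) * peval x (k c)) =
          (\<Sum>c\<in>C - {c0}. peval x (pexpr_pivot A r0 c0 r c) * peval x (K c))"
        "\<And>c. c \<noteq> c0 \<Longrightarrow> k c = PMul (A r0 c0) (K c)"
        using pivot_kernel_extend[OF C(1) pivot.hyps(3), of A r0 K] by blast
      have "(\<Sum>c\<in>C. peval x (A r c) * peval x (k c)) = 0" if "r \<in> insert r0 R" for x r
      proof (cases "r = r0")
        case True
        then show ?thesis unfolding k(1)[rule_format]
          by (intro sum.neutral) (auto simp: pexpr_pivot_def)
      qed (use that K(1) k(1) in auto)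
      moreover have "\<exists>c\<in>C. peval x0 (k c) \<noteq> 0" using c1 k(2)[of c1] pivot.hyps(4)
        by (intro bexI[of _ c1]) auto
      ultimately show "\<exists>K. (\<forall>x. \<forall>r\<in>insert r0 R. (\<Sum>c\<in>C. peval x (A r c) * peval x (K c)) = 0) \<and>
          (\<exists>c\<in>C. peval x0 (K c) \<noteq> 0)" by blast
    qed
  qed
  then show thesis using that assms(3,4) by blast
qed

section \<open>Algebraically independent points\<close>

instance pexpr :: (countable) countable
  by countable_datatype

lemma countable_pexprs_on:
  assumes "countable W"
  shows "countable {e. pvars e \<subseteq> W}"
proof -
  have set: "set_pexpr e = pvars e" for e :: "'v pexpr" by (induction e) auto
  have "e = map_pexpr (from_nat_into W) (map_pexpr (to_nat_on W) e)" if "pvars e \<subseteq> W" for e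
  proof -
    have "map_pexpr (from_nat_into W \<circ> to_nat_on W) e = map_pexpr id e"
      using that assms by (intro pexpr.map_cong0) (auto simp: set subset_iff)
    then show ?thesis by (simp add: pexpr.map_comp pexpr.map_id)
  qed
  then have "{e. pvars e \<subseteq> W} \<subseteq> range (map_pexpr (from_nat_into W))" by blast
  then show ?thesis by (rule countable_subset) (intro countable_image, simp)
qed

fun psubst :: "'v \<Rightarrow> rat \<Rightarrow> 'v pexpr \<Rightarrow> 'v pexpr" where
  "psubst v c (PConst d) = PConst d"
| "psubst v c (PVar u) = (if u = v then PConst c else PVar u)"
| "psubst v c (PAdd a b) = PAdd (psubst v c a) (psubst v c b)"
| "psubst v c (PMul a b) = PMul (psubst v c a) (psubst v c b)"
| "psubst v c (PNeg a) = PNeg (psubst v c a)"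

lemma peval_psubst: "peval x (psubst v c e) = peval (x(v := of_rat c)) e"
  by (induction e) auto

lemma pvars_psubst: "pvars (psubst v c e) \<subseteq> pvars e - {v}"
  by (induction e) auto

fun poly_in :: "'v \<Rightarrow> ('v \<Rightarrow> real) \<Rightarrow> 'v pexpr \<Rightarrow> real poly" where
  "poly_in v x (PConst c) = [:of_rat c:]"
| "poly_in v x (PVar u) = (if u = v then [:0, 1:] else [:x u:])"
| "poly_in v x (PAdd a b) = poly_in v x a + poly_in v x b"
| "poly_in v x (PMul a b) = poly_in v x a * poly_in v x b"
| "poly_in v x (PNeg a) = - poly_in v x a"

lemma poly_poly_in: "poly (poly_in v x e) t = peval (x(v := t)) e"
  by (induction e) auto

lemma poly_eq_0_if_zero_on_rats:
  fixes P :: "real poly"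
  assumes "\<And>c. poly P (of_rat c) = 0"
  shows "P = 0"
proof (rule ccontr)
  assume "P \<noteq> 0"
  then have "finite {t. poly P t = 0}" by (rule poly_roots_finite)
  moreover have "range (of_rat :: rat \<Rightarrow> real) \<subseteq> {t. poly P t = 0}" using assms by auto
  moreover have "infinite (range (of_rat :: rat \<Rightarrow> real))"
    using finite_imageD[of "of_rat :: rat \<Rightarrow> real" UNIV] infinite_UNIV_char_0[where 'a=rat]
    by (auto simp: inj_on_def)
  ultimately show False using finite_subset by blast
qed

definition alg_independent_on :: "'v set \<Rightarrow> ('v \<Rightarrow> real) \<Rightarrow> bool" where
  "alg_independent_on W x \<longleftrightarrow> (\<forall>e. pvars e \<subseteq> W \<longrightarrow> peval x e = 0 \<longrightarrow> (\<forall>y. peval y e = 0))"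

lemma alg_independent_onD:
  assumes "alg_independent_on W x" "pvars e \<subseteq> W" "peval y e \<noteq> 0"
  shows "peval x e \<noteq> 0"
  using assms unfolding alg_independent_on_def by blast

lemma finite_zeros_over_alg_independent:
  assumes x: "alg_independent_on W x" and e: "pvars e \<subseteq> insert v W" "peval y e \<noteq> 0"
  shows "finite {t. peval (x(v := t)) e = 0}"
proof -
  have "poly_in v y e \<noteq> 0" using e(2) poly_poly_in[of v y e "y v"] by auto
  then obtain c where "poly (poly_in v y e) (of_rat c) \<noteq> 0" using poly_eq_0_if_zero_on_rats by blast
  then have "peval y (psubst v c e) \<noteq> 0" by (simp add: poly_poly_in peval_psubst)
  then have "peval x (psubst v c e) \<noteq> 0"
    using alg_independent_onD[OF x, of "psubst v c e" y] pvars_psubst[of v c e] e(1) by blast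
  then have "poly_in v x e \<noteq> 0" using poly_poly_in[of v x e "of_rat c"] by (auto simp: peval_psubst)
  from poly_roots_finite[OF this] show ?thesis by (simp add: poly_poly_in)
qed

lemma alg_independent_on_exists:
  fixes W :: "'v set"
  assumes "finite W"
  shows "\<exists>x. alg_independent_on W x"
  using assms
proof (induction W rule: finite_induct)
  case empty
  have "peval y e = peval x e" if "pvars e = {}" for e :: "'v pexpr" and x y
    using that by (induction e) auto
  then show ?case unfolding alg_independent_on_def by (metis subset_empty)
next
  case (insert v W)
  then obtain x where x: "alg_independent_on W x" by blast
  define N where "N = {e :: 'v pexpr. pvars e \<subseteq> insert v W \<and> (\<exists>y. peval y e \<noteq> 0)}"
  have "countable N"
    using insert.hyps by (intro countable_subset[OF _ countable_pexprs_on[of "insert v W"]])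
      (auto simp: N_def countable_finite)
  moreover have "finite {t. peval (x(v := t)) e = 0}" if "e \<in> N" for e
    using finite_zeros_over_alg_independent[OF x] that by (auto simp: N_def)
  ultimately have "countable (\<Union>e\<in>N. {t. peval (x(v := t)) e = 0})"
    by (intro countable_UN) (auto intro: countable_finite)
  then have "(\<Union>e\<in>N. {t. peval (x(v := t)) e = 0}) \<noteq> UNIV"
    using uncountable_UNIV_real by metis
  then obtain t where "t \<notin> (\<Union>e\<in>N. {t. peval (x(v := t)) e = 0})" by blast
  then have "alg_independent_on (insert v W) (x(v := t))"
    unfolding alg_independent_on_def N_def by blast
  then show ?case by blast
qed

section \<open>Polynomials near a point\<close>

lemma eventually_uniformly_on:
  "eventually P (uniformly_on S f) \<longleftrightarrow> (\<exists>d>0. \<forall>g. (\<forall>x\<in>S. dist (g x) (f x) < d) \<longrightarrow> P g)"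
  unfolding uniformly_on_def
  by (subst eventually_INF_base)
    (fastforce simp: eventually_principal intro: bexI[where x="min a b" for a b])+

lemma eventually_uniformly_on_subset:
  "eventually P (uniformly_on S f) \<Longrightarrow> S \<subseteq> T \<Longrightarrow> eventually P (uniformly_on T f)"
  unfolding eventually_uniformly_on by (meson subsetD)

lemma tendsto_uniformly_on: "x \<in> S \<Longrightarrow> ((\<lambda>g. g x) \<longlongrightarrow> f x) (uniformly_on S f)"
  unfolding tendsto_iff eventually_uniformly_on by blast

lemma tendsto_peval:
  assumes "\<And>v. v \<in> pvars e \<Longrightarrow> ((\<lambda>i. x i v) \<longlongrightarrow> x0 v) F"
  shows "((\<lambda>i. peval (x i) e) \<longlongrightarrow> peval x0 e) F"
  using assms by (induction e) (auto intro!: tendsto_intros)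

definition bounded_lipschitz_near :: "('v \<Rightarrow> real) \<Rightarrow> real \<Rightarrow> (('v \<Rightarrow> real) \<Rightarrow> real) \<Rightarrow> bool" where
  "bounded_lipschitz_near x0 L f \<longleftrightarrow>
    (\<forall>x y d. (\<forall>v. \<bar>x v - x0 v\<bar> \<le> 1) \<longrightarrow> (\<forall>v. \<bar>y v - x0 v\<bar> \<le> 1) \<longrightarrow> (\<forall>v. \<bar>x v - y v\<bar> \<le> d) \<longrightarrow>
      \<bar>f x\<bar> \<le> L \<and> \<bar>f x - f y\<bar> \<le> L * d)"

lemma bounded_lipschitz_nearI:
  assumes "\<And>x y d. \<lbrakk>\<And>v. \<bar>x v - x0 v\<bar> \<le> 1; \<And>v. \<bar>y v - x0 v\<bar> \<le> 1; \<And>v. \<bar>x v - y v\<bar> \<le> d; 0 \<le> d\<rbrakk> \<Longrightarrow>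
    \<bar>f x\<bar> \<le> L \<and> \<bar>f x - f y\<bar> \<le> L * d"
  shows "bounded_lipschitz_near x0 L f"
  unfolding bounded_lipschitz_near_def
proof (intro allI impI assms)
  fix x y :: "'a \<Rightarrow> real" and d assume "\<forall>v. \<bar>x v - y v\<bar> \<le> d"
  then show "0 \<le> d" using abs_ge_zero order_trans by blast
qed auto

lemma bounded_lipschitz_near_bound:
  assumes "bounded_lipschitz_near x0 L f" "\<And>v. \<bar>x v - x0 v\<bar> \<le> 1"
  shows "\<bar>f x\<bar> \<le> L"
  using assms(1)[unfolded bounded_lipschitz_near_def, rule_format, of x x 0] assms(2) by simp

lemma bounded_lipschitz_near_diff:
  assumes "bounded_lipschitz_near x0 L f" "\<And>v. \<bar>x v - x0 v\<bar> \<le> 1" "\<And>v. \<bar>y v - x0 v\<bar> \<le> 1"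
    "\<And>v. \<bar>x v - y v\<bar> \<le> d"
  shows "\<bar>f x - f y\<bar> \<le> L * d"
  using assms unfolding bounded_lipschitz_near_def by blast

lemma bounded_lipschitz_near_nonneg: "bounded_lipschitz_near x0 L f \<Longrightarrow> 0 \<le> L"
  using bounded_lipschitz_near_bound[of x0 L f x0] by (simp add: order_trans[OF abs_ge_zero])

lemma bounded_lipschitz_near_mono:
  assumes "bounded_lipschitz_near x0 L f" "L \<le> L'"
  shows "bounded_lipschitz_near x0 L' f"
proof (rule bounded_lipschitz_nearI)
  fix x y d
  assume "\<And>v. \<bar>x v - x0 v\<bar> \<le> 1" "\<And>v. \<bar>y v - x0 v\<bar> \<le> 1" "\<And>v. \<bar>x v - y v\<bar> \<le> d" "0 \<le> d"
  then show "\<bar>f x\<bar> \<le> L' \<and> \<bar>f x - f y\<bar> \<le> L' * d"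
    using bounded_lipschitz_near_bound[OF assms(1), of x]
      bounded_lipschitz_near_diff[OF assms(1), of x y d]
      assms(2) mult_right_mono[of L L' d] by fastforce
qed

lemma bounded_lipschitz_near_add:
  assumes "bounded_lipschitz_near x0 L f" "bounded_lipschitz_near x0 M g"
  shows "bounded_lipschitz_near x0 (L + M) (\<lambda>x. f x + g x)"
proof (rule bounded_lipschitz_nearI)
  fix x y d
  assume near: "\<And>v. \<bar>x v - x0 v\<bar> \<le> 1" "\<And>v. \<bar>y v - x0 v\<bar> \<le> 1" "\<And>v. \<bar>x v - y v\<bar> \<le> d"
  show "\<bar>f x + g x\<bar> \<le> L + M \<and> \<bar>f x + g x - (f y + g y)\<bar> \<le> (L + M) * d"
    using bounded_lipschitz_near_bound[OF assms(1) near(1)]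
      bounded_lipschitz_near_bound[OF assms(2) near(1)]
      bounded_lipschitz_near_diff[OF assms(1) near] bounded_lipschitz_near_diff[OF assms(2) near]
    unfolding distrib_right by linarith
qed

lemma bounded_lipschitz_near_mult:
  assumes "bounded_lipschitz_near x0 L f" "bounded_lipschitz_near x0 M g"
  shows "bounded_lipschitz_near x0 (2 * L * M) (\<lambda>x. f x * g x)"
proof (rule bounded_lipschitz_nearI)
  fix x y d
  assume near: "\<And>v. \<bar>x v - x0 v\<bar> \<le> 1" "\<And>v. \<bar>y v - x0 v\<bar> \<le> 1" "\<And>v. \<bar>x v - y v\<bar> \<le> d" and "0 \<le> d"
  note f = bounded_lipschitz_near_bound[OF assms(1)] bounded_lipschitz_near_diff[OF assms(1) near]
  note g = bounded_lipschitz_near_bound[OF assms(2)] bounded_lipschitz_near_diff[OF assms(2) near]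
  have LM: "0 \<le> L" "0 \<le> M" using assms bounded_lipschitz_near_nonneg by blast+
  have "\<bar>f x * g x\<bar> \<le> L * M"
    unfolding abs_mult using f(1) g(1) near(1) LM by (intro mult_mono) auto
  moreover have "0 \<le> L * M" using LM by simp
  moreover have "\<bar>f x * g x - f y * g y\<bar> \<le> 2 * L * M * d"
  proof -
    have "f x * g x - f y * g y = (f x - f y) * g x + f y * (g x - g y)" by (simp add: algebra_simps)
    also have "\<bar>\<dots>\<bar> \<le> \<bar>f x - f y\<bar> * \<bar>g x\<bar> + \<bar>f y\<bar> * \<bar>g x - g y\<bar>"
      by (metis abs_mult abs_triangle_ineq)
    also have "\<dots> \<le> (L * d) * M + L * (M * d)"
      using f(2) f(1)[OF near(2)] g(2) g(1)[OF near(1)] LM \<open>0 \<le> d\<close> by (intro add_mono mult_mono) auto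
    finally show ?thesis by (simp add: algebra_simps)
  qed
  ultimately show "\<bar>f x * g x\<bar> \<le> 2 * L * M \<and> \<bar>f x * g x - f y * g y\<bar> \<le> 2 * L * M * d" by simp
qed

lemma bounded_lipschitz_near_peval: "\<exists>L. bounded_lipschitz_near x0 L (\<lambda>x. peval x e)"
proof (induction e)
  case (PConst c)
  have "bounded_lipschitz_near x0 \<bar>of_rat c\<bar> (\<lambda>x. peval x (PConst c))"
    by (rule bounded_lipschitz_nearI) simp
  then show ?case by blast
next
  case (PVar v)
  have "bounded_lipschitz_near x0 (\<bar>x0 v\<bar> + 1) (\<lambda>x. peval x (PVar v))"
  proof (rule bounded_lipschitz_nearI)
    fix x y d
    assume near: "\<And>v. \<bar>x v - x0 v\<bar> \<le> 1" "\<And>v. \<bar>x v - y v\<bar> \<le> d" and "0 \<le> d"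
    have "\<bar>x v - y v\<bar> \<le> (\<bar>x0 v\<bar> + 1) * d"
      using near(2)[of v] mult_right_mono[of 1 "\<bar>x0 v\<bar> + 1" d] \<open>0 \<le> d\<close> by simp
    then show "\<bar>peval x (PVar v)\<bar> \<le> \<bar>x0 v\<bar> + 1 \<and>
        \<bar>peval x (PVar v) - peval y (PVar v)\<bar> \<le> (\<bar>x0 v\<bar> + 1) * d"
      using near(1)[of v] by simp
  qed
  then show ?case by blast
next
  case (PAdd a b)
  then show ?case using bounded_lipschitz_near_add by fastforce
next
  case (PMul a b)
  then show ?case using bounded_lipschitz_near_mult by fastforce
next
  case (PNeg a)
  then show ?case by (simp add: bounded_lipschitz_near_def abs_minus_commute)
qed

lemma bounded_lipschitz_near_pevals:
  assumes "finite S"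
  shows "\<exists>L. \<forall>e\<in>S. bounded_lipschitz_near x0 L (\<lambda>x. peval x e)"
  using assms
proof (induction S rule: finite_induct)
  case (insert e S)
  then obtain L where L: "\<forall>e\<in>S. bounded_lipschitz_near x0 L (\<lambda>x. peval x e)" by blast
  obtain M where M: "bounded_lipschitz_near x0 M (\<lambda>x. peval x e)" using bounded_lipschitz_near_peval
    by blast
  show ?case
    using L bounded_lipschitz_near_mono[OF M max.cobounded2]
      bounded_lipschitz_near_mono[OF _ max.cobounded1]
    by (intro exI[of _ "max L M"]) blast
qed simp

section \<open>A fixed point equation\<close>

lemma pointwise_contraction_fixpoint:
  fixes T :: "('c \<Rightarrow> real) \<Rightarrow> 'c \<Rightarrow> real"
  assumes "\<delta> \<ge> 0"
    and maps: "\<And>w c. (\<And>c. \<bar>w c\<bar> \<le> \<delta>) \<Longrightarrow> \<bar>T w c\<bar> \<le> \<delta>"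
    and contraction: "\<And>w w' d c. (\<And>c. \<bar>w c\<bar> \<le> \<delta>) \<Longrightarrow> (\<And>c. \<bar>w' c\<bar> \<le> \<delta>) \<Longrightarrow> (\<And>c. \<bar>w c - w' c\<bar> \<le> d) \<Longrightarrow>
       \<bar>T w c - T w' c\<bar> \<le> d / 2"
  shows "\<exists>w. (\<forall>c. \<bar>w c\<bar> \<le> \<delta>) \<and> T w = w"
proof -
  interpret S: Submetric UNIV dist "{- \<delta>..\<delta>}" by unfold_locales simp
  let ?F = "S.sub.fspace (UNIV :: 'c set)"
  interpret F: Metric_space ?F "S.sub.fdist UNIV" by (rule S.sub.Metric_space_funspace)
  have in_F: "w \<in> ?F \<longleftrightarrow> (\<forall>c. \<bar>w c\<bar> \<le> \<delta>)" for w
  proof -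
    have "S.sub.mbounded (w ` UNIV)" if "w ` UNIV \<subseteq> {- \<delta>..\<delta>}"
      using that bounded_subset[OF bounded_closed_interval] by (simp add: S.mbounded_submetric)
    then show ?thesis by (auto simp: S.sub.fspace_def abs_le_iff minus_le_iff image_subset_iff)
  qed
  have "S.sub.mcomplete"
    using S.closedin_mcomplete_imp_mcomplete complete_UNIV by (simp add: mcomplete_iff_complete)
  then have "F.mcomplete" using S.sub.mcomplete_funspace[of UNIV] by (simp add: mcomplete_of_def)
  show ?thesis
  proof (rule F.Banach_fixedpoint_thm[of T "1 / 2"])
    show "F.mcomplete" by fact
    show "?F \<noteq> {}" using in_F[of "\<lambda>_. 0"] assms(1) by auto
    show "T \<in> ?F \<rightarrow> ?F" using maps in_F by blast
    show "S.sub.fdist UNIV (T w) (T w') \<le> 1 / 2 * S.sub.fdist UNIV w w'"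
      if w: "w \<in> ?F" "w' \<in> ?F" for w w'
    proof -
      have "\<bar>w c - w' c\<bar> \<le> S.sub.fdist UNIV w w'" for c
        using S.sub.funspace_mdist_le[OF w, of "S.sub.fdist UNIV w w'"] by (simp add: dist_real_def)
      then have "\<bar>T w c - T w' c\<bar> \<le> S.sub.fdist UNIV w w' / 2" for c
        using w in_F by (intro contraction) auto
      then show ?thesis
        using w maps in_F by (subst S.sub.funspace_mdist_le) (auto simp: dist_real_def)
    qed
    show ?thesis if "w \<in> ?F" "T w = w" for w using that in_F by blast
  qed simp
qed

lemma small_fixed_point:
  fixes K :: "'c \<Rightarrow> ('c \<Rightarrow> real) \<Rightarrow> real"
  assumes K: "\<And>c. bounded_lipschitz_near x0 L (K c)" and "\<delta> > 0"
  obtains w \<tau> where "\<tau> > 0" "\<And>c. \<bar>w c\<bar> \<le> \<delta>" "\<And>c. w c = \<tau> * K c (\<lambda>c. x0 c + w c / 2)"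
proof -
  have L: "0 \<le> L" using bounded_lipschitz_near_nonneg[OF K] .
  define \<delta>' where "\<delta>' = min \<delta> 1"
  have \<delta>': "0 < \<delta>'" "\<delta>' \<le> 1" "\<delta>' \<le> \<delta>" using assms(2) by (auto simp: \<delta>'_def)
  define \<tau> where "\<tau> = \<delta>' / (L + 1)"
  have "\<tau> * L = \<delta>' * (L / (L + 1))" by (simp add: \<tau>_def)
  also have "\<dots> \<le> \<delta>' * 1" using L \<delta>' by (intro mult_left_mono) auto
  finally have \<tau>: "\<tau> > 0" "\<tau> * L \<le> \<delta>'" using L \<delta>' by (auto simp: \<tau>_def)
  define mid where "mid w c = x0 c + w c / 2" for w c
  have near: "\<bar>mid w v - x0 v\<bar> \<le> 1" if "\<And>c. \<bar>w c\<bar> \<le> \<delta>'" for w v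
    using that[of v] \<delta>' by (simp add: mid_def)
  have "\<exists>w. (\<forall>c. \<bar>w c\<bar> \<le> \<delta>') \<and> (\<lambda>c. \<tau> * K c (mid w)) = w"
  proof (rule pointwise_contraction_fixpoint[of \<delta>' "\<lambda>w c. \<tau> * K c (mid w)"])
    show "0 \<le> \<delta>'" using \<delta>' by simp
  next
    fix w :: "'c \<Rightarrow> real" and c assume w: "\<And>c. \<bar>w c\<bar> \<le> \<delta>'"
    have "\<tau> * \<bar>K c (mid w)\<bar> \<le> \<tau> * L"
      using bounded_lipschitz_near_bound[OF K near[OF w]] \<tau> by (intro mult_left_mono) auto
    then have "\<tau> * \<bar>K c (mid w)\<bar> \<le> \<delta>'" using \<tau>(2) by (rule order_trans)
    then show "\<bar>\<tau> * K c (mid w)\<bar> \<le> \<delta>'" using \<tau>(1) by (simp add: abs_mult)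
  next
    fix w w' :: "'c \<Rightarrow> real" and d c
    assume w: "\<And>c. \<bar>w c\<bar> \<le> \<delta>'" "\<And>c. \<bar>w' c\<bar> \<le> \<delta>'" "\<And>c. \<bar>w c - w' c\<bar> \<le> d"
    have d: "d \<ge> 0" using w(3) by (meson abs_ge_zero order_trans)
    have "\<bar>mid w v - mid w' v\<bar> \<le> d / 2" for v
      using w(3)[of v] by (simp add: mid_def diff_divide_distrib[symmetric])
    then have "\<bar>K c (mid w) - K c (mid w')\<bar> \<le> L * (d / 2)"
      using near[of w] near[of w'] w(1,2) by (intro bounded_lipschitz_near_diff[OF K]) auto
    then have "\<tau> * \<bar>K c (mid w) - K c (mid w')\<bar> \<le> \<tau> * (L * (d / 2))" using \<tau>
      by (intro mult_left_mono) auto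
    also have "\<dots> = (\<tau> * L) * (d / 2)" by simp
    also have "\<dots> \<le> 1 * (d / 2)" using \<tau> \<delta>' d by (intro mult_right_mono) auto
    finally show "\<bar>\<tau> * K c (mid w) - \<tau> * K c (mid w')\<bar> \<le> d / 2"
      using \<tau> by (simp add: abs_mult right_diff_distrib[symmetric])
  qed
  then obtain w where w: "\<And>c. \<bar>w c\<bar> \<le> \<delta>'" "(\<lambda>c. \<tau> * K c (mid w)) = w" by blast
  show thesis
  proof (rule that[OF \<tau>(1)])
    show "\<bar>w c\<bar> \<le> \<delta>" for c using w(1)[of c] \<delta>' by linarith
    show "w c = \<tau> * K c (\<lambda>c. x0 c + w c / 2)" for c using fun_cong[OF w(2), of c]
      by (simp add: mid_def[abs_def])
  qed
qed

section \<open>The quarter turn of the plane\<close>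

definition rot90 :: "real^2 \<Rightarrow> real^2" where
  "rot90 x = vector [- x $ 2, x $ 1]"

lemma rot90_nth [simp]: "rot90 x $ 1 = - x $ 2" "rot90 x $ 2 = x $ 1"
  by (simp_all add: rot90_def)

lemma inner_vec2: "x \<bullet> y = x $ 1 * y $ 1 + x $ 2 * y $ 2" for x y :: "real^2"
  by (simp add: inner_vec_def sum_2)

lemma linear_rot90: "linear rot90"
  by (rule linearI) (simp_all add: vec_eq_iff forall_2)

lemmas rot90_add = linear_add[OF linear_rot90]
  and rot90_diff = linear_diff[OF linear_rot90]
  and rot90_scaleR = linear_cmul[OF linear_rot90]

lemma rot90_rot90 [simp]: "rot90 (rot90 x) = - x"
  by (simp add: vec_eq_iff forall_2)

lemma inner_rot90_self [simp]: "x \<bullet> rot90 x = 0"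
  by (simp add: inner_vec2)

lemma inner_rot90_rot90 [simp]: "rot90 x \<bullet> rot90 y = x \<bullet> y"
  by (simp add: inner_vec2)

lemma orthogonal_to_independent_pair:
  fixes d e z :: "real^2"
  assumes "d \<bullet> z = 0" "e \<bullet> z = 0" "rot90 d \<bullet> e \<noteq> 0"
  shows "z = 0"
proof -
  have "(rot90 d \<bullet> e) *\<^sub>R z = (e \<bullet> z) *\<^sub>R rot90 d - (d \<bullet> z) *\<^sub>R rot90 e"
    by (simp add: vec_eq_iff forall_2 inner_vec2 algebra_simps)
  then show ?thesis using assms by simp
qed

text \<open>The isometry is the Cayley transform of the infinitesimal rotation, followed by a translation.\<close>

lemma cayley_isometry:
  "\<exists>f :: real^2 \<Rightarrow> real^2. (\<forall>x y. dist (f x) (f y) = dist x y) \<and>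
    (\<forall>p q. q - p = t + h *\<^sub>R rot90 (p + q) \<longrightarrow> f p = q)"
proof -
  define R where "R x = x + h *\<^sub>R rot90 x" for x
  define f where "f x = (1 / (1 + h\<^sup>2)) *\<^sub>R R (R x + t)" for x
  have h: "1 + h\<^sup>2 > 0" by (simp add: add_pos_nonneg)
  have R_diff: "R x - R y = R (x - y)" for x y by (simp add: R_def rot90_diff algebra_simps)
  have norm_R: "norm (R x) = sqrt (1 + h\<^sup>2) * norm x" for x
  proof -
    have "(norm (R x))\<^sup>2 = (1 + h\<^sup>2) * (norm x)\<^sup>2"
      unfolding power2_norm_eq_inner R_def
      by (simp add: inner_add_left inner_add_right inner_commute[of "rot90 x"]
          power2_eq_square algebra_simps)
    then show ?thesis by (metis abs_norm_cancel real_sqrt_abs real_sqrt_mult)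
  qed
  have "dist (f x) (f y) = dist x y" for x y
  proof -
    have "f x - f y = (1 / (1 + h\<^sup>2)) *\<^sub>R R (R (x - y))"
      unfolding f_def scaleR_diff_right[symmetric] R_diff by (simp add: R_diff)
    then have "norm (f x - f y) =
        (1 / (1 + h\<^sup>2)) * (sqrt (1 + h\<^sup>2) * (sqrt (1 + h\<^sup>2) * norm (x - y)))"
      using h by (simp add: norm_R)
    then show ?thesis using h by (simp add: dist_norm mult.assoc[symmetric])
  qed
  moreover have "f p = q" if "q - p = t + h *\<^sub>R rot90 (p + q)" for p q
  proof -
    have "R p + t = q - h *\<^sub>R rot90 q"
      using that by (simp add: R_def rot90_add algebra_simps)
    then have "R (R p + t) = R (q - h *\<^sub>R rot90 q)" by simp
    also have "\<dots> = (1 + h\<^sup>2) *\<^sub>R q"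
      by (simp add: R_def rot90_diff rot90_scaleR power2_eq_square algebra_simps)
    finally show ?thesis using h by (simp add: f_def)
  qed
  ultimately show ?thesis by blast
qed

section \<open>Infinitesimal rigidity in the plane\<close>

definition infinitesimal_motion :: "'a set set \<Rightarrow> ('a \<Rightarrow> real^2) \<Rightarrow> ('a \<Rightarrow> real^2) \<Rightarrow> bool" where
  "infinitesimal_motion E p w \<longleftrightarrow> (\<forall>a b. {a, b} \<in> E \<longrightarrow> (p a - p b) \<bullet> (w a - w b) = 0)"

definition infinitesimally_rigid :: "'a set \<Rightarrow> 'a set set \<Rightarrow> ('a \<Rightarrow> real^2) \<Rightarrow> bool" where
  "infinitesimally_rigid V E p \<longleftrightarrow>
    (\<forall>w. infinitesimal_motion E p w \<longrightarrow> (\<exists>t \<omega>. \<forall>u\<in>V. w u = t + \<omega> *\<^sub>R rot90 (p u)))"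

lemma infinitesimal_motionD: "infinitesimal_motion E p w \<Longrightarrow> {a, b} \<in> E \<Longrightarrow> (p a - p b) \<bullet> (w a - w b) = 0"
  by (simp add: infinitesimal_motion_def)

lemma infinitesimal_motion_mono: "infinitesimal_motion E p w \<Longrightarrow> F \<subseteq> E \<Longrightarrow> infinitesimal_motion F p w"
  by (auto simp: infinitesimal_motion_def)

lemma infinitesimal_motion_scaleR:
  assumes "infinitesimal_motion E p w"
  shows "infinitesimal_motion E p (\<lambda>u. c *\<^sub>R w u)"
  using assms by (simp add: infinitesimal_motion_def scaleR_diff_right[symmetric])

lemma inner_trivial_motion [simp]:
  "(p a - p b) \<bullet> ((t + \<omega> *\<^sub>R rot90 (p a)) - (t + \<omega> *\<^sub>R rot90 (p b))) = 0"
  by (simp add: scaleR_diff_right[symmetric] rot90_diff[symmetric])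

lemma infinitesimal_motion_diff_trivial:
  assumes "infinitesimal_motion E p w"
  shows "infinitesimal_motion E p (\<lambda>u. w u - (t + \<omega> *\<^sub>R rot90 (p u)))"
  unfolding infinitesimal_motion_def
proof (intro allI impI)
  fix a b assume e: "{a, b} \<in> E"
  have "(w a - (t + \<omega> *\<^sub>R rot90 (p a))) - (w b - (t + \<omega> *\<^sub>R rot90 (p b))) =
      (w a - w b) - ((t + \<omega> *\<^sub>R rot90 (p a)) - (t + \<omega> *\<^sub>R rot90 (p b)))" by simp
  then show "(p a - p b) \<bullet> ((w a - (t + \<omega> *\<^sub>R rot90 (p a))) - (w b - (t + \<omega> *\<^sub>R rot90 (p b)))) = 0"
    using infinitesimal_motionD[OF assms e]
      by (simp only: inner_diff_right[of "p a - p b" "w a - w b"] inner_trivial_motion)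
qed

lemma infinitesimally_rigid_if_fewer_motions:
  assumes "infinitesimally_rigid V E p" "\<And>w. infinitesimal_motion F p w \<Longrightarrow> infinitesimal_motion E p w"
  shows "infinitesimally_rigid V F p"
  using assms unfolding infinitesimally_rigid_def by blast

lemma infinitesimally_rigid_cong:
  assumes "simple_graph V E" "\<And>u. u \<in> V \<Longrightarrow> p u = q u"
  shows "infinitesimally_rigid V E p \<longleftrightarrow> infinitesimally_rigid V E q"
proof -
  have "infinitesimal_motion E p w \<longleftrightarrow> infinitesimal_motion E q w" for w
    using assms(2) simple_graph_endpoints[OF assms(1)] unfolding infinitesimal_motion_def by metis
  then show ?thesis using assms(2) unfolding infinitesimally_rigid_def by (metis (no_types, lifting))
qed

definition pinned :: "'a \<Rightarrow> 'a \<Rightarrow> ('a \<Rightarrow> real^2) \<Rightarrow> bool" where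
  "pinned a b w \<longleftrightarrow> w a = 0 \<and> w b $ 1 = 0"

lemma pinning_trivial_motion:
  assumes "p a $ 2 \<noteq> p b $ 2"
  shows "\<exists>t \<omega>. pinned a b (\<lambda>u. w u - (t + \<omega> *\<^sub>R rot90 (p u)))"
proof -
  define \<omega> where "\<omega> = (w a $ 1 - w b $ 1) / (p b $ 2 - p a $ 2)"
  have "\<omega> * (p b $ 2 - p a $ 2) = w a $ 1 - w b $ 1" using assms by (simp add: \<omega>_def)
  then have "pinned a b (\<lambda>u. w u - ((w a - \<omega> *\<^sub>R rot90 (p a)) + \<omega> *\<^sub>R rot90 (p u)))"
    by (simp add: pinned_def algebra_simps)
  then show ?thesis by blast
qed

lemma pinned_trivial_motion_zero:
  assumes "pinned a b (\<lambda>u. t + \<omega> *\<^sub>R rot90 (p u))" "p a $ 2 \<noteq> p b $ 2"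
  shows "\<omega> = 0" "t = 0"
proof -
  have a: "t + \<omega> *\<^sub>R rot90 (p a) = 0" and b: "(t + \<omega> *\<^sub>R rot90 (p b)) $ 1 = 0"
    using assms(1) by (auto simp: pinned_def)
  have "\<omega> * (p a $ 2 - p b $ 2) = (t + \<omega> *\<^sub>R rot90 (p b)) $ 1 - (t + \<omega> *\<^sub>R rot90 (p a)) $ 1"
    by (simp add: algebra_simps)
  then show "\<omega> = 0" using a b assms(2) by simp
  then show "t = 0" using a by simp
qed

lemma infinitesimally_rigid_iff_pinned:
  assumes "a \<in> V" "b \<in> V" "p a $ 2 \<noteq> p b $ 2"
  shows "infinitesimally_rigid V E p \<longleftrightarrow>
    (\<forall>w. infinitesimal_motion E p w \<longrightarrow> pinned a b w \<longrightarrow> (\<forall>u\<in>V. w u = 0))"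
proof (intro iffI allI impI)
  fix w assume "infinitesimally_rigid V E p" "infinitesimal_motion E p w" and pin: "pinned a b w"
  then obtain t \<omega> where w: "\<forall>u\<in>V. w u = t + \<omega> *\<^sub>R rot90 (p u)"
    unfolding infinitesimally_rigid_def by blast
  have "pinned a b (\<lambda>u. t + \<omega> *\<^sub>R rot90 (p u))" using pin w assms(1,2) by (simp add: pinned_def)
  from pinned_trivial_motion_zero[OF this assms(3)] show "\<forall>u\<in>V. w u = 0" using w by simp
next
  assume zero: "\<forall>w. infinitesimal_motion E p w \<longrightarrow> pinned a b w \<longrightarrow> (\<forall>u\<in>V. w u = 0)"
  show "infinitesimally_rigid V E p" unfolding infinitesimally_rigid_def
  proof (intro allI impI)
    fix w assume w: "infinitesimal_motion E p w"
    obtain t \<omega> where "pinned a b (\<lambda>u. w u - (t + \<omega> *\<^sub>R rot90 (p u)))"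
      using pinning_trivial_motion[of p a b w] assms(3) by blast
    then have "\<forall>u\<in>V. w u - (t + \<omega> *\<^sub>R rot90 (p u)) = 0"
      using zero infinitesimal_motion_diff_trivial[OF w] by blast
    then show "\<exists>t \<omega>. \<forall>u\<in>V. w u = t + \<omega> *\<^sub>R rot90 (p u)" by (metis eq_iff_diff_eq_0)
  qed
qed

lemma infinitesimally_rigid_K2:
  assumes "p a $ 2 \<noteq> p b $ 2"
  shows "infinitesimally_rigid {a, b} {{a, b}} p"
proof -
  have "w b = 0" if "infinitesimal_motion {{a, b}} p w" "pinned a b w" for w
  proof -
    have "(p a $ 2 - p b $ 2) * w b $ 2 = 0"
      using infinitesimal_motionD[OF that(1), of a b] that(2) by (simp add: inner_vec2 pinned_def)
    then show ?thesis using assms that(2) by (simp add: pinned_def vec_eq_iff forall_2)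
  qed
  then show ?thesis using infinitesimally_rigid_iff_pinned[of a "{a, b}" b p] assms
    by (auto simp: pinned_def)
qed

lemma infinitesimally_rigid_insert:
  assumes rigid: "infinitesimally_rigid V E p" and ab: "a \<in> V" "b \<in> V"
    and det: "rot90 (p v - p a) \<bullet> (p v - p b) \<noteq> 0"
  shows "infinitesimally_rigid (insert v V) (E \<union> {{v, a}, {v, b}}) p"
  unfolding infinitesimally_rigid_def
proof (intro allI impI)
  fix w assume w: "infinitesimal_motion (E \<union> {{v, a}, {v, b}}) p w"
  then obtain t \<omega> where trivial: "\<forall>u\<in>V. w u = t + \<omega> *\<^sub>R rot90 (p u)"
    using rigid infinitesimal_motion_mono[of _ p w E] unfolding infinitesimally_rigid_def by blast
  define z where "z u = w u - (t + \<omega> *\<^sub>R rot90 (p u))" for u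
  have "infinitesimal_motion (E \<union> {{v, a}, {v, b}}) p z"
    unfolding z_def by (rule infinitesimal_motion_diff_trivial[OF w])
  moreover have "z a = 0" "z b = 0" using trivial ab by (simp_all add: z_def)
  ultimately have "(p v - p a) \<bullet> z v = 0" "(p v - p b) \<bullet> z v = 0"
    using infinitesimal_motionD[of _ p z v a] infinitesimal_motionD[of _ p z v b] by auto
  then have "z v = 0" using det by (rule orthogonal_to_independent_pair)
  then have "\<forall>u\<in>insert v V. w u = t + \<omega> *\<^sub>R rot90 (p u)" using trivial by (simp add: z_def)
  then show "\<exists>t \<omega>. \<forall>u\<in>insert v V. w u = t + \<omega> *\<^sub>R rot90 (p u)" by blast
qed

lemma infinitesimally_rigid_split_edge:
  assumes rigid: "infinitesimally_rigid V E p" and ik: "i \<in> V" "k \<in> V"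
    and v: "p v = midpoint (p i) (p j)" and det: "rot90 (p v - p i) \<bullet> (p v - p k) \<noteq> 0"
  shows "infinitesimally_rigid (insert v V) (E - {{i, j}} \<union> {{v, i}, {v, j}, {v, k}}) p"
proof (rule infinitesimally_rigid_if_fewer_motions[OF infinitesimally_rigid_insert[OF rigid ik det]])
  fix w assume w: "infinitesimal_motion (E - {{i, j}} \<union> {{v, i}, {v, j}, {v, k}}) p w"
  have "(p v - p i) \<bullet> (w v - w i) = 0" "(p v - p j) \<bullet> (w v - w j) = 0"
    using infinitesimal_motionD[OF w] by auto
  moreover have "p v - p i = (1 / 2) *\<^sub>R (p j - p i)" "p v - p j = (1 / 2) *\<^sub>R (p i - p j)"
    by (simp_all add: v midpoint_def vec_eq_iff field_simps)
  ultimately have ij: "(p i - p j) \<bullet> (w i - w j) = 0" by (simp add: inner_diff_left inner_diff_right)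
  show "infinitesimal_motion (E \<union> {{v, i}, {v, k}}) p w"
    unfolding infinitesimal_motion_def
  proof (intro allI impI)
    fix a b assume e: "{a, b} \<in> E \<union> {{v, i}, {v, k}}"
    show "(p a - p b) \<bullet> (w a - w b) = 0"
    proof (cases "{a, b} = {i, j}")
      case True
      then consider "a = i" "b = j" | "a = j" "b = i" by (auto simp: doubleton_eq_iff)
      then show ?thesis using ij by cases (simp_all add: inner_diff_left inner_diff_right)
    next
      case False
      then have "{a, b} \<in> E - {{i, j}} \<union> {{v, i}, {v, j}, {v, k}}" using e by blast
      then show ?thesis by (rule infinitesimal_motionD[OF w])
    qed
  qed
qed

section \<open>The rigidity matrix\<close>

definition coords :: "('a \<Rightarrow> real^2) \<Rightarrow> 'a \<times> 2 \<Rightarrow> real" where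
  "coords p = (\<lambda>(u, i). p u $ i)"

lemma coords_apply [simp]: "coords p (u, i) = p u $ i"
  by (simp add: coords_def)

definition rigidity_matrix :: "'a set \<Rightarrow> 'a \<times> 2 \<Rightarrow> ('a \<times> 2) pexpr" where
  "rigidity_matrix e = (\<lambda>(u, i).
    if u \<in> e then PSub (PVar (u, i)) (PVar (the_elem (e - {u}), i)) else PConst 0)"

lemma rigidity_matrix_outside: "u \<notin> e \<Longrightarrow> rigidity_matrix e (u, i) = PConst 0"
  by (simp add: rigidity_matrix_def)

lemma rigidity_matrix_pair:
  assumes "a \<noteq> b"
  shows "rigidity_matrix {a, b} (a, i) = PSub (PVar (a, i)) (PVar (b, i))"
    "rigidity_matrix {a, b} (b, i) = PSub (PVar (b, i)) (PVar (a, i))"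
proof -
  have "{a, b} - {a} = {b}" "{a, b} - {b} = {a}" using assms by auto
  then show "rigidity_matrix {a, b} (a, i) = PSub (PVar (a, i)) (PVar (b, i))"
    "rigidity_matrix {a, b} (b, i) = PSub (PVar (b, i)) (PVar (a, i))"
    by (simp_all add: rigidity_matrix_def)
qed

lemma pvars_rigidity_matrix:
  assumes "simple_graph V E" "e \<in> E"
  shows "pvars (rigidity_matrix e c) \<subseteq> V \<times> UNIV"
proof -
  obtain a b where e: "e = {a, b}" "a \<noteq> b" "a \<in> V" "b \<in> V" using assms by (rule simple_graphE)
  obtain u i where c: "c = (u, i)" by (cases c)
  show ?thesis
    using e rigidity_matrix_pair[OF e(2)] by (cases "u \<in> e") (auto simp: c rigidity_matrix_outside)
qed

lemma sum_coords:
  assumes "finite V"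
  shows "(\<Sum>c\<in>V \<times> UNIV. coords x c * coords y c) = (\<Sum>u\<in>V. x u \<bullet> y u)"
proof -
  have "(\<Sum>c\<in>V \<times> UNIV. coords x c * coords y c) = (\<Sum>u\<in>V. \<Sum>i\<in>UNIV. coords x (u, i) * coords y (u, i))"
    by (simp add: sum.cartesian_product coords_def case_prod_unfold)
  then show ?thesis by (simp add: inner_vec_def)
qed

lemma rigidity_matrix_apply:
  assumes "finite V" "a \<in> V" "b \<in> V" "a \<noteq> b"
  shows "(\<Sum>c\<in>V \<times> UNIV. peval (coords p) (rigidity_matrix {a, b} c) * coords w c) =
    (p a - p b) \<bullet> (w a - w b)"
proof -
  define x where "x u = (if u = a then p a - p b else if u = b then p b - p a else 0)" for u
  have "peval (coords p) (rigidity_matrix {a, b} c) = coords x c" for c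
    using assms(4) by (cases c) (auto simp: x_def rigidity_matrix_pair rigidity_matrix_outside)
  then have "(\<Sum>c\<in>V \<times> UNIV. peval (coords p) (rigidity_matrix {a, b} c) * coords w c) =
      (\<Sum>u\<in>V. x u \<bullet> w u)"
    using sum_coords[OF assms(1)] by simp
  also have "\<dots> = (\<Sum>u\<in>{a, b}. x u \<bullet> w u)"
    using assms by (intro sum.mono_neutral_right) (auto simp: x_def)
  also have "\<dots> = (p a - p b) \<bullet> (w a - w b)"
    using assms(4) by (simp add: x_def inner_diff_left inner_diff_right)
  finally show ?thesis .
qed

lemma infinitesimal_motion_iff_kernel:
  assumes "finite V" "simple_graph V E"
  shows "infinitesimal_motion E p w \<longleftrightarrow>
    (\<forall>e\<in>E. (\<Sum>c\<in>V \<times> UNIV. peval (coords p) (rigidity_matrix e c) * coords w c) = 0)"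
proof
  assume w: "infinitesimal_motion E p w"
  show "\<forall>e\<in>E. (\<Sum>c\<in>V \<times> UNIV. peval (coords p) (rigidity_matrix e c) * coords w c) = 0"
  proof
    fix e assume "e \<in> E"
    then obtain a b where "e = {a, b}" "a \<noteq> b" "a \<in> V" "b \<in> V" "{a, b} \<in> E"
      by (metis simple_graphE[OF assms(2)])
    then show "(\<Sum>c\<in>V \<times> UNIV. peval (coords p) (rigidity_matrix e c) * coords w c) = 0"
      using infinitesimal_motionD[OF w] by (simp add: rigidity_matrix_apply[OF assms(1)])
  qed
next
  assume kernel: "\<forall>e\<in>E. (\<Sum>c\<in>V \<times> UNIV. peval (coords p) (rigidity_matrix e c) * coords w c) = 0"
  show "infinitesimal_motion E p w"
    unfolding infinitesimal_motion_def
  proof (intro allI impI)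
    fix a b assume e: "{a, b} \<in> E"
    show "(p a - p b) \<bullet> (w a - w b) = 0"
      using rigidity_matrix_apply[OF assms(1) simple_graph_endpoints[OF assms(2) e], of p w] kernel e
        by simp
  qed
qed

definition pins :: "'a \<Rightarrow> 'a \<Rightarrow> ('a \<times> 2) set" where
  "pins a b = {(a, 1), (a, 2), (b, 1)}"

lemma pinned_iff_coords: "pinned a b w \<longleftrightarrow> (\<forall>c\<in>pins a b. coords w c = 0)"
  by (auto simp: pinned_def pins_def vec_eq_iff forall_2)

lemma card_coords_minus_pins:
  assumes "finite V" "a \<in> V" "b \<in> V" "a \<noteq> b"
  shows "card (V \<times> UNIV - pins a b) = 2 * card V - 3"
proof -
  have "card (pins a b) = 3" using assms by (auto simp: pins_def card_insert_if)
  moreover have "pins a b \<subseteq> V \<times> UNIV" using assms by (auto simp: pins_def)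
  ultimately show ?thesis using assms by (simp add: card_Diff_subset pins_def card_cartesian_product)
qed

lemma sum_pinned:
  assumes "finite V" "pinned a b w"
  shows "(\<Sum>c\<in>V \<times> UNIV - pins a b. f c * coords w c) = (\<Sum>c\<in>V \<times> UNIV. f c * coords w c)"
  using assms by (intro sum.mono_neutral_left) (auto simp: pinned_iff_coords)

lemma infinitesimally_rigid_iff_indep_columns:
  assumes V: "finite V" "simple_graph V E" and ab: "a \<in> V" "b \<in> V" "p a $ 2 \<noteq> p b $ 2"
  shows "infinitesimally_rigid V E p \<longleftrightarrow>
    indep_rows (V \<times> UNIV - pins a b) E (\<lambda>c e. peval (coords p) (rigidity_matrix e c))"
    (is "_ \<longleftrightarrow> indep_rows ?C E ?M")
  unfolding infinitesimally_rigid_iff_pinned[of a V b p, OF ab] infinitesimal_motion_iff_kernel[OF V]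
proof (intro iffI allI impI ballI)
  assume zero: "\<forall>w. (\<forall>e\<in>E. (\<Sum>c\<in>V \<times> UNIV. ?M c e * coords w c) = 0) \<longrightarrow> pinned a b w \<longrightarrow> (\<forall>u\<in>V. w u = 0)"
  show "indep_rows ?C E ?M" unfolding indep_rows_def
  proof (intro allI impI ballI)
    fix l c assume l: "\<forall>e\<in>E. (\<Sum>c\<in>?C. l c * ?M c e) = 0" and c: "c \<in> ?C"
    define w :: "'a \<Rightarrow> real^2" where "w u = (\<chi> i. if (u, i) \<in> ?C then l (u, i) else 0)" for u
    have w: "coords w c = (if c \<in> ?C then l c else 0)" for c by (cases c) (simp add: w_def)
    have pinned: "pinned a b w" unfolding pinned_iff_coords w by simp
    have "(\<Sum>c\<in>V \<times> UNIV. ?M c e * coords w c) = 0" if "e \<in> E" for e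
      using l that unfolding sum_pinned[OF V(1) pinned, symmetric] by (simp add: w mult.commute)
    then have "\<forall>u\<in>V. w u = 0" using zero pinned by blast
    then have "coords w c = 0" using c by (cases c) auto
    then show "l c = 0" using c by (simp add: w)
  qed
next
  fix w u
  assume indep: "indep_rows ?C E ?M" and pinned: "pinned a b w" and "u \<in> V"
    and "\<forall>e\<in>E. (\<Sum>c\<in>V \<times> UNIV. ?M c e * coords w c) = 0"
  then have "(\<Sum>c\<in>?C. coords w c * ?M c e) = 0" if "e \<in> E" for e
    using that sum_pinned[OF V(1) pinned, of "\<lambda>c. ?M c e"] by (simp add: mult.commute)
  from indep_rowsD[OF indep this] have "coords w c = 0" if "c \<in> ?C" for c using that by blast
  then have "coords w (u, i) = 0" for i using pinned \<open>u \<in> V\<close> unfolding pinned_iff_coords by blast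
  then show "w u = 0" by (simp add: vec_eq_iff)
qed

lemma infinitesimally_rigid_certificate:
  assumes V: "finite V" "simple_graph V E" and ab: "a \<in> V" "b \<in> V" "p0 a $ 2 \<noteq> p0 b $ 2"
    and rigid: "infinitesimally_rigid V E p0"
  obtains D where "pvars D \<subseteq> V \<times> UNIV" "peval (coords p0) D \<noteq> 0"
    "\<And>p. peval (coords p) D \<noteq> 0 \<Longrightarrow> infinitesimally_rigid V E p"
proof -
  let ?C = "V \<times> UNIV - pins a b"
  have "indep_rows ?C E (\<lambda>c e. peval (coords p0) (rigidity_matrix e c))"
    using infinitesimally_rigid_iff_indep_columns[of V E a b p0] assms by blast
  then obtain D where D: "pvars D \<subseteq> V \<times> UNIV" "peval (coords p0) D \<noteq> 0"
    "\<And>x. peval x D \<noteq> 0 \<Longrightarrow> indep_rows ?C E (\<lambda>c e. peval x (rigidity_matrix e c))"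
  proof (rule indep_rows_certificate[rotated])
    show "finite ?C" using V(1) by simp
    show "pvars (rigidity_matrix e c) \<subseteq> V \<times> UNIV" if "e \<in> E" for c e
      using pvars_rigidity_matrix[OF V(2) that] .
  qed blast
  show thesis
  proof (rule that[of "PMul D (PSub (PVar (a, 2)) (PVar (b, 2)))"])
    fix p assume "peval (coords p) (PMul D (PSub (PVar (a, 2)) (PVar (b, 2)))) \<noteq> 0"
    then show "infinitesimally_rigid V E p"
      using infinitesimally_rigid_iff_indep_columns[OF V ab(1,2), of p] D(3) by simp
  qed (use D ab in auto)
qed

section \<open>Generic configurations\<close>

lemma generic_iff_alg_independent_on: "generic V p \<longleftrightarrow> alg_independent_on (V \<times> UNIV) (coords p)"
  by (simp add: generic_def alg_independent_on_def coords_def)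

lemma genericD:
  assumes "generic V p" "pvars e \<subseteq> V \<times> UNIV" "peval x e \<noteq> 0"
  shows "peval (coords p) e \<noteq> 0"
  using alg_independent_onD assms unfolding generic_iff_alg_independent_on by blast

lemma generic_exists:
  assumes "finite V"
  shows "\<exists>p. generic V p"
proof -
  have "finite (V \<times> (UNIV :: 2 set))" using assms by simp
  then obtain x where "alg_independent_on (V \<times> (UNIV :: 2 set)) x"
    using alg_independent_on_exists by blast
  moreover have "coords (\<lambda>u. \<chi> i. x (u, i)) = x" by (simp add: fun_eq_iff)
  ultimately have "generic V (\<lambda>u. \<chi> i. x (u, i))" by (simp add: generic_iff_alg_independent_on)
  then show ?thesis by blast
qed

lemma generic_coord_neq:
  assumes "generic V p" "a \<in> V" "b \<in> V" "a \<noteq> b"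
  shows "p a $ i \<noteq> p b $ i"
  using genericD[OF assms(1), of "PSub (PVar (a, i)) (PVar (b, i))" "\<lambda>c. if c = (a, i) then 1 else 0"]
    assms(2-) by auto

lemma generic_inj_on: "generic V p \<Longrightarrow> inj_on p V"
  using generic_coord_neq by (metis inj_onI)

lemma generic_not_collinear:
  assumes "generic V p" "{a, b, c} \<subseteq> V" "distinct [a, b, c]"
  shows "rot90 (p b - p a) \<bullet> (p c - p a) \<noteq> 0"
proof -
  let ?d = "\<lambda>u i. PSub (PVar (u, i)) (PVar (a, i))"
  let ?e = "PSub (PMul (?d b 1) (?d c 2)) (PMul (?d b 2) (?d c 1))"
  have "peval (coords p) ?e \<noteq> 0"
    using assms(2,3)
    by (intro genericD[OF assms(1), of _ "\<lambda>d. if d = (b, 1) \<or> d = (c, 2) then 1 else 0"]) auto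
  then show ?thesis by (simp add: inner_vec2 algebra_simps)
qed

lemma infinitesimally_rigid_generic:
  assumes "finite V" "simple_graph V E" "a \<in> V" "b \<in> V" "p0 a $ 2 \<noteq> p0 b $ 2"
    "infinitesimally_rigid V E p0"
    and "generic V p"
  shows "infinitesimally_rigid V E p"
  using infinitesimally_rigid_certificate[of V E a b p0] genericD[OF assms(7)] assms(1-6) by metis

lemma generic_infinitesimally_rigid_move1:
  assumes H: "henneberg V E" and v: "v \<notin> V" and ab: "a \<in> V" "b \<in> V" "a \<noteq> b"
    and rigid: "\<And>p. generic V p \<Longrightarrow> infinitesimally_rigid V E p" and p: "generic (insert v V) p"
  shows "infinitesimally_rigid (insert v V) (E \<union> {{v, a}, {v, b}}) p"
proof -
  note graph = henneberg_simple_graph[OF H]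
    and graph' = henneberg_simple_graph[OF henneberg.move1[OF H v ab]]
  obtain p0 where p0: "generic V p0" using generic_exists[OF graph(1)] by blast
  define q where "q = p0(v := p0 a + rot90 (p0 b - p0 a))"
  have q: "q v = p0 a + rot90 (p0 b - p0 a)" "\<And>u. u \<in> V \<Longrightarrow> q u = p0 u"
    using v by (auto simp: q_def)
  have "p0 a \<noteq> p0 b" using generic_coord_neq[OF p0 ab] by metis
  have "rot90 (q v - q a) \<bullet> (q v - q b) = (p0 b - p0 a) \<bullet> (p0 b - p0 a)"
    using ab(1,2) by (simp add: q inner_vec2 algebra_simps)
  then have "rot90 (q v - q a) \<bullet> (q v - q b) \<noteq> 0" using \<open>p0 a \<noteq> p0 b\<close> by simp
  moreover have "infinitesimally_rigid V E q"
    using rigid[OF p0] infinitesimally_rigid_cong[of V E q p0] graph(2) q(2) by blast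
  ultimately have "infinitesimally_rigid (insert v V) (E \<union> {{v, a}, {v, b}}) q"
    using ab(1,2) by (intro infinitesimally_rigid_insert)
  moreover have "q a $ 2 \<noteq> q b $ 2" using generic_coord_neq[OF p0 ab] q(2) ab(1,2) by simp
  ultimately show ?thesis
    using infinitesimally_rigid_generic[OF graph', of a b q p] ab p by simp
qed

lemma generic_infinitesimally_rigid_move2:
  assumes H: "henneberg V E" and ij: "{i, j} \<in> E" "i \<noteq> j" and k: "k \<in> V" "k \<noteq> i" "k \<noteq> j"
    and v: "v \<notin> V"
    and rigid: "\<And>p. generic V p \<Longrightarrow> infinitesimally_rigid V E p" and p: "generic (insert v V) p"
  shows "infinitesimally_rigid (insert v V) (E - {{i, j}} \<union> {{v, i}, {v, j}, {v, k}}) p"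
proof -
  note graph = henneberg_simple_graph[OF H]
    and graph' = henneberg_simple_graph[OF henneberg.move2[OF H ij k v]]
  have in_V: "i \<in> V" "j \<in> V" using simple_graph_endpoints[OF graph(2) ij(1)] by auto
  obtain p0 where p0: "generic V p0" using generic_exists[OF graph(1)] by blast
  define q where "q = p0(v := midpoint (p0 i) (p0 j))"
  have q: "q v = midpoint (p0 i) (p0 j)" "\<And>u. u \<in> V \<Longrightarrow> q u = p0 u"
    using v by (auto simp: q_def)
  have "rot90 (q v - q i) \<bullet> (q v - q k) = - (rot90 (p0 j - p0 i) \<bullet> (p0 k - p0 i)) / 2"
    using in_V k(1) by (simp add: q midpoint_def inner_vec2 field_simps)
  moreover have "rot90 (p0 j - p0 i) \<bullet> (p0 k - p0 i) \<noteq> 0"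
    using ij(2) k in_V by (intro generic_not_collinear[OF p0]) auto
  ultimately have "rot90 (q v - q i) \<bullet> (q v - q k) \<noteq> 0" by simp
  moreover have "infinitesimally_rigid V E q"
    using rigid[OF p0] infinitesimally_rigid_cong[of V E q p0] graph(2) q(2) by blast
  moreover have "q v = midpoint (q i) (q j)" using q in_V by simp
  ultimately have "infinitesimally_rigid (insert v V) (E - {{i, j}} \<union> {{v, i}, {v, j}, {v, k}}) q"
    using in_V k(1) by (intro infinitesimally_rigid_split_edge)
  moreover have "q i $ 2 \<noteq> q j $ 2" using generic_coord_neq[OF p0 in_V ij(2)] q(2) in_V by simp
  ultimately show ?thesis
    using infinitesimally_rigid_generic[OF graph', of i j q p] in_V p by simp
qed

lemma henneberg_infinitesimally_rigid:
  assumes "henneberg V E" "generic V p"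
  shows "infinitesimally_rigid V E p"
  using assms
proof (induction arbitrary: p rule: henneberg.induct)
  case (K2 a b)
  then show ?case using generic_coord_neq[OF K2(2), of a b] by (intro infinitesimally_rigid_K2) auto
next
  case (move1 V E v a b)
  then show ?case by (intro generic_infinitesimally_rigid_move1)
next
  case (move2 V E i j k v)
  then show ?case by (intro generic_infinitesimally_rigid_move2)
qed

section \<open>Infinitesimal rigidity implies rigidity\<close>

lemma eventually_peval_coords_neq:
  assumes "pvars e \<subseteq> V \<times> UNIV" "peval (coords p) e \<noteq> 0"
  shows "\<forall>\<^sub>F q in uniformly_on V p. peval (coords q) e \<noteq> 0"
proof (rule tendsto_imp_eventually_ne[OF tendsto_peval assms(2)])
  fix c assume "c \<in> pvars e"
  then obtain u i where "c = (u, i)" "u \<in> V" using assms(1) by (cases c) auto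
  then show "((\<lambda>q. coords q c) \<longlongrightarrow> coords p c) (uniformly_on V p)"
    by (simp add: tendsto_vec_nth[OF tendsto_uniformly_on])
qed

lemma eventually_coord_neq:
  fixes p :: "'a \<Rightarrow> real^'n"
  assumes "a \<in> V" "b \<in> V" "p a $ i \<noteq> p b $ i"
  shows "\<forall>\<^sub>F q in uniformly_on V p. q a $ i \<noteq> q b $ i"
proof -
  have "((\<lambda>q. q a $ i - q b $ i) \<longlongrightarrow> p a $ i - p b $ i) (uniformly_on V p)"
    using assms(1,2) by (intro tendsto_intros tendsto_uniformly_on)
  then have "\<forall>\<^sub>F q in uniformly_on V p. q a $ i - q b $ i \<noteq> 0"
    by (rule tendsto_imp_eventually_ne) (use assms(3) in simp)
  then show ?thesis by (rule eventually_mono) simp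
qed

lemma eventually_infinitesimally_rigid:
  assumes "finite V" "simple_graph V E" "a \<in> V" "b \<in> V" "p a $ 2 \<noteq> p b $ 2"
    "infinitesimally_rigid V E p"
  shows "\<forall>\<^sub>F q in uniformly_on V p. infinitesimally_rigid V E q"
proof -
  obtain D where D: "pvars D \<subseteq> V \<times> UNIV" "peval (coords p) D \<noteq> 0"
    "\<And>q. peval (coords q) D \<noteq> 0 \<Longrightarrow> infinitesimally_rigid V E q"
    using infinitesimally_rigid_certificate[OF assms] by blast
  from eventually_peval_coords_neq[OF D(1,2)] show ?thesis by (rule eventually_mono) (rule D(3))
qed

definition equivalent_on :: "'a set set \<Rightarrow> ('a \<Rightarrow> 'b::metric_space) \<Rightarrow> ('a \<Rightarrow> 'b) \<Rightarrow> bool" where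
  "equivalent_on E p q \<longleftrightarrow> (\<forall>a b. {a, b} \<in> E \<longrightarrow> dist (q a) (q b) = dist (p a) (p b))"

definition congruent_on :: "'a set \<Rightarrow> ('a \<Rightarrow> 'b::metric_space) \<Rightarrow> ('a \<Rightarrow> 'b) \<Rightarrow> bool" where
  "congruent_on V p q \<longleftrightarrow> (\<forall>a\<in>V. \<forall>b\<in>V. dist (q a) (q b) = dist (p a) (p b))"

lemma congruent_on_imp_equivalent_on: "simple_graph V E \<Longrightarrow> congruent_on V p q \<Longrightarrow> equivalent_on E p q"
  using simple_graph_endpoints unfolding congruent_on_def equivalent_on_def by metis

text \<open>This is exact, not only to first order, and replaces every use of differentiation.\<close>

lemma infinitesimal_motion_midpoint_iff:
  "infinitesimal_motion E (\<lambda>u. midpoint (p u) (q u)) (\<lambda>u. q u - p u) \<longleftrightarrow> equivalent_on E p q"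
proof -
  have inner: "(midpoint (p a) (q a) - midpoint (p b) (q b)) \<bullet> ((q a - p a) - (q b - p b)) =
      ((dist (q a) (q b))\<^sup>2 - (dist (p a) (p b))\<^sup>2) / 2" for a b
  proof -
    have "midpoint (p a) (q a) - midpoint (p b) (q b) = (1 / 2) *\<^sub>R ((q a - q b) + (p a - p b))"
      by (simp add: midpoint_def algebra_simps)
    moreover have "(q a - p a) - (q b - p b) = (q a - q b) - (p a - p b)" by simp
    moreover have "(y + x) \<bullet> (y - x) = (norm y)\<^sup>2 - (norm x)\<^sup>2" for x y :: "real^2"
      by (simp add: power2_norm_eq_inner inner_simps inner_commute[of y x])
    ultimately show ?thesis by (simp only: dist_norm inner_scaleR_left)
  qed
  show ?thesis unfolding infinitesimal_motion_def equivalent_on_def inner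
    by (simp add: power2_eq_iff_nonneg)
qed

lemma rigid_framework_if_eventually_infinitesimally_rigid:
  assumes "finite V" and near: "\<forall>\<^sub>F q in uniformly_on V p. infinitesimally_rigid V E q"
  shows "rigid_framework V E p"
proof -
  obtain \<delta> where "\<delta> > 0" and \<delta>: "\<And>q. (\<forall>u\<in>V. dist (q u) (p u) < \<delta>) \<Longrightarrow> infinitesimally_rigid V E q"
    using near unfolding eventually_uniformly_on by blast
  have "\<exists>f :: real^2 \<Rightarrow> real^2. (\<forall>x y. dist (f x) (f y) = dist x y) \<and> f ` (p ` V) = q ` V"
    if close: "(\<Sum>u\<in>V. (norm (p u - q u))\<^sup>2) \<le> \<delta>\<^sup>2"
      and edges: "equivalent_on E p q" for q
  proof -
    let ?m = "\<lambda>u. midpoint (p u) (q u)"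
    have "dist (?m u) (p u) < \<delta>" if "u \<in> V" for u
    proof -
      have "(norm (p u - q u))\<^sup>2 \<le> (\<Sum>u\<in>V. (norm (p u - q u))\<^sup>2)"
        using assms(1) that by (intro member_le_sum) auto
      then have "norm (p u - q u) \<le> \<delta>"
        using close \<open>\<delta> > 0\<close> by (meson order_trans power2_le_imp_le less_imp_le)
      moreover have "dist (?m u) (p u) = norm (p u - q u) / 2"
        using dist_midpoint(3)[of "p u" "q u"] unfolding dist_norm .
      ultimately show ?thesis using \<open>\<delta> > 0\<close> by simp
    qed
    then have "infinitesimally_rigid V E ?m" by (intro \<delta>) blast
    moreover have "infinitesimal_motion E ?m (\<lambda>u. q u - p u)"
      using edges by (simp add: infinitesimal_motion_midpoint_iff)
    ultimately obtain t \<omega> where w: "\<And>u. u \<in> V \<Longrightarrow> q u - p u = t + \<omega> *\<^sub>R rot90 (?m u)"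
      unfolding infinitesimally_rigid_def by blast
    obtain f :: "real^2 \<Rightarrow> real^2" where f: "\<And>x y. dist (f x) (f y) = dist x y"
      "\<And>p q. q - p = t + (\<omega> / 2) *\<^sub>R rot90 (p + q) \<Longrightarrow> f p = q"
      using cayley_isometry[of t "\<omega> / 2"] by blast
    have "f (p u) = q u" if "u \<in> V" for u
      using w[OF that] by (intro f(2)) (simp add: midpoint_def rot90_scaleR)
    then have "f ` (p ` V) = q ` V" by force
    then show ?thesis using f(1) by blast
  qed
  then show ?thesis
    unfolding rigid_framework_def equivalent_on_def using \<open>\<delta> > 0\<close> by (intro exI[of _ "\<delta>\<^sup>2"]) simp
qed

lemma henneberg_eventually_infinitesimally_rigid:
  assumes "henneberg V E" "generic V p"
  shows "\<forall>\<^sub>F q in uniformly_on V p. infinitesimally_rigid V E q"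
proof -
  obtain a b where ab: "a \<in> V" "b \<in> V" "a \<noteq> b" using card_ge_2E[OF henneberg_card_ge_2[OF assms(1)]] .
  show ?thesis
    using eventually_infinitesimally_rigid[OF henneberg_simple_graph[OF assms(1)] ab(1,2)
        generic_coord_neq[OF assms(2) ab] henneberg_infinitesimally_rigid[OF assms]] .
qed

lemma henneberg_imp_generically_rigid: "henneberg V E \<Longrightarrow> generically_rigid_2 V E"
  unfolding generically_rigid_2_def
  using rigid_framework_if_eventually_infinitesimally_rigid henneberg_eventually_infinitesimally_rigid
    henneberg_simple_graph(1) by blast

section \<open>Independent edge sets are sparse\<close>

definition independent_edges :: "'a set \<Rightarrow> 'a set set \<Rightarrow> ('a \<Rightarrow> real^2) \<Rightarrow> bool" where
  "independent_edges V F p \<longleftrightarrow> indep_rows F (V \<times> UNIV) (eval_matrix (coords p) rigidity_matrix)"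

text \<open>Linear combinations of rows are orthogonal to the trivial motions, so one vanishing off the
  pinned coordinates vanishes there as well.\<close>

lemma independent_edges_unpin:
  assumes V: "finite V" "simple_graph V F" and ab: "a \<in> V" "b \<in> V" "p a $ 2 \<noteq> p b $ 2"
    and indep: "independent_edges V F p"
  shows "indep_rows F (V \<times> UNIV - pins a b) (eval_matrix (coords p) rigidity_matrix)"
  unfolding indep_rows_def
proof (intro allI impI)
  let ?M = "eval_matrix (coords p) rigidity_matrix"
  fix l assume l: "\<forall>c\<in>V \<times> UNIV - pins a b. (\<Sum>e\<in>F. l e * ?M e c) = 0"
  define g :: "'a \<Rightarrow> real^2" where "g u = (\<chi> i. \<Sum>e\<in>F. l e * ?M e (u, i))" for u
  have g: "coords g c = (\<Sum>e\<in>F. l e * ?M e c)" for c by (cases c) (simp add: g_def)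
  have orth: "g a \<bullet> w a + g b \<bullet> w b = 0" if "infinitesimal_motion F p w" for w
  proof -
    have "(\<Sum>u\<in>V. g u \<bullet> w u) = (\<Sum>c\<in>V \<times> UNIV. (\<Sum>e\<in>F. l e * ?M e c) * coords w c)"
      by (simp add: sum_coords[OF V(1), symmetric] g)
    also have "\<dots> = 0"
      unfolding sum_combination_swap using that infinitesimal_motion_iff_kernel[OF V] by simp
    finally have "(\<Sum>u\<in>V. g u \<bullet> w u) = 0" .
    moreover have "g u = 0" if "u \<in> V - {a, b}" for u
    proof -
      have "coords g (u, i) = 0" for i using that l unfolding g by (auto simp: pins_def)
      then show ?thesis by (simp add: vec_eq_iff)
    qed
    then have "(\<Sum>u\<in>V. g u \<bullet> w u) = (\<Sum>u\<in>{a, b}. g u \<bullet> w u)"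
      using V(1) ab(1,2) by (intro sum.mono_neutral_right) auto
    moreover have "a \<noteq> b" using ab(3) by blast
    ultimately show ?thesis by simp
  qed
  have "coords g (b, 2) = 0" using l ab unfolding g by (auto simp: pins_def)
  then have b2: "g b $ 2 = 0" by simp
  have trivial: "infinitesimal_motion F p (\<lambda>u. t + \<omega> *\<^sub>R rot90 (p u))" for t \<omega>
    by (simp add: infinitesimal_motion_def scaleR_diff_right[symmetric] rot90_diff[symmetric])
  have "(g a + g b) \<bullet> t = 0" for t using orth[OF trivial[of t 0]] by (simp add: inner_add_left)
  then have ga: "g a = - g b" by (metis add_eq_0_iff2 inner_eq_zero_iff)
  have "g a $ 1 * (p b $ 2 - p a $ 2) = 0"
    using orth[OF trivial[of 0 1]] b2 ga by (simp add: inner_vec2 algebra_simps)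
  then have "g a = 0" "g b = 0" using ga b2 ab(3) by (simp_all add: vec_eq_iff forall_2)
  then have "coords g c = 0" if "c \<in> pins a b" for c using that by (auto simp: pins_def)
  then have "\<forall>c\<in>V \<times> UNIV. (\<Sum>e\<in>F. l e * ?M e c) = 0" using l unfolding g by blast
  then show "\<forall>e\<in>F. l e = 0" using indep unfolding independent_edges_def indep_rows_def by blast
qed

lemma independent_edges_edges_in:
  assumes V: "finite V" "simple_graph V F" and indep: "independent_edges V F p"
  shows "independent_edges S (edges_in F S) p"
  unfolding independent_edges_def indep_rows_def
proof (intro allI impI)
  let ?M = "eval_matrix (coords p) rigidity_matrix"
  fix l assume l: "\<forall>c\<in>S \<times> UNIV. (\<Sum>e\<in>edges_in F S. l e * ?M e c) = 0"
  have "(\<Sum>e\<in>edges_in F S. l e * ?M e c) = 0" for c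
  proof (cases "c \<in> S \<times> UNIV")
    case False
    then have "rigidity_matrix e c = PConst 0" if "e \<in> edges_in F S" for e
      using that by (cases c) (auto intro!: rigidity_matrix_outside simp: edges_in_def)
    then show ?thesis by simp
  qed (use l in blast)
  moreover have "indep_rows (edges_in F S) (V \<times> UNIV) ?M"
    using indep unfolding independent_edges_def
    by (rule indep_rows_subset[OF simple_graph_finite[OF V(2,1)] edges_in_subset])
  ultimately show "\<forall>e\<in>edges_in F S. l e = 0" unfolding indep_rows_def by blast
qed

lemma independent_edges_sparse:
  assumes V: "finite V" "simple_graph V F" and p: "generic V p" and indep: "independent_edges V F p"
  shows "sparse V F"
  unfolding sparse_def
proof (intro allI impI)
  fix S assume S: "S \<subseteq> V" "2 \<le> card S"
  have finS: "finite S" using S(1) V(1) finite_subset by blast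
  obtain a b where ab: "a \<in> S" "b \<in> S" "a \<noteq> b" using card_ge_2E[OF S(2)] .
  have "p a $ 2 \<noteq> p b $ 2" using generic_coord_neq[OF p] S(1) ab by blast
  then have "indep_rows (edges_in F S) (S \<times> UNIV - pins a b) (eval_matrix (coords p) rigidity_matrix)"
    using independent_edges_unpin[OF finS simple_graph_edges_in[OF V(2)] ab(1,2)]
      independent_edges_edges_in[OF V indep] by blast
  then have "card (edges_in F S) \<le> card (S \<times> (UNIV :: 2 set) - pins a b)"
    using finS simple_graph_finite[OF V(2,1)]
      by (intro indep_rows_card_le) (auto simp: finite_edges_in)
  then show "card (edges_in F S) + 3 \<le> 2 * card S"
    using card_coords_minus_pins[OF finS ab] S(2) by simp
qed

section \<open>Frameworks of deficient rank are flexible\<close>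

lemma eventually_inj_on_uniformly_on:
  fixes p :: "'a \<Rightarrow> 'b::metric_space"
  assumes "finite V" "inj_on p V"
  shows "\<forall>\<^sub>F q in uniformly_on V p. inj_on q V"
proof -
  have "\<forall>\<^sub>F q in uniformly_on V p. q a \<noteq> q b" if "a \<in> V" "b \<in> V" "a \<noteq> b" for a b
  proof -
    have "((\<lambda>q. dist (q a) (q b)) \<longlongrightarrow> dist (p a) (p b)) (uniformly_on V p)"
      using that by (intro tendsto_dist tendsto_uniformly_on)
    moreover have "dist (p a) (p b) \<noteq> 0" using assms(2) that by (auto dest: inj_onD)
    ultimately have "\<forall>\<^sub>F q in uniformly_on V p. dist (q a) (q b) \<noteq> 0"
      by (rule tendsto_imp_eventually_ne)
    then show ?thesis by (rule eventually_mono) auto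
  qed
  then have "\<forall>\<^sub>F q in uniformly_on V p. \<forall>a\<in>V. \<forall>b\<in>V. a \<noteq> b \<longrightarrow> q a \<noteq> q b"
    using assms(1) by (simp add: eventually_ball_finite_distrib)
  then show ?thesis by (rule eventually_mono) (auto simp: inj_on_def)
qed

text \<open>The pairwise distances of \<open>p\<close> form a finite set, so a nearby configuration realising the same
  set of distances realises each of them at the same pair.\<close>

lemma eventually_isometric_imp_congruent:
  fixes p :: "'a \<Rightarrow> 'b::metric_space"
  assumes "finite V"
  shows "\<forall>\<^sub>F q in uniformly_on V p. \<forall>f. (\<forall>x y. dist (f x) (f y) = dist x y) \<longrightarrow> f ` (p ` V) = q ` V \<longrightarrow>
    congruent_on V p q"
proof -
  let ?D = "(\<lambda>(a, b). dist (p a) (p b)) ` (V \<times> V)"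
  have "uniform_discrete ?D" using assms uniform_discrete_finite_iff[of ?D] by blast
  then obtain \<eta> where \<eta>: "\<eta> > 0" "\<And>s t. s \<in> ?D \<Longrightarrow> t \<in> ?D \<Longrightarrow> dist s t < \<eta> \<Longrightarrow> s = t"
    unfolding uniform_discrete_def by blast
  show ?thesis
    unfolding eventually_uniformly_on congruent_on_def
  proof (intro exI[of _ "\<eta> / 2"] conjI allI impI ballI)
    show "\<eta> / 2 > 0" using \<eta>(1) by simp
    fix q f a b
    assume close: "\<forall>u\<in>V. dist (q u) (p u) < \<eta> / 2" and iso: "\<forall>x y. dist (f x) (f y) = dist x y"
      and image: "f ` (p ` V) = q ` V" and ab: "a \<in> V" "b \<in> V"
    have "q a \<in> f ` (p ` V)" "q b \<in> f ` (p ` V)" unfolding image using ab by auto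
    then have in_D: "dist (q a) (q b) \<in> ?D" "dist (p a) (p b) \<in> ?D" using iso ab by force+
    have "dist (dist (q a) (q b)) (dist (p a) (p b)) \<le> dist (q a) (p a) + dist (q b) (p b)"
      unfolding dist_real_def by metric
    moreover have "dist (q a) (p a) < \<eta> / 2" "dist (q b) (p b) < \<eta> / 2" using close ab by auto
    ultimately have "dist (dist (q a) (q b)) (dist (p a) (p b)) < \<eta>" by linarith
    then show "dist (q a) (q b) = dist (p a) (p b)" by (rule \<eta>(2)[OF in_D])
  qed
qed

lemma rigid_framework_imp_locally_congruent:
  assumes V: "finite V" "inj_on p V" and rigid: "rigid_framework V E p"
  shows "\<forall>\<^sub>F q in uniformly_on V p. equivalent_on E p q \<longrightarrow> congruent_on V p q"
proof -
  obtain \<epsilon> where "\<epsilon> > 0" and \<epsilon>: "\<And>q. inj_on q V \<Longrightarrow> (\<Sum>u\<in>V. (norm (p u - q u))\<^sup>2) \<le> \<epsilon> \<Longrightarrow>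
      equivalent_on E p q \<Longrightarrow>
      \<exists>f :: real^2 \<Rightarrow> real^2. (\<forall>x y. dist (f x) (f y) = dist x y) \<and> f ` (p ` V) = q ` V"
    using rigid unfolding rigid_framework_def equivalent_on_def by auto
  have "((\<lambda>q. \<Sum>u\<in>V. (norm (p u - q u))\<^sup>2) \<longlongrightarrow> (\<Sum>u\<in>V. (norm (p u - p u))\<^sup>2)) (uniformly_on V p)"
    by (intro tendsto_intros tendsto_uniformly_on)
  then have "\<forall>\<^sub>F q in uniformly_on V p. (\<Sum>u\<in>V. (norm (p u - q u))\<^sup>2) < \<epsilon>"
    using \<open>\<epsilon> > 0\<close> by (intro order_tendstoD) auto
  with eventually_inj_on_uniformly_on[OF V] eventually_isometric_imp_congruent[OF V(1), of p]
  show ?thesis by eventually_elim (use \<epsilon> in \<open>meson less_imp_le\<close>)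
qed

lemma small_polynomial_displacement:
  fixes p :: "'a \<Rightarrow> real^2" and K :: "'a \<times> 2 \<Rightarrow> ('a \<times> 2) pexpr"
  assumes K: "finite C" "\<forall>c. c \<notin> C \<longrightarrow> K c = PConst 0" and "\<delta> > 0"
  obtains q \<tau> where "\<tau> > 0" "\<And>u. dist (q u) (p u) < \<delta>"
    "\<And>c. coords (\<lambda>u. q u - p u) c = \<tau> * peval (coords (\<lambda>u. midpoint (p u) (q u))) (K c)"
proof -
  obtain L where L: "\<forall>e\<in>insert (PConst 0) (K ` C).
      bounded_lipschitz_near (coords p) L (\<lambda>x. peval x e)"
    using bounded_lipschitz_near_pevals[of "insert (PConst 0) (K ` C)"] K(1) by blast
  have lipschitz: "bounded_lipschitz_near (coords p) L (\<lambda>x. peval x (K c))" for c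
  proof -
    have "K c \<in> insert (PConst 0) (K ` C)" using K(2) by blast
    then show ?thesis using L by blast
  qed
  have "\<delta> / 4 > 0" using \<open>\<delta> > 0\<close> by simp
  then obtain w \<tau> where "\<tau> > 0" and w_le: "\<And>c. \<bar>w c\<bar> \<le> \<delta> / 4"
    and w: "\<And>c. w c = \<tau> * peval (\<lambda>c. coords p c + w c / 2) (K c)"
    by (rule small_fixed_point[of "coords p" L "\<lambda>c x. peval x (K c)", OF lipschitz]) (rule that)
  define q :: "'a \<Rightarrow> real^2" where "q u = (\<chi> i. p u $ i + w (u, i))" for u
  have "dist (q u) (p u) < \<delta>" for u
  proof -
    have "dist (q u) (p u) \<le> (\<Sum>i\<in>UNIV. \<bar>(q u - p u) $ i\<bar>)" unfolding dist_norm
      by (rule norm_le_l1_cart)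
    also have "\<dots> = \<bar>w (u, 1)\<bar> + \<bar>w (u, 2)\<bar>" by (simp add: q_def sum_2)
    finally show ?thesis using w_le[of "(u, 1)"] w_le[of "(u, 2)"] \<open>\<delta> > 0\<close> by linarith
  qed
  moreover have "coords (\<lambda>u. q u - p u) c = \<tau> * peval (coords (\<lambda>u. midpoint (p u) (q u))) (K c)" for c
  proof -
    have "coords (\<lambda>u. q u - p u) c = w c" by (cases c) (simp add: q_def)
    moreover have "coords (\<lambda>u. midpoint (p u) (q u)) = (\<lambda>c. coords p c + w c / 2)"
      by (auto simp: fun_eq_iff q_def midpoint_def field_simps)
    ultimately show ?thesis by (metis w)
  qed
  ultimately show thesis using that[OF \<open>\<tau> > 0\<close>] by blast
qed

text \<open>To flex the framework along a polynomial field \<open>K\<close> of infinitesimal motions, solve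
  \<open>q - p = \<tau> K((p + q) / 2)\<close>: then \<open>q - p\<close> is an infinitesimal motion of the midpoint configuration.\<close>

lemma flex_along_polynomial_field:
  fixes K :: "'a \<times> 2 \<Rightarrow> ('a \<times> 2) pexpr"
  assumes K: "finite C" "\<forall>c. c \<notin> C \<longrightarrow> K c = PConst 0"
    and field: "\<forall>\<^sub>F m in uniformly_on UNIV p.
      infinitesimal_motion E m (\<lambda>u. \<chi> i. peval (coords m) (K (u, i)))"
    and P: "\<forall>\<^sub>F q in uniformly_on UNIV p. P q"
  obtains q \<tau> where "\<tau> > 0" "P q" "P (\<lambda>u. midpoint (p u) (q u))" "equivalent_on E p q"
    "\<And>c. coords (\<lambda>u. q u - p u) c = \<tau> * peval (coords (\<lambda>u. midpoint (p u) (q u))) (K c)"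
proof -
  from eventually_conj[OF field P] obtain \<delta> where "\<delta> > 0"
    and \<delta>: "\<And>m. \<forall>u. dist (m u) (p u) < \<delta> \<Longrightarrow>
      infinitesimal_motion E m (\<lambda>u. \<chi> i. peval (coords m) (K (u, i))) \<and> P m"
    unfolding eventually_uniformly_on by auto
  obtain q \<tau> where "\<tau> > 0" and near_q: "\<And>u. dist (q u) (p u) < \<delta>"
    and flex: "\<And>c. coords (\<lambda>u. q u - p u) c = \<tau> * peval (coords (\<lambda>u. midpoint (p u) (q u))) (K c)"
    by (rule small_polynomial_displacement[OF K \<open>\<delta> > 0\<close>]) (rule that)
  let ?m = "\<lambda>u. midpoint (p u) (q u)"
  have near_m: "dist (?m u) (p u) < \<delta>" for u
  proof -
    have "dist (?m u) (p u) = dist (q u) (p u) / 2" using dist_midpoint(3)[of "p u" "q u"]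
      by (simp add: dist_commute)
    then show ?thesis using near_q[of u] zero_le_dist[of "q u" "p u"] by linarith
  qed
  have displacement: "q u - p u = \<tau> *\<^sub>R (\<chi> i. peval (coords ?m) (K (u, i)))" for u
    unfolding vec_eq_iff
  proof
    fix i
    show "(q u - p u) $ i = (\<tau> *\<^sub>R (\<chi> i. peval (coords ?m) (K (u, i)))) $ i" using flex[of "(u, i)"]
      by simp
  qed
  have m: "infinitesimal_motion E ?m (\<lambda>u. \<chi> i. peval (coords ?m) (K (u, i)))" "P ?m"
    using \<delta>[of ?m] near_m by auto
  have "infinitesimal_motion E ?m (\<lambda>u. q u - p u)"
    unfolding displacement by (rule infinitesimal_motion_scaleR[OF m(1)])
  then have "equivalent_on E p q" by (simp only: infinitesimal_motion_midpoint_iff)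
  moreover have "P q" using \<delta>[of q] near_q by blast
  ultimately show thesis using that[OF \<open>\<tau> > 0\<close> _ _ _ flex] m(2) by blast
qed

lemma independent_edges_certificate:
  assumes "finite F" "simple_graph V F" "independent_edges V F p"
  obtains D where "pvars D \<subseteq> V \<times> UNIV" "peval (coords p) D \<noteq> 0"
    "\<And>q. peval (coords q) D \<noteq> 0 \<Longrightarrow> independent_edges V F q"
  using assms(3) unfolding independent_edges_def
proof (rule indep_rows_certificate[OF assms(1)])
  show "pvars (rigidity_matrix e c) \<subseteq> V \<times> UNIV" if "e \<in> F" for e c
    using pvars_rigidity_matrix[OF assms(2) that] .
qed (use that in \<open>simp add: independent_edges_def\<close>)

lemma eventually_independent_edges:
  assumes "finite F" "simple_graph V F" "independent_edges V F p"
  shows "\<forall>\<^sub>F q in uniformly_on V p. independent_edges V F q"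
proof -
  obtain D where D: "pvars D \<subseteq> V \<times> UNIV" "peval (coords p) D \<noteq> 0"
    "\<And>q. peval (coords q) D \<noteq> 0 \<Longrightarrow> independent_edges V F q"
    using independent_edges_certificate[OF assms] by blast
  from eventually_peval_coords_neq[OF D(1,2)] show ?thesis by (rule eventually_mono) (rule D(3))
qed

lemma independent_edges_generic:
  assumes "finite F" "simple_graph V F" "independent_edges V F q" "generic V p"
  shows "independent_edges V F p"
  using independent_edges_certificate[OF assms(1-3)] genericD[OF assms(4)] by metis

definition rigidity_basis :: "'a set \<Rightarrow> 'a set set \<Rightarrow> ('a \<Rightarrow> real^2) \<Rightarrow> 'a set set \<Rightarrow> bool" where
  "rigidity_basis V E p F \<longleftrightarrow>
    F \<subseteq> E \<and> independent_edges V F p \<and> (\<forall>e\<in>E - F. \<not> independent_edges V (insert e F) p)"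

lemma rigidity_basis_exists:
  assumes "finite E"
  shows "\<exists>F. rigidity_basis V E p F"
  using indep_rows_maximal_subset[OF assms] unfolding rigidity_basis_def independent_edges_def
    by metis

lemma rigidity_basis_graph:
  assumes "finite V" "simple_graph V E" "rigidity_basis V E p F"
  shows "finite F" "simple_graph V F"
  using assms simple_graph_finite[OF assms(2,1)] finite_subset simple_graph_subset[OF assms(2)]
  unfolding rigidity_basis_def by blast+

lemma eventually_rigidity_basis:
  assumes V: "finite V" "simple_graph V E" and p: "generic V p" and F: "rigidity_basis V E p F"
  shows "\<forall>\<^sub>F q in uniformly_on V p. rigidity_basis V E q F"
proof -
  note graph = rigidity_basis_graph[OF V F]
  have "\<not> independent_edges V (insert e F) q" if e: "e \<in> E - F" for e q
  proof
    assume "independent_edges V (insert e F) q"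
    moreover have "simple_graph V (insert e F)"
      using F e by (intro simple_graph_subset[OF V(2)]) (auto simp: rigidity_basis_def)
    ultimately have "independent_edges V (insert e F) p"
      using independent_edges_generic[OF _ _ _ p] graph(1) by blast
    then show False using F e by (simp add: rigidity_basis_def)
  qed
  then show ?thesis
    using eventually_independent_edges[OF graph, of p] F unfolding rigidity_basis_def
    by (auto elim: eventually_mono)
qed

lemma rigidity_basis_motion:
  assumes V: "finite V" "simple_graph V E" and F: "rigidity_basis V E q F"
    and motion: "infinitesimal_motion F q w"
  shows "infinitesimal_motion E q w"
  unfolding infinitesimal_motion_iff_kernel[OF V]
proof
  fix e assume e: "e \<in> E"
  note graph = rigidity_basis_graph[OF V F]
  have kernel: "(\<Sum>c\<in>V \<times> UNIV. peval (coords q) (rigidity_matrix f c) * coords w c) = 0"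
    if "f \<in> F" for f
    using motion that unfolding infinitesimal_motion_iff_kernel[OF V(1) graph(2)] by blast
  show "(\<Sum>c\<in>V \<times> UNIV. peval (coords q) (rigidity_matrix e c) * coords w c) = 0"
  proof (cases "e \<in> F")
    case False
    then show ?thesis
      using F e unfolding rigidity_basis_def independent_edges_def
      by (intro dependent_row_kernel[OF graph(1) False _ _ kernel]) auto
  qed (rule kernel)
qed

lemma rank_deficient_motion_field:
  assumes V: "finite V" "simple_graph V E" and p: "generic V p" and ab: "a \<in> V" "b \<in> V" "a \<noteq> b"
    and F: "rigidity_basis V E p F" and deficient: "card F < 2 * card V - 3"
  obtains K where "\<forall>c. c \<notin> V \<times> UNIV - pins a b \<longrightarrow> K c = PConst 0"
    "\<exists>c\<in>V \<times> UNIV. peval (coords p) (K c) \<noteq> 0"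
    "\<forall>\<^sub>F q in uniformly_on V p. infinitesimal_motion E q (\<lambda>u. \<chi> i. peval (coords q) (K (u, i)))"
proof -
  let ?C = "V \<times> UNIV - pins a b"
  note graph = rigidity_basis_graph[OF V F]
  have "indep_rows F ?C (eval_matrix (coords p) rigidity_matrix)"
    using independent_edges_unpin[OF V(1) graph(2) ab(1,2) generic_coord_neq[OF p ab]] F
    by (simp add: rigidity_basis_def)
  moreover have "finite ?C" "card F < card ?C"
    using V(1) card_coords_minus_pins[OF V(1) ab] deficient by auto
  ultimately obtain k
    where k: "\<And>x e. e \<in> F \<Longrightarrow> (\<Sum>c\<in>?C. peval x (rigidity_matrix e c) * peval x (k c)) = 0"
    and k0: "\<exists>c\<in>?C. peval (coords p) (k c) \<noteq> 0"
    by (rule polynomial_kernel_vector[OF graph(1)]) (rule that)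
  define K where "K c = (if c \<in> ?C then k c else PConst 0)" for c
  let ?w = "\<lambda>q u. \<chi> i. peval (coords q) (K (u, i))"
  have coords_w: "coords (?w q) c = peval (coords q) (K c)" for q c by (cases c) simp
  have motion_F: "infinitesimal_motion F q (?w q)" for q
    unfolding infinitesimal_motion_iff_kernel[OF V(1) graph(2)]
  proof
    fix e assume "e \<in> F"
    have "pinned a b (?w q)" unfolding pinned_iff_coords coords_w by (simp add: K_def)
    then have "(\<Sum>c\<in>V \<times> UNIV. peval (coords q) (rigidity_matrix e c) * coords (?w q) c) =
        (\<Sum>c\<in>?C. peval (coords q) (rigidity_matrix e c) * coords (?w q) c)"
      by (rule sum_pinned[OF V(1), symmetric])
    also have "\<dots> = (\<Sum>c\<in>?C. peval (coords q) (rigidity_matrix e c) * peval (coords q) (k c))"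
      unfolding coords_w by (intro sum.cong) (simp_all add: K_def)
    also have "\<dots> = 0" by (rule k[OF \<open>e \<in> F\<close>])
    finally show "(\<Sum>c\<in>V \<times> UNIV. peval (coords q) (rigidity_matrix e c) * coords (?w q) c) = 0" .
  qed
  have "\<forall>\<^sub>F q in uniformly_on V p. infinitesimal_motion E q (?w q)"
    using eventually_rigidity_basis[OF V p F]
    by eventually_elim (rule rigidity_basis_motion[OF V _ motion_F])
  moreover have "\<exists>c\<in>V \<times> UNIV. peval (coords p) (K c) \<noteq> 0" using k0 by (auto simp: K_def)
  moreover have "K c = PConst 0" if "c \<notin> ?C" for c unfolding K_def using that by (rule if_not_P)
  ultimately show thesis using that[of K] by blast
qed

lemma not_rigid_if_rank_deficient:
  assumes V: "finite V" "simple_graph V E" "card V \<ge> 2" and p: "generic V p"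
    and F: "rigidity_basis V E p F" and deficient: "card F < 2 * card V - 3"
  shows "\<not> rigid_framework V E p"
proof
  assume rigid: "rigid_framework V E p"
  obtain a b where ab: "a \<in> V" "b \<in> V" "a \<noteq> b" using card_ge_2E[OF V(3)] .
  obtain K where K: "\<forall>c. c \<notin> V \<times> UNIV - pins a b \<longrightarrow> K c = PConst 0"
    and nonzero: "\<exists>c\<in>V \<times> UNIV. peval (coords p) (K c) \<noteq> 0"
    and field: "\<forall>\<^sub>F q in uniformly_on V p.
      infinitesimal_motion E q (\<lambda>u. \<chi> i. peval (coords q) (K (u, i)))"
    by (rule rank_deficient_motion_field[OF V(1,2) p ab F deficient]) (rule that)
  obtain v j where v: "v \<in> V" "peval (coords p) (K (v, j)) \<noteq> 0" using nonzero by blast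
  obtain H where H: "henneberg V H" using henneberg_exists[OF V(1,3)] by blast
  define good where "good q \<longleftrightarrow> infinitesimally_rigid V H q \<and> q a $ 2 \<noteq> q b $ 2 \<and>
    (equivalent_on E p q \<longrightarrow> congruent_on V p q)" for q
  from eventually_coord_neq[OF ab(1,2) generic_coord_neq[OF p ab]]
    henneberg_eventually_infinitesimally_rigid[OF H p]
    rigid_framework_imp_locally_congruent[OF V(1) generic_inj_on[OF p] rigid]
  have "\<forall>\<^sub>F q in uniformly_on V p. good q" by eventually_elim (simp add: good_def)
  moreover have "\<forall>\<^sub>F q in uniformly_on UNIV p. peval (coords q) (K (v, j)) \<noteq> 0"
    by (rule eventually_peval_coords_neq[OF _ v(2)]) simp
  ultimately have near: "\<forall>\<^sub>F q in uniformly_on UNIV p. good q \<and> peval (coords q) (K (v, j)) \<noteq> 0"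
    by (intro eventually_conj eventually_uniformly_on_subset[OF _ subset_UNIV])
  have finC: "finite (V \<times> UNIV - pins a b)" using V(1) by simp
  obtain q \<tau> where "\<tau> > 0" and q: "good q \<and> peval (coords q) (K (v, j)) \<noteq> 0"
    and m: "good (\<lambda>u. midpoint (p u) (q u)) \<and>
      peval (coords (\<lambda>u. midpoint (p u) (q u))) (K (v, j)) \<noteq> 0"
    and edges: "equivalent_on E p q"
    and flex: "\<And>c. coords (\<lambda>u. q u - p u) c = \<tau> * peval (coords (\<lambda>u. midpoint (p u) (q u))) (K c)"
    by (rule flex_along_polynomial_field[OF finC K
          eventually_uniformly_on_subset[OF field subset_UNIV] near])
      (rule that)
  have "equivalent_on H p q"
    using q edges congruent_on_imp_equivalent_on[OF henneberg_simple_graph(2)[OF H], of p q]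
    unfolding good_def by blast
  then have "infinitesimal_motion H (\<lambda>u. midpoint (p u) (q u)) (\<lambda>u. q u - p u)"
    by (simp only: infinitesimal_motion_midpoint_iff)
  moreover have "K c = PConst 0" if "c \<in> pins a b" for c using K that by blast
  then have "pinned a b (\<lambda>u. q u - p u)" by (simp add: pinned_iff_coords flex)
  ultimately have "q v - p v = 0"
    using m infinitesimally_rigid_iff_pinned[of a V b "\<lambda>u. midpoint (p u) (q u)" H] ab(1,2) v(1)
    unfolding good_def by blast
  then have "\<tau> * peval (coords (\<lambda>u. midpoint (p u) (q u))) (K (v, j)) = 0" using flex[of "(v, j)"]
    by simp
  then show False using m \<open>\<tau> > 0\<close> by simp
qed

lemma generically_rigid_contains_laman:
  assumes V: "finite V" "simple_graph V E" "card V \<ge> 2" and rigid: "generically_rigid_2 V E"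
  shows "\<exists>F\<subseteq>E. laman V F"
proof -
  obtain p where p: "generic V p" using generic_exists[OF V(1)] by blast
  have "rigid_framework V E p" using rigid p generic_inj_on[OF p] unfolding generically_rigid_2_def
    by blast
  obtain F where F: "rigidity_basis V E p F"
    using rigidity_basis_exists[OF simple_graph_finite[OF V(2,1)]] by blast
  note graph = rigidity_basis_graph(2)[OF V(1,2) F]
  have sparse: "sparse V F"
    using independent_edges_sparse[OF V(1) graph p] F by (simp add: rigidity_basis_def)
  have "card F + 3 \<le> 2 * card V" using sparseD[OF sparse order_refl V(3)]
    by (simp add: edges_in_all[OF graph])
  moreover have "\<not> card F < 2 * card V - 3"
    using not_rigid_if_rank_deficient[OF V p F] \<open>rigid_framework V E p\<close> by blast
  ultimately have "laman V F" using laman_iff_sparse[OF V(1) graph] sparse by simp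
  then show ?thesis using F unfolding rigidity_basis_def by blast
qed

section \<open>Generic minimal rigidity\<close>

lemma generically_rigid_2_mono:
  assumes "generically_rigid_2 V F" "F \<subseteq> E"
  shows "generically_rigid_2 V E"
proof -
  have "rigid_framework V E p" if "rigid_framework V F p" for p
    using that assms(2) unfolding rigid_framework_def by (meson subsetD)
  then show ?thesis using assms(1) unfolding generically_rigid_2_def by blast
qed

lemma henneberg_imp_generically_minimally_rigid:
  assumes H: "henneberg V E"
  shows "generically_minimally_rigid_2 V E"
proof -
  note graph = henneberg_simple_graph[OF H]
  have "\<not> generically_rigid_2 V (E - {e})" if "e \<in> E" for e
  proof
    assume "generically_rigid_2 V (E - {e})"
    then obtain F where F: "F \<subseteq> E - {e}" "laman V F"
      using generically_rigid_contains_laman[OF graph(1) simple_graph_subset[OF graph(2) Diff_subset]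
        henneberg_card_ge_2[OF H]]
      by blast
    have "card F < card E"
      using F(1) that by (intro psubset_card_mono simple_graph_finite[OF graph(2,1)]) blast
    then show False using F(2) henneberg_card_edges[OF H] by (simp add: laman_def)
  qed
  then show ?thesis
    using henneberg_imp_generically_rigid[OF H] unfolding generically_minimally_rigid_2_def by blast
qed

lemma generically_minimally_rigid_imp_henneberg:
  assumes V: "finite V" "simple_graph V E" "card V \<ge> 2" and min: "generically_minimally_rigid_2 V E"
  shows "henneberg V E"
proof -
  obtain F where F: "F \<subseteq> E" "laman V F"
    using generically_rigid_contains_laman[OF V] min unfolding generically_minimally_rigid_2_def
      by blast
  have H: "henneberg V F"
    by (rule laman_imp_henneberg[OF F(2) simple_graph_subset[OF V(2) F(1)] V(3)])
  have "e \<in> F" if "e \<in> E" for e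
  proof (rule ccontr)
    assume "e \<notin> F"
    then have "generically_rigid_2 V (E - {e})"
      using F(1) by (intro generically_rigid_2_mono[OF henneberg_imp_generically_rigid[OF H]]) blast
    then show False using min that unfolding generically_minimally_rigid_2_def by blast
  qed
  then have "E = F" using F(1) by blast
  then show ?thesis using H by simp
qed

section \<open>Multigraph trees\<close>

abbreviation mg_conn :: "'e set \<Rightarrow> ('e \<Rightarrow> 'w set) \<Rightarrow> 'w \<Rightarrow> 'w \<Rightarrow> bool" where
  "mg_conn Ed ends \<equiv> (mg_adj Ed ends)\<^sup>*\<^sup>*"

definition mg_loopless :: "'w set \<Rightarrow> 'e set \<Rightarrow> ('e \<Rightarrow> 'w set) \<Rightarrow> bool" where
  "mg_loopless W Ed ends \<longleftrightarrow> (\<forall>e\<in>Ed. \<exists>u\<in>W. \<exists>w\<in>W. u \<noteq> w \<and> ends e = {u, w})"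

lemma mg_looplessE:
  assumes "mg_loopless W Ed ends" "e \<in> Ed"
  obtains u w where "u \<in> W" "w \<in> W" "u \<noteq> w" "ends e = {u, w}"
  using assms unfolding mg_loopless_def by blast

lemma mg_loopless_subset: "mg_loopless W Ed ends \<Longrightarrow> F \<subseteq> Ed \<Longrightarrow> mg_loopless W F ends"
  by (auto simp: mg_loopless_def)

lemma mg_conn_sym: "mg_conn Ed ends u w \<Longrightarrow> mg_conn Ed ends w u"
proof -
  have "symp (mg_adj Ed ends)" by (auto simp: symp_def mg_adj_def insert_commute)
  then show "mg_conn Ed ends u w \<Longrightarrow> mg_conn Ed ends w u" by (metis symp_rtranclp sympD)
qed

lemma mg_conn_mono: "mg_conn Ed ends u w \<Longrightarrow> Ed \<subseteq> Ed' \<Longrightarrow> mg_conn Ed' ends u w"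
  by (erule rtranclp_mono[THEN predicate2D, rotated]) (unfold mg_adj_def, blast)

lemma mg_conn_edge:
  assumes "e \<in> Ed" "ends e = {u, w}"
  shows "mg_conn Ed ends u w"
  using assms by (intro r_into_rtranclp) (auto simp: mg_adj_def)

lemma mg_conn_insert_iff:
  assumes "ends e = {u, w}"
  shows "mg_conn (insert e Ed) ends x y \<longleftrightarrow> mg_conn Ed ends x y \<or>
    mg_conn Ed ends x u \<and> mg_conn Ed ends w y \<or> mg_conn Ed ends x w \<and> mg_conn Ed ends u y"
    (is "?L \<longleftrightarrow> ?R x y")
proof
  assume ?L
  then show "?R x y"
  proof (induction rule: rtranclp_induct)
    case (step y z)
    from step.hyps(2) have "mg_adj Ed ends y z \<or> {y, z} = {u, w}" using assms
      by (auto simp: mg_adj_def)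
    then show ?case
    proof
      assume "mg_adj Ed ends y z"
      then show ?thesis using step.IH by (meson rtranclp.rtrancl_into_rtrancl)
    next
      assume "{y, z} = {u, w}"
      then have "y = u \<and> z = w \<or> y = w \<and> z = u" by (auto simp: doubleton_eq_iff)
      then show ?thesis using step.IH by auto
    qed
  qed simp
next
  have up: "mg_conn (insert e Ed) ends a b" if "mg_conn Ed ends a b" for a b
    using mg_conn_mono[OF that] by blast
  have "mg_conn (insert e Ed) ends u w" "mg_conn (insert e Ed) ends w u"
    using assms by (auto intro!: mg_conn_edge[of e] simp: insert_commute)
  moreover assume "?R x y"
  ultimately show ?L using up by (meson rtranclp_trans)
qed

lemma mg_conn_insert_redundant:
  assumes "ends e = {u, w}" "mg_conn Ed ends u w"
  shows "mg_conn (insert e Ed) ends = mg_conn Ed ends"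
  unfolding fun_eq_iff mg_conn_insert_iff[of ends, OF assms(1)]
  using assms(2) mg_conn_sym[OF assms(2)] by (meson rtranclp_trans)

lemma mg_connected_exchange:
  assumes "mg_connected W (insert e Ed) ends" "ends e = {u, w}" "ends f = {s, t}"
    and "mg_conn Ed ends u s" "mg_conn Ed ends w t"
  shows "mg_connected W (insert f Ed) ends"
proof -
  have "mg_conn (insert f Ed) ends u w"
    unfolding mg_conn_insert_iff[of ends, OF assms(3)] using assms(4) mg_conn_sym[OF assms(5)]
      by blast
  then have "mg_conn (insert f (insert e Ed)) ends = mg_conn (insert f Ed) ends"
    using mg_conn_insert_redundant[of ends e] assms(2) by (simp add: insert_commute)
  moreover have "mg_conn (insert f (insert e Ed)) ends x y" if "x \<in> W" "y \<in> W" for x y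
    using assms(1) that mg_conn_mono[of "insert e Ed" ends x y] unfolding mg_connected_def by blast
  ultimately show ?thesis using assms(1) unfolding mg_connected_def by metis
qed

lemma mg_connected_cong:
  assumes "\<And>e. e \<in> Ed \<Longrightarrow> ends e = ends' e"
  shows "mg_conn Ed ends = mg_conn Ed ends'" "mg_connected W Ed ends = mg_connected W Ed ends'"
proof -
  have "mg_adj Ed ends = mg_adj Ed ends'" using assms by (fastforce simp: fun_eq_iff mg_adj_def)
  then show "mg_conn Ed ends = mg_conn Ed ends'" "mg_connected W Ed ends = mg_connected W Ed ends'"
    by (simp_all add: mg_connected_def)
qed

lemma mg_connected_image:
  assumes "mg_connected W Ed ends" "\<And>e. e \<in> Ed \<Longrightarrow> ends' e = \<phi> ` ends e"
  shows "mg_connected (\<phi> ` W) Ed ends'"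
proof -
  have "mg_conn Ed ends' (\<phi> u) (\<phi> w)" if "mg_conn Ed ends u w" for u w
    using that
  proof (induction rule: rtranclp_induct)
    case (step y z)
    then obtain e where "e \<in> Ed" "ends e = {y, z}" by (auto simp: mg_adj_def)
    then have "mg_conn Ed ends' (\<phi> y) (\<phi> z)" using assms(2) by (intro mg_conn_edge[of e]) auto
    then show ?case using step.IH by (meson rtranclp_trans)
  qed simp
  then show ?thesis using assms(1) by (auto simp: mg_connected_def)
qed

lemma mg_connectedI:
  assumes "r \<in> W" "\<And>w. w \<in> W \<Longrightarrow> mg_conn Ed ends r w"
  shows "mg_connected W Ed ends"
  using assms mg_conn_sym unfolding mg_connected_def by (metis empty_iff rtranclp_trans)

lemma mg_connected_insert_pendant:
  assumes "mg_connected W Ed ends" "u \<in> W" "ends e = {u, w}"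
  shows "mg_connected (insert w W) (insert e Ed) ends"
proof (rule mg_connectedI)
  show "u \<in> insert w W" using assms(2) by simp
  fix x assume "x \<in> insert w W"
  then show "mg_conn (insert e Ed) ends u x"
    using assms(1,2) unfolding mg_connected_def mg_conn_insert_iff[of ends, OF assms(3)] by blast
qed

lemma mg_cycle_mono:
  assumes "mg_cycle W Ed ends vs es" "W \<subseteq> W'" "Ed \<subseteq> Ed'"
  shows "mg_cycle W' Ed' ends vs es"
  using assms unfolding mg_cycle_def by auto

lemma mg_conn_simple_path:
  assumes "mg_conn Ed ends u w" "u \<in> W" "mg_loopless W Ed ends"
  shows "\<exists>vs es. length vs = Suc (length es) \<and> vs ! 0 = u \<and> vs ! length es = w \<and> distinct vs \<and>
     set vs \<subseteq> W \<and> set es \<subseteq> Ed \<and> (\<forall>i<length es. ends (es ! i) = {vs ! i, vs ! Suc i})"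
  using assms(1)
proof (induction rule: rtranclp_induct)
  case base
  show ?case using assms(2) by (intro exI[of _ "[u]"] exI[of _ "[]"]) auto
next
  case (step y z)
  then obtain vs es where path: "length vs = Suc (length es)" "vs ! 0 = u" "vs ! length es = y"
    "distinct vs"
    "set vs \<subseteq> W" "set es \<subseteq> Ed" "\<forall>i<length es. ends (es ! i) = {vs ! i, vs ! Suc i}" by blast
  obtain e where e: "e \<in> Ed" "ends e = {y, z}" using step.hyps(2) by (auto simp: mg_adj_def)
  show ?case
  proof (cases "z \<in> set vs")
    case True
    then obtain k where k: "k < length vs" "vs ! k = z" by (auto simp: in_set_conv_nth)
    have "set (take (Suc k) vs) \<subseteq> W" "set (take k es) \<subseteq> Ed"
      using path(5,6) set_take_subset by (meson subset_trans)+
    then show ?thesis using path k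
      by (intro exI[of _ "take (Suc k) vs"] exI[of _ "take k es"]) auto
  next
    case False
    have "z \<in> W" using mg_looplessE[OF assms(3) e(1)] e(2) by (metis insert_iff singletonD)
    then show ?thesis using path e False
      by (intro exI[of _ "vs @ [z]"] exI[of _ "es @ [e]"]) (auto simp: nth_append less_Suc_eq)
  qed
qed

lemma mg_cycle_closing_edge:
  assumes "mg_conn Ed ends u w" "e \<notin> Ed" "ends e = {u, w}" "u \<in> W" "mg_loopless W Ed ends"
  shows "\<exists>vs es. mg_cycle W (insert e Ed) ends vs es"
proof -
  from mg_conn_simple_path[OF assms(1,4,5)] obtain vs es where
    path: "length vs = Suc (length es)" "vs ! 0 = u" "vs ! length es = w" "distinct vs"
    "set vs \<subseteq> W" "set es \<subseteq> Ed" "\<And>i. i < length es \<Longrightarrow> ends (es ! i) = {vs ! i, vs ! Suc i}" by blast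
  have "distinct es" unfolding distinct_conv_nth
  proof (intro allI impI notI)
    fix i j assume ij: "i < length es" "j < length es" "i \<noteq> j" "es ! i = es ! j"
    then have "{vs ! i, vs ! Suc i} = {vs ! j, vs ! Suc j}" using path(7) by metis
    then have "i = j \<or> (i = Suc j \<and> Suc i = j)"
      using ij path(1,4) by (auto simp: doubleton_eq_iff nth_eq_iff_index_eq)
    then show False using ij by auto
  qed
  then have "distinct (es @ [e])" using path(6) assms(2) by auto
  moreover have "ends ((es @ [e]) ! i) = {vs ! i, vs ! ((i + 1) mod length vs)}"
    if "i < length (es @ [e])" for i
  proof (cases "i = length es")
    case True
    then show ?thesis using path assms(3) by (auto simp: nth_append)
  next
    case False
    then show ?thesis using that path by (auto simp: nth_append)
  qed
  ultimately have "mg_cycle W (insert e Ed) ends vs (es @ [e])"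
    using path unfolding mg_cycle_def by auto
  then show ?thesis by blast
qed

lemma mg_cycle_redundant_edge:
  assumes "mg_cycle W Ed ends vs es"
  obtains e u w where "e \<in> Ed" "ends e = {u, w}" "mg_conn (Ed - {e}) ends u w"
proof -
  obtain k where k: "length vs = Suc k" "length es = Suc k"
    using assms by (auto simp: mg_cycle_def gr0_conv_Suc Suc_le_eq)
  have es: "distinct es" "set es \<subseteq> Ed"
    and ends: "\<And>i. i < Suc k \<Longrightarrow> ends (es ! i) = {vs ! i, vs ! ((i + 1) mod Suc k)}"
    using assms k unfolding mg_cycle_def by auto
  have path: "mg_conn (Ed - {es ! k}) ends (vs ! 0) (vs ! i)" if "i \<le> k" for i
    using that
  proof (induction i)
    case (Suc i)
    then have "es ! i \<in> Ed - {es ! k}" using es k by (auto simp: nth_eq_iff_index_eq)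
    then have "mg_conn (Ed - {es ! k}) ends (vs ! i) (vs ! Suc i)"
      using ends[of i] Suc.prems by (intro mg_conn_edge) auto
    then show ?case using Suc by (meson Suc_leD rtranclp_trans)
  qed simp
  have "es ! k \<in> Ed" using es(2) k by auto
  moreover have "ends (es ! k) = {vs ! 0, vs ! k}" using ends[of k] by auto
  ultimately show thesis using that path[of k] by blast
qed

definition mg_component :: "'w set \<Rightarrow> 'e set \<Rightarrow> ('e \<Rightarrow> 'w set) \<Rightarrow> 'w \<Rightarrow> 'w set" where
  "mg_component W Ed ends x = {y \<in> W. mg_conn Ed ends x y}"

definition mg_components :: "'w set \<Rightarrow> 'e set \<Rightarrow> ('e \<Rightarrow> 'w set) \<Rightarrow> 'w set set" where
  "mg_components W Ed ends = mg_component W Ed ends ` W"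

lemma mg_component_eq_iff:
  assumes "x \<in> W" "y \<in> W"
  shows "mg_component W Ed ends x = mg_component W Ed ends y \<longleftrightarrow> mg_conn Ed ends x y"
proof
  assume "mg_component W Ed ends x = mg_component W Ed ends y"
  moreover have "y \<in> mg_component W Ed ends y" using assms by (simp add: mg_component_def)
  ultimately have "y \<in> mg_component W Ed ends x" by simp
  then show "mg_conn Ed ends x y" by (simp add: mg_component_def)
next
  assume "mg_conn Ed ends x y"
  then show "mg_component W Ed ends x = mg_component W Ed ends y"
    using mg_conn_sym[of Ed ends x y] unfolding mg_component_def
      by (meson Collect_cong rtranclp_trans)
qed

lemma mg_components_insert_redundant:
  assumes "ends e = {u, w}" "mg_conn Ed ends u w"
  shows "mg_components W (insert e Ed) ends = mg_components W Ed ends"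
  unfolding mg_components_def mg_component_def mg_conn_insert_redundant[of ends, OF assms] ..

lemma mg_components_insert_bridge:
  fixes W :: "'w set" and Ed :: "'e set"
  assumes e: "ends e = {u, w}" "u \<in> W" "w \<in> W"
  defines "C \<equiv> mg_component W Ed ends"
  shows "mg_components W (insert e Ed) ends =
    insert (C u \<union> C w) (mg_components W Ed ends - {C u, C w})"
proof -
  have C_eq: "mg_conn Ed ends x y \<longleftrightarrow> C x = C y" if "x \<in> W" "y \<in> W" for x y
    unfolding C_def using mg_component_eq_iff[OF that] by blast
  have C_mem: "y \<in> C x \<longleftrightarrow> y \<in> W \<and> C x = C y" if "x \<in> W" for x y
  proof -
    have "y \<in> C x \<longleftrightarrow> y \<in> W \<and> mg_conn Ed ends x y" by (simp add: C_def mg_component_def)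
    then show ?thesis using C_eq[OF that] by blast
  qed
  have comp: "mg_component W (insert e Ed) ends x = (if C x \<in> {C u, C w} then C u \<union> C w else C x)"
    if "x \<in> W" for x
  proof -
    have "mg_component W (insert e Ed) ends x =
        {y \<in> W. C x = C y \<or> C x = C u \<and> C w = C y \<or> C x = C w \<and> C u = C y}"
      unfolding mg_component_def mg_conn_insert_iff[of ends, OF e(1)]
      using that e(2,3) by (intro Collect_cong) (simp add: C_eq cong: conj_cong)
    also have "\<dots> = (if C x \<in> {C u, C w} then C u \<union> C w else C x)"
      using C_mem[OF that] C_mem[OF e(2)] C_mem[OF e(3)] by (intro set_eqI) (simp, metis)
    finally show ?thesis .
  qed
  have image_merge: "(\<lambda>X. if X \<in> B then A else X) ` \<C> = insert A (\<C> - B)" if "B \<inter> \<C> \<noteq> {}"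
    for A B and \<C> :: "'w set set"
    using that by (auto simp: image_iff)
  have "mg_component W (insert e Ed) ends ` W = (\<lambda>X. if X \<in> {C u, C w} then C u \<union> C w else X) ` C ` W"
    unfolding image_image by (intro image_cong refl comp)
  also have "\<dots> = insert (C u \<union> C w) (C ` W - {C u, C w})"
    using e(2) by (intro image_merge) blast
  finally show ?thesis by (simp add: mg_components_def C_def)
qed

lemma card_mg_components_insert_bridge:
  assumes "finite W" and e: "ends e = {u, w}" "u \<in> W" "w \<in> W" and bridge: "\<not> mg_conn Ed ends u w"
  shows "card (mg_components W (insert e Ed) ends) + 1 = card (mg_components W Ed ends)"
proof -
  let ?C = "mg_component W Ed ends" and ?CC = "mg_components W Ed ends"
  have "finite ?CC" using assms(1) by (simp add: mg_components_def)
  moreover have uw: "?C u \<in> ?CC" "?C w \<in> ?CC" "?C u \<noteq> ?C w"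
    using e bridge by (auto simp: mg_components_def mg_component_eq_iff)
  moreover have "?C u \<union> ?C w \<notin> ?CC - {?C u, ?C w}"
  proof
    assume "?C u \<union> ?C w \<in> ?CC - {?C u, ?C w}"
    then obtain x where x: "x \<in> W" "?C u \<union> ?C w = ?C x" "?C x \<noteq> ?C u"
      by (auto simp: mg_components_def)
    moreover have "u \<in> ?C u" using e(2) by (simp add: mg_component_def)
    ultimately have "u \<in> ?C x" by blast
    then have "mg_conn Ed ends x u" by (simp add: mg_component_def)
    then show False using x(3) mg_component_eq_iff[OF x(1) e(2)] by blast
  qed
  moreover have "card {?C u, ?C w} \<le> card ?CC" using uw(1,2) \<open>finite ?CC\<close> by (intro card_mono) auto
  ultimately show ?thesis
    unfolding mg_components_insert_bridge[of ends, OF e] by (simp add: card_Diff_subset)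
qed

lemma card_mg_components_no_edges: "card (mg_components W {} ends) = card W"
proof -
  have "\<not> mg_adj {} ends u w" for u w by (simp add: mg_adj_def)
  then have "mg_conn {} ends u w \<longleftrightarrow> u = w" for u w by (metis converse_rtranclpE rtranclp.rtrancl_refl)
  then have "mg_component W {} ends x = {x}" if "x \<in> W" for x using that
    by (auto simp: mg_component_def)
  then show ?thesis unfolding mg_components_def by (subst card_image) (auto simp: inj_on_def)
qed

lemma card_vertices_le_components_edges:
  assumes "finite Ed" "finite W" "mg_loopless W Ed ends"
  shows "card W \<le> card (mg_components W Ed ends) + card Ed"
  using assms
proof (induction Ed rule: finite_induct)
  case (insert e Ed)
  obtain u w where uw: "u \<in> W" "w \<in> W" "ends e = {u, w}" using insert.prems(2)
    by (auto elim: mg_looplessE)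
  have IH: "card W \<le> card (mg_components W Ed ends) + card Ed"
    using insert mg_loopless_subset by blast
  show ?case
    using IH insert.hyps mg_components_insert_redundant[of ends e u w Ed W]
      card_mg_components_insert_bridge[of W ends e u w Ed] uw insert.prems(1)
    by (cases "mg_conn Ed ends u w") auto
qed (simp add: card_mg_components_no_edges)

lemma card_vertices_eq_components_edges:
  assumes "finite Ed" "finite W" "mg_loopless W Ed ends" "\<nexists>vs es. mg_cycle W Ed ends vs es"
  shows "card W = card (mg_components W Ed ends) + card Ed"
  using assms
proof (induction Ed rule: finite_induct)
  case (insert e Ed)
  obtain u w where uw: "u \<in> W" "w \<in> W" "ends e = {u, w}" using insert.prems(2)
    by (auto elim: mg_looplessE)
  have loopless: "mg_loopless W Ed ends" using mg_loopless_subset[OF insert.prems(2)] by blast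
  then have "card W = card (mg_components W Ed ends) + card Ed"
    using insert.IH insert.prems(1,3) mg_cycle_mono[of W Ed ends _ _ W "insert e Ed"] by blast
  moreover have "\<not> mg_conn Ed ends u w"
    using mg_cycle_closing_edge[OF _ insert.hyps(2) uw(3,1) loopless] insert.prems(3) by blast
  ultimately show ?case
    using insert.hyps card_mg_components_insert_bridge[of W ends e u w Ed] insert.prems(1) uw by auto
qed (simp add: card_mg_components_no_edges)

lemma mg_forest_card:
  assumes "finite Ed" "finite W" "W \<noteq> {}" "mg_loopless W Ed ends" "\<nexists>vs es. mg_cycle W Ed ends vs es"
  shows "card Ed + 1 \<le> card W"
proof -
  have "card (mg_components W Ed ends) > 0" using assms by (simp add: mg_components_def card_gt_0_iff)
  then show ?thesis using card_vertices_eq_components_edges[OF assms(1,2,4,5)] by simp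
qed

lemma mg_connected_card:
  assumes "finite Ed" "finite W" "mg_loopless W Ed ends" "mg_connected W Ed ends"
  shows "card W \<le> card Ed + 1"
proof -
  have "mg_components W Ed ends \<subseteq> {W}"
    using assms(4) by (auto simp: mg_components_def mg_component_def mg_connected_def)
  then have "card (mg_components W Ed ends) \<le> card {W}" by (intro card_mono) auto
  then show ?thesis using card_vertices_le_components_edges[OF assms(1-3)] by simp
qed

lemma mg_connected_card_imp_acyclic:
  assumes fin: "finite Ed" "finite W"
    and "mg_loopless W Ed ends" "mg_connected W Ed ends" "card Ed + 1 = card W"
  shows "\<not> mg_cycle W Ed ends vs es"
proof
  assume "mg_cycle W Ed ends vs es"
  then obtain e u w where e: "e \<in> Ed" "ends e = {u, w}" "mg_conn (Ed - {e}) ends u w"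
    by (rule mg_cycle_redundant_edge)
  then have "mg_conn Ed ends = mg_conn (Ed - {e}) ends"
    using mg_conn_insert_redundant[of ends e u w "Ed - {e}"] by (simp add: insert_absorb)
  then have "mg_connected W (Ed - {e}) ends" using assms(4) by (simp add: mg_connected_def)
  then have "card W \<le> card (Ed - {e}) + 1"
    using fin mg_loopless_subset[OF assms(3)] by (intro mg_connected_card[of _ W ends]) auto
  moreover have "card Ed = Suc (card (Ed - {e}))" using card.remove[OF fin(1) e(1)] .
  ultimately show False using assms(5) by simp
qed

lemma mg_tree_iff:
  assumes "finite Ed" "finite W" "mg_loopless W Ed ends"
  shows "mg_tree W Ed ends \<longleftrightarrow> mg_connected W Ed ends \<and> card Ed + 1 = card W"
proof
  assume tree: "mg_tree W Ed ends"
  then have connected: "mg_connected W Ed ends" "W \<noteq> {}" by (auto simp: mg_tree_def mg_connected_def)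
  then show "mg_connected W Ed ends \<and> card Ed + 1 = card W"
    using mg_connected_card[OF assms connected(1)] mg_forest_card[OF assms(1,2) connected(2) assms(3)]
      tree
    by (simp add: mg_tree_def)
next
  assume connected: "mg_connected W Ed ends \<and> card Ed + 1 = card W"
  moreover have "\<forall>e\<in>Ed. ends e \<subseteq> W" using assms(3) by (fastforce simp: mg_loopless_def)
  ultimately show "mg_tree W Ed ends"
    using assms mg_connected_card_imp_acyclic[OF assms] by (simp add: mg_tree_def)
qed

section \<open>Clades of binary trees\<close>

abbreviation leaves :: "btree \<Rightarrow> nat set" where
  "leaves T \<equiv> set (leaf_list T)"

fun lca :: "btree \<Rightarrow> nat set \<Rightarrow> nat set" where
  "lca (Leaf i) S = {i}"
| "lca (Node l r) S =
    (if S \<subseteq> leaves l then lca l S else if S \<subseteq> leaves r then lca r S else leaves l \<union> leaves r)"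

lemma leaf_list_nonempty [simp]: "leaf_list T \<noteq> []"
  by (induction T) auto

lemma binary_tree_on_finite: "binary_tree_on T V \<Longrightarrow> finite V"
  unfolding binary_tree_on_def by (metis List.finite_set)

lemma finite_clades: "finite (clades T)"
  by (induction T) auto

lemma clades_subset_leaves: "C \<in> clades T \<Longrightarrow> C \<subseteq> leaves T"
  by (induction T) auto

lemma clades_nonempty: "C \<in> clades T \<Longrightarrow> C \<noteq> {}"
  by (induction T) auto

lemma card_clades:
  assumes "distinct (leaf_list T)"
  shows "card (clades T) + 1 = card (leaves T)"
  using assms
proof (induction T)
  case (Node l r)
  have disjoint: "leaves l \<inter> leaves r = {}" using Node.prems by simp
  have "clades l \<inter> clades r = {}"
  proof (rule equals0I)
    fix C assume C: "C \<in> clades l \<inter> clades r"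
    then have "C \<subseteq> leaves l \<inter> leaves r" using clades_subset_leaves by auto
    then show False using disjoint clades_nonempty[of C l] C by simp
  qed
  moreover have "leaves l \<union> leaves r \<notin> clades l \<union> clades r"
  proof
    assume "leaves l \<union> leaves r \<in> clades l \<union> clades r"
    then have "leaves r \<subseteq> leaves l \<or> leaves l \<subseteq> leaves r" using clades_subset_leaves by blast
    then have "leaves l = {} \<or> leaves r = {}" by (metis disjoint inf.absorb1 inf.absorb2)
    then show False by simp
  qed
  ultimately have "card (clades (Node l r)) = Suc (card (clades l) + card (clades r))"
    by (simp add: card_Un_disjoint finite_clades)
  moreover have "card (leaves (Node l r)) = card (leaves l) + card (leaves r)"
    using disjoint by (simp add: card_Un_disjoint)
  ultimately show ?case using Node by simp
qed simp

lemma lca_least_clade: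
  assumes "distinct (leaf_list T)" "S \<subseteq> leaves T" "2 \<le> card S"
  shows "lca T S \<in> clades T \<and> S \<subseteq> lca T S \<and> (\<forall>C\<in>clades T. S \<subseteq> C \<longrightarrow> lca T S \<subseteq> C)"
  using assms
proof (induction T)
  case (Leaf i)
  then show ?case using card_mono[of "{i}" S] by simp
next
  case (Node l r)
  have disjoint: "leaves l \<inter> leaves r = {}" "S \<noteq> {}" using Node.prems by auto
  note in_leaves = clades_subset_leaves[of _ l] clades_subset_leaves[of _ r]
  consider "S \<subseteq> leaves l" | "S \<subseteq> leaves r" "\<not> S \<subseteq> leaves l" | "\<not> S \<subseteq> leaves l" "\<not> S \<subseteq> leaves r"
    by blast
  then show ?case
  proof cases
    case 1
    have "\<not> S \<subseteq> C" if "C \<in> clades r" for C using 1 disjoint in_leaves(2)[OF that] by blast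
    then show ?thesis using 1 Node.IH(1) Node.prems in_leaves(1)[of "lca l S"] by auto
  next
    case 2
    have "\<not> S \<subseteq> C" if "C \<in> clades l" for C using 2 in_leaves(1)[OF that] by blast
    then show ?thesis using 2 Node.IH(2) Node.prems in_leaves(2)[of "lca r S"] by auto
  next
    case 3
    have "\<not> S \<subseteq> C" if "C \<in> clades l \<union> clades r" for C using 3 in_leaves that by blast
    then show ?thesis using 3 Node.prems by auto
  qed
qed

lemma clade_of_eq_lca:
  assumes "distinct (leaf_list T)" "S \<subseteq> leaves T" "2 \<le> card S"
  shows "clade_of T S = lca T S"
  unfolding clade_of_def using lca_least_clade[OF assms] by (intro the_equality) blast+

lemma clade_of_in_clades:
  assumes "binary_tree_on T V" "S \<subseteq> V" "2 \<le> card S"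
  shows "clade_of T S \<in> clades T"
  using lca_least_clade[of T S] clade_of_eq_lca[of T S] assms unfolding binary_tree_on_def by metis

definition pair_lcas :: "btree \<Rightarrow> nat set \<Rightarrow> nat set set" where
  "pair_lcas T S = lca T ` {e. e \<subseteq> S \<and> card e = 2}"

lemma finite_pair_lcas: "finite S \<Longrightarrow> finite (pair_lcas T S)"
  by (simp add: pair_lcas_def)

lemma pair_lcas_empty [simp]: "pair_lcas T {} = {}"
  by (auto simp: pair_lcas_def)

lemma pair_lcas_Node_subset:
  assumes "distinct (leaf_list (Node l r))" "S \<subseteq> leaves (Node l r)"
  defines "A \<equiv> S \<inter> leaves l" and "B \<equiv> S \<inter> leaves r"
  shows "pair_lcas (Node l r) S \<subseteq>
    pair_lcas l A \<union> pair_lcas r B \<union> (if A = {} \<or> B = {} then {} else {leaves l \<union> leaves r})"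
proof
  fix C assume "C \<in> pair_lcas (Node l r) S"
  then obtain e where e: "e \<subseteq> S" "card e = 2" "C = lca (Node l r) e"
    unfolding pair_lcas_def by blast
  then have "e \<noteq> {}" by auto
  consider "e \<subseteq> leaves l" | "e \<subseteq> leaves r" "\<not> e \<subseteq> leaves l" | "\<not> e \<subseteq> leaves l" "\<not> e \<subseteq> leaves r"
    by blast
  then show "C \<in> pair_lcas l A \<union> pair_lcas r B \<union>
      (if A = {} \<or> B = {} then {} else {leaves l \<union> leaves r})"
  proof cases
    case 1
    then show ?thesis using e by (auto simp: pair_lcas_def A_def)
  next
    case 2
    then show ?thesis using e by (auto simp: pair_lcas_def B_def)
  next
    case 3
    then have "A \<noteq> {}" "B \<noteq> {}" using e(1) assms(2) by (auto simp: A_def B_def)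
    then show ?thesis using 3 e(3) by simp
  qed
qed

lemma card_pair_lcas:
  assumes "distinct (leaf_list T)" "S \<subseteq> leaves T" "S \<noteq> {}"
  shows "card (pair_lcas T S) + 1 \<le> card S"
  using assms
proof (induction T arbitrary: S)
  case (Leaf i)
  then have S: "S = {i}" by auto
  then have "{e. e \<subseteq> S \<and> card e = 2} = {}" by (auto simp: subset_singleton_iff)
  then show ?case using S by (simp add: pair_lcas_def)
next
  case (Node l r)
  define A B where "A = S \<inter> leaves l" and "B = S \<inter> leaves r"
  define top where "top = (if A = {} \<or> B = {} then {} else {leaves l \<union> leaves r})"
  have AB: "S = A \<union> B" "A \<inter> B = {}" "finite A" "finite B"
    using Node.prems by (auto simp: A_def B_def)
  have "card (pair_lcas (Node l r) S) \<le> card (pair_lcas l A \<union> pair_lcas r B \<union> top)"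
    using pair_lcas_Node_subset[OF Node.prems(1,2)] AB finite_pair_lcas unfolding A_def B_def top_def
    by (intro card_mono) auto
  also have "\<dots> \<le> card (pair_lcas l A) + card (pair_lcas r B) + card top"
    by (meson card_Un_le add_right_mono order_trans)
  finally have "card (pair_lcas (Node l r) S)
      \<le> card (pair_lcas l A) + card (pair_lcas r B) + card top" .
  moreover have "card S = card A + card B" using AB by (simp add: card_Un_disjoint)
  moreover have "A \<noteq> {} \<Longrightarrow> card (pair_lcas l A) + 1 \<le> card A"
    "B \<noteq> {} \<Longrightarrow> card (pair_lcas r B) + 1 \<le> card B"
    using Node by (auto simp: A_def B_def)
  ultimately show ?case
    using AB(1) Node.prems(3) by (cases "A = {}"; cases "B = {}") (simp_all add: top_def)
qed

section \<open>Clade graphs that are trees come from Laman graphs\<close>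

lemma finite_clade_graph_vertices: "finite (clade_graph_vertices T1 T2)"
  by (simp add: clade_graph_vertices_def finite_clades)

lemma card_clade_graph_vertices:
  assumes "binary_tree_on T1 V" "binary_tree_on T2 V"
  shows "card (clade_graph_vertices T1 T2) + 2 = 2 * card V"
proof -
  have "card (clade_graph_vertices T1 T2) = card (clades T1) + card (clades T2)"
    unfolding clade_graph_vertices_def
    by (subst card_Un_disjoint) (auto simp: finite_clades card_image)
  moreover have "card (clades T1) + 1 = card V" "card (clades T2) + 1 = card V"
    using card_clades[of T1] card_clades[of T2] assms by (auto simp: binary_tree_on_def)
  ultimately show ?thesis by simp
qed

lemma clade_of_in_clade_graph_vertices:
  assumes "binary_tree_on T1 V" "binary_tree_on T2 V" "S \<subseteq> V" "2 \<le> card S"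
  shows "Inl (clade_of T1 S) \<in> clade_graph_vertices T1 T2"
    "Inr (clade_of T2 S) \<in> clade_graph_vertices T1 T2"
  using clade_of_in_clades[OF assms(1,3,4)] clade_of_in_clades[OF assms(2,3,4)]
  by (auto simp: clade_graph_vertices_def)

lemma clade_graph_loopless:
  assumes "simple_graph V E" "binary_tree_on T1 V" "binary_tree_on T2 V"
  shows "mg_loopless (clade_graph_vertices T1 T2) E (clade_graph_ends T1 T2)"
  unfolding mg_loopless_def clade_graph_ends_def
  using clade_of_in_clade_graph_vertices[OF assms(2,3)]
    simple_graph_edge_subset[OF assms(1)] simple_graph_card_edge[OF assms(1)]
  by (metis Inl_Inr_False order_refl)

lemma restricted_clade_graph_is_tree_iff:
  assumes "simple_graph V E" "binary_tree_on T1 V" "binary_tree_on T2 V"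
  shows "restricted_clade_graph_is_tree E T1 T2 \<longleftrightarrow>
    mg_connected (clade_graph_vertices T1 T2) E (clade_graph_ends T1 T2) \<and> card E + 3 = 2 * card V"
proof -
  have "finite E" using simple_graph_finite[OF assms(1)] binary_tree_on_finite[OF assms(2)] .
  then show ?thesis
    using mg_tree_iff[OF _ finite_clade_graph_vertices clade_graph_loopless[OF assms]]
    unfolding restricted_clade_graph_is_tree_def
    using card_clade_graph_vertices[OF assms(2,3)] by auto
qed

lemma acyclic_clade_graph_sparse:
  assumes graph: "simple_graph V E" and trees: "binary_tree_on T1 V" "binary_tree_on T2 V"
    and acyclic: "\<nexists>vs es. mg_cycle (clade_graph_vertices T1 T2) E (clade_graph_ends T1 T2) vs es"
  shows "sparse V E"
  unfolding sparse_def
proof (intro allI impI)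
  fix S assume S: "S \<subseteq> V" "2 \<le> card S"
  have finS: "finite S" using S(1) binary_tree_on_finite[OF trees(1)] finite_subset by blast
  have tree_leaves: "distinct (leaf_list T1)" "leaves T1 = V" "distinct (leaf_list T2)"
    "leaves T2 = V"
    using trees by (auto simp: binary_tree_on_def)
  define F where "F = edges_in E S"
  define W :: "(nat set + nat set) set" where "W = Inl ` pair_lcas T1 S \<union> Inr ` pair_lcas T2 S"
  have "mg_loopless W F (clade_graph_ends T1 T2)"
    unfolding mg_loopless_def
  proof
    fix e assume "e \<in> F"
    then have e: "e \<subseteq> S" "card e = 2" using simple_graph_card_edge[OF graph]
      by (auto simp: F_def edges_in_def)
    then have "clade_of T1 e \<in> pair_lcas T1 S" "clade_of T2 e \<in> pair_lcas T2 S"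
      using tree_leaves S(1) by (auto simp: clade_of_eq_lca pair_lcas_def)
    then show "\<exists>u\<in>W. \<exists>w\<in>W. u \<noteq> w \<and> clade_graph_ends T1 T2 e = {u, w}"
      unfolding W_def clade_graph_ends_def by blast
  qed
  moreover have "W \<subseteq> clade_graph_vertices T1 T2"
    using lca_least_clade tree_leaves S(1)
      by (fastforce simp: W_def clade_graph_vertices_def pair_lcas_def)
  then have "\<nexists>vs es. mg_cycle W F (clade_graph_ends T1 T2) vs es"
    using acyclic mg_cycle_mono[OF _ _ edges_in_subset] unfolding F_def by blast
  moreover obtain a b where "a \<in> S" "b \<in> S" "a \<noteq> b" using card_ge_2E[OF S(2)] .
  then have "{a, b} \<in> {e. e \<subseteq> S \<and> card e = 2}" by simp
  then have "W \<noteq> {}" unfolding W_def pair_lcas_def by blast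
  ultimately have "card F + 1 \<le> card W"
    using finS simple_graph_finite[OF graph binary_tree_on_finite[OF trees(1)]]
    by (intro mg_forest_card) (auto simp: F_def W_def finite_edges_in finite_pair_lcas)
  also have "card W = card (pair_lcas T1 S) + card (pair_lcas T2 S)"
    unfolding W_def using finite_pair_lcas[OF finS]
      by (subst card_Un_disjoint) (auto simp: card_image)
  finally show "card (edges_in E S) + 3 \<le> 2 * card S"
    using card_pair_lcas[OF tree_leaves(1), of S] card_pair_lcas[OF tree_leaves(3), of S]
      tree_leaves(2,4) S by (fastforce simp: F_def)
qed

definition has_clade_trees :: "nat set \<Rightarrow> nat set set \<Rightarrow> bool" where
  "has_clade_trees V E \<longleftrightarrow>
    (\<exists>T1 T2. binary_tree_on T1 V \<and> binary_tree_on T2 V \<and> restricted_clade_graph_is_tree E T1 T2)"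

lemma has_clade_trees_imp_laman:
  assumes graph: "simple_graph V E" and "has_clade_trees V E"
  shows "laman V E"
proof -
  obtain T1 T2 where trees: "binary_tree_on T1 V" "binary_tree_on T2 V"
    "restricted_clade_graph_is_tree E T1 T2"
    using assms(2) by (auto simp: has_clade_trees_def)
  have "sparse V E"
    using acyclic_clade_graph_sparse[OF graph trees(1,2)] trees(3)
      by (simp add: restricted_clade_graph_is_tree_def mg_tree_def)
  moreover have "card E + 3 = 2 * card V"
    using restricted_clade_graph_is_tree_iff[OF graph trees(1,2)] trees(3) by blast
  ultimately show ?thesis using laman_iff_sparse[OF binary_tree_on_finite[OF trees(1)] graph] by simp
qed

section \<open>Attaching a leaf to a binary tree\<close>

fun attach :: "nat \<Rightarrow> nat \<Rightarrow> btree \<Rightarrow> btree" where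
  "attach x v (Leaf i) = (if i = x then Node (Leaf x) (Leaf v) else Leaf i)"
| "attach x v (Node l r) = Node (attach x v l) (attach x v r)"

definition attach_clade :: "nat \<Rightarrow> nat \<Rightarrow> nat set \<Rightarrow> nat set" where
  "attach_clade x v C = (if x \<in> C then insert v C else C)"

definition contract :: "nat \<Rightarrow> nat \<Rightarrow> nat \<Rightarrow> nat" where
  "contract x v u = (if u = v then x else u)"

lemma contract_image_pair: "z \<noteq> v \<Longrightarrow> contract x v ` {v, z} = {x, z}"
  by (auto simp: contract_def)

lemma attach_clade_Un: "attach_clade x v C \<union> attach_clade x v D = attach_clade x v (C \<union> D)"
  by (auto simp: attach_clade_def)

lemma leaves_attach: "leaves (attach x v T) = attach_clade x v (leaves T)"
  by (induction T) (auto simp: attach_clade_def)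

lemma attach_id: "x \<notin> leaves T \<Longrightarrow> attach x v T = T"
  by (induction T) auto

lemma binary_tree_on_attach:
  assumes "binary_tree_on T V" "v \<notin> V" "x \<in> V"
  shows "binary_tree_on (attach x v T) (insert v V)"
proof -
  have "distinct (leaf_list (attach x v T))" if "distinct (leaf_list T)" "v \<notin> leaves T" for T
    using that by (induction T) (auto simp: leaves_attach attach_clade_def)
  then show ?thesis using assms by (simp add: binary_tree_on_def leaves_attach attach_clade_def)
qed

lemma clades_attach:
  assumes "distinct (leaf_list T)" "x \<in> leaves T"
  shows "clades (attach x v T) = insert {x, v} (attach_clade x v ` clades T)"
  using assms
proof (induction T)
  case (Node l r)
  have id: "attach_clade x v ` clades T = clades T" if "x \<notin> leaves T" for T
    using clades_subset_leaves[of _ T] that by (force simp: attach_clade_def image_iff)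
  show ?case
  proof (cases "x \<in> leaves l")
    case True
    then have "x \<notin> leaves r" "attach_clade x v (leaves r) = leaves r"
      using Node.prems by (auto simp: attach_clade_def)
    then show ?thesis
      using Node True id[of r]
      by (simp add: leaves_attach attach_id image_Un insert_commute attach_clade_Un[symmetric])
  next
    case False
    then have "x \<in> leaves r" "attach_clade x v (leaves l) = leaves l"
      using Node.prems by (auto simp: attach_clade_def)
    then show ?thesis
      using Node False id[of l]
      by (simp add: leaves_attach attach_id image_Un insert_commute attach_clade_Un[symmetric])
  qed
qed auto

lemma subset_leaves_attach_iff:
  assumes "v \<notin> leaves T"
  shows "S \<subseteq> leaves (attach x v T) \<longleftrightarrow> contract x v ` S \<subseteq> leaves T"
proof -
  have "u \<in> leaves (attach x v T) \<longleftrightarrow> contract x v u \<in> leaves T" for u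
    using assms by (auto simp: leaves_attach attach_clade_def contract_def)
  then show ?thesis by blast
qed

lemma lca_attach:
  assumes "v \<notin> leaves T" "2 \<le> card (contract x v ` S)"
  shows "lca (attach x v T) S = attach_clade x v (lca T (contract x v ` S))"
  using assms
proof (induction T)
  case (Leaf i)
  have "\<not> contract x v ` S \<subseteq> {x}" using card_mono[of "{x}" "contract x v ` S"] Leaf.prems(2) by auto
  then have "\<not> S \<subseteq> {x}" "\<not> S \<subseteq> {v}" by (auto simp: contract_def)
  then show ?case by (auto simp: attach_clade_def)
next
  case (Node l r)
  have "leaves (attach x v l) \<union> leaves (attach x v r) = attach_clade x v (leaves l \<union> leaves r)"
    by (simp add: leaves_attach attach_clade_Un)
  then show ?case using Node by (simp add: subset_leaves_attach_iff)
qed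

lemma lca_attach_cherry:
  assumes "x \<in> leaves T" "v \<notin> leaves T"
  shows "lca (attach x v T) {v, x} = {x, v}"
  using assms
proof (induction T)
  case (Node l r)
  then show ?case
    by (auto simp: subset_leaves_attach_iff contract_def simp del: insert_subset)
qed auto

lemma clade_of_attach:
  assumes tree: "binary_tree_on T V" "v \<notin> V" "x \<in> V"
    and S: "S \<subseteq> insert v V" "2 \<le> card (contract x v ` S)"
  shows "clade_of (attach x v T) S = attach_clade x v (clade_of T (contract x v ` S))"
proof -
  have leaves: "distinct (leaf_list T)" "leaves T = V" using tree(1)
    by (auto simp: binary_tree_on_def)
  have attached: "distinct (leaf_list (attach x v T))" "leaves (attach x v T) = insert v V"
    using binary_tree_on_attach[OF tree] by (auto simp: binary_tree_on_def)
  have "finite S" using S(1) binary_tree_on_finite[OF tree(1)] finite_subset by blast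
  then have "2 \<le> card S" using S(2) card_image_le order_trans by blast
  then have "clade_of (attach x v T) S = lca (attach x v T) S"
    using attached S(1) by (intro clade_of_eq_lca) auto
  also have "\<dots> = attach_clade x v (lca T (contract x v ` S))" using leaves tree(2) S(2)
    by (intro lca_attach) auto
  also have "lca T (contract x v ` S) = clade_of T (contract x v ` S)"
    using leaves S tree(3) by (intro clade_of_eq_lca[symmetric]) (auto simp: contract_def)
  finally show ?thesis .
qed

lemma clade_of_attach_cherry:
  assumes "binary_tree_on T V" "v \<notin> V" "x \<in> V"
  shows "clade_of (attach x v T) {v, x} = {x, v}"
proof -
  have "v \<noteq> x" using assms by blast
  then show ?thesis
    using binary_tree_on_attach[OF assms] assms
    by (subst clade_of_eq_lca) (auto simp: binary_tree_on_def lca_attach_cherry)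
qed

section \<open>Henneberg moves on clade graphs\<close>

text \<open>The clade graph of the trees with \<open>v\<close> attached next to \<open>x\<close> and next to \<open>y\<close>, with the two
  new clades \<open>{x, v}\<close> and \<open>{y, v}\<close> deleted and the others named by the clades they extend.\<close>

definition attach_ends :: "nat \<Rightarrow> nat \<Rightarrow> nat \<Rightarrow> btree \<Rightarrow> btree \<Rightarrow> nat set \<Rightarrow> (nat set + nat set) set" where
  "attach_ends x y v T1 T2 e =
    {Inl (clade_of T1 (contract x v ` e)), Inr (clade_of T2 (contract y v ` e))}"

lemma attach_ends_old: "v \<notin> e \<Longrightarrow> attach_ends x y v T1 T2 e = clade_graph_ends T1 T2 e"
proof -
  assume "v \<notin> e"
  then have "contract x v ` e = e" for x by (force simp: contract_def image_iff)
  then show ?thesis by (simp add: attach_ends_def clade_graph_ends_def)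
qed

context
  fixes T1 T2 :: btree and V :: "nat set" and x y v :: nat
  assumes T1: "binary_tree_on T1 V" and T2: "binary_tree_on T2 V"
    and xy: "x \<in> V" "y \<in> V" "x \<noteq> y" and v: "v \<notin> V"
begin

lemma clade_graph_vertices_attach:
  "clade_graph_vertices (attach x v T1) (attach y v T2) =
     insert (Inr {y, v}) (insert (Inl {x, v})
       (map_sum (attach_clade x v) (attach_clade y v) ` clade_graph_vertices T1 T2))"
  using T1 T2 xy
  by (simp add: clade_graph_vertices_def clades_attach binary_tree_on_def
      image_Un image_image insert_commute)

lemma clade_graph_ends_attach:
  assumes "e \<subseteq> insert v V" "card e = 2" "e \<noteq> {v, x}" "e \<noteq> {v, y}"
  shows "clade_graph_ends (attach x v T1) (attach y v T2) e =
    map_sum (attach_clade x v) (attach_clade y v) ` attach_ends x y v T1 T2 e"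
proof -
  have "inj_on (contract x v) e" "inj_on (contract y v) e"
    using assms(2-4) by (auto simp: inj_on_def contract_def card_2_iff doubleton_eq_iff)
  then have "2 \<le> card (contract x v ` e)" "2 \<le> card (contract y v ` e)"
    using assms(2) by (auto simp: card_image)
  then show ?thesis
    using clade_of_attach[OF T1 v xy(1) assms(1)] clade_of_attach[OF T2 v xy(2) assms(1)]
    by (simp add: clade_graph_ends_def attach_ends_def)
qed

lemma clade_graph_ends_attach_cherries:
  "clade_graph_ends (attach x v T1) (attach y v T2) {v, x} =
     {map_sum (attach_clade x v) (attach_clade y v) (Inr (clade_of T2 {x, y})), Inl {x, v}}"
  "clade_graph_ends (attach x v T1) (attach y v T2) {v, y} =
     {map_sum (attach_clade x v) (attach_clade y v) (Inl (clade_of T1 {x, y})), Inr {y, v}}"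
proof -
  have "x \<noteq> v" "y \<noteq> v" using xy v by auto
  then have "contract y v ` {v, x} = {x, y}" "contract x v ` {v, y} = {x, y}"
    using contract_image_pair insert_commute by metis+
  then show "clade_graph_ends (attach x v T1) (attach y v T2) {v, x} =
     {map_sum (attach_clade x v) (attach_clade y v) (Inr (clade_of T2 {x, y})), Inl {x, v}}"
    "clade_graph_ends (attach x v T1) (attach y v T2) {v, y} =
     {map_sum (attach_clade x v) (attach_clade y v) (Inl (clade_of T1 {x, y})), Inr {y, v}}"
    using xy clade_of_attach_cherry[OF T1 v xy(1)] clade_of_attach_cherry[OF T2 v xy(2)]
      clade_of_attach[OF T1 v xy(1), of "{v, y}"] clade_of_attach[OF T2 v xy(2), of "{v, x}"]
    by (simp_all add: clade_graph_ends_def insert_commute)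
qed

lemma clade_tree_attach:
  assumes graph: "simple_graph (insert v V) (E \<union> {{v, x}, {v, y}})"
    and new: "{v, x} \<notin> E" "{v, y} \<notin> E"
      and card: "card (E \<union> {{v, x}, {v, y}}) + 3 = 2 * card (insert v V)"
    and conn: "mg_connected (clade_graph_vertices T1 T2) E (attach_ends x y v T1 T2)"
  shows "restricted_clade_graph_is_tree (E \<union> {{v, x}, {v, y}}) (attach x v T1) (attach y v T2)"
proof -
  let ?W = "clade_graph_vertices T1 T2" and ?\<phi> = "map_sum (attach_clade x v) (attach_clade y v)"
  let ?ends = "clade_graph_ends (attach x v T1) (attach y v T2)"
  have "?ends e = ?\<phi> ` attach_ends x y v T1 T2 e" if "e \<in> E" for e
    using that new simple_graph_edge_subset[OF graph] simple_graph_card_edge[OF graph]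
    by (intro clade_graph_ends_attach) auto
  then have old: "mg_connected (?\<phi> ` ?W) E ?ends" using conn by (rule mg_connected_image[rotated])
  have "Inl (clade_of T1 {x, y}) \<in> ?W" "Inr (clade_of T2 {x, y}) \<in> ?W"
    using clade_of_in_clade_graph_vertices[OF T1 T2, of "{x, y}"] xy by auto
  note in_image = this[THEN imageI[of _ _ ?\<phi>]]
  have "mg_connected (insert (Inl {x, v}) (?\<phi> ` ?W)) (insert {v, x} E) ?ends"
    using mg_connected_insert_pendant[of _ _ ?ends,
        OF old in_image(2) clade_graph_ends_attach_cherries(1)] .
  from mg_connected_insert_pendant[of _ _ ?ends, OF this insertI2[OF in_image(1)]
    clade_graph_ends_attach_cherries(2)]
  have "mg_connected (insert (Inr {y, v}) (insert (Inl {x, v}) (?\<phi> ` ?W)))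
      (insert {v, y} (insert {v, x} E)) ?ends" .
  then have "mg_connected (clade_graph_vertices (attach x v T1) (attach y v T2))
      (E \<union> {{v, x}, {v, y}}) ?ends"
    unfolding clade_graph_vertices_attach by (simp add: insert_commute)
  then show ?thesis
    using restricted_clade_graph_is_tree_iff[OF graph binary_tree_on_attach[OF T1 v xy(1)]
      binary_tree_on_attach[OF T2 v xy(2)]]
      card by blast
qed

end

lemma has_clade_trees_K2:
  assumes "a \<noteq> b"
  shows "has_clade_trees {a, b} {{a, b}}"
proof -
  let ?T = "Node (Leaf a) (Leaf b)"
  have T: "binary_tree_on ?T {a, b}" using assms by (auto simp: binary_tree_on_def)
  have graph: "simple_graph {a, b} {{a, b}}" using assms by (auto simp: simple_graph_def)
  have "clade_graph_vertices ?T ?T = {Inl {a, b}, Inr {a, b}}"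
    by (auto simp: clade_graph_vertices_def)
  moreover have "clade_graph_ends ?T ?T {a, b} = {Inl {a, b}, Inr {a, b}}"
    using assms by (simp add: clade_graph_ends_def clade_of_eq_lca insert_commute)
  then have "mg_conn {{a, b}} (clade_graph_ends ?T ?T) (Inl {a, b}) (Inr {a, b})"
    by (intro mg_conn_edge) auto
  ultimately have "mg_connected (clade_graph_vertices ?T ?T) {{a, b}} (clade_graph_ends ?T ?T)"
    by (intro mg_connectedI[of "Inl {a, b}"]) auto
  then show ?thesis
    using restricted_clade_graph_is_tree_iff[OF graph T T] T assms unfolding has_clade_trees_def
      by auto
qed

lemma has_clade_trees_move1:
  assumes "has_clade_trees V E" and H: "henneberg V E" and v: "v \<notin> V" and ab: "a \<in> V" "b \<in> V" "a \<noteq> b"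
  shows "has_clade_trees (insert v V) (E \<union> {{v, a}, {v, b}})"
proof -
  obtain T1 T2 where trees: "binary_tree_on T1 V" "binary_tree_on T2 V"
    "restricted_clade_graph_is_tree E T1 T2"
    using assms(1) by (auto simp: has_clade_trees_def)
  note graph = henneberg_simple_graph(2)[OF H] and moved = henneberg.move1[OF H v ab]
  have fresh: "v \<notin> e" if "e \<in> E" for e using simple_graph_edge_subset[OF graph that] v by blast
  have "mg_connected (clade_graph_vertices T1 T2) E (attach_ends a b v T1 T2)"
    using mg_connected_cong(2)[of E] attach_ends_old[OF fresh]
      restricted_clade_graph_is_tree_iff[OF graph trees(1,2)] trees(3)
    by metis
  then have "restricted_clade_graph_is_tree (E \<union> {{v, a}, {v, b}}) (attach a v T1) (attach b v T2)"
    using fresh by (intro clade_tree_attach[OF trees(1,2) ab v henneberg_simple_graph(2)[OF moved] _ _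
          henneberg_card_edges[OF moved]]) auto
  then show ?thesis
    using binary_tree_on_attach[OF trees(1) v ab(1)] binary_tree_on_attach[OF trees(2) v ab(2)]
    unfolding has_clade_trees_def by blast
qed

text \<open>Deleting \<open>e\<^sub>i\<^sub>j\<close> splits the clade graph into a part containing \<open>c\<^sub>1(i, j)\<close> and a part
  containing \<open>c\<^sub>2(i, j)\<close>. Some labelling \<open>x, y, z\<close> of \<open>i, j, k\<close> makes the edge that joins
  \<open>c\<^sub>1(x, z)\<close> to \<open>c\<^sub>2(y, z)\<close> reconnect the two parts.\<close>

lemma clade_graph_reconnecting_triple:
  assumes trees: "binary_tree_on T1 V" "binary_tree_on T2 V"
    and ijk: "{i, j, k} \<subseteq> V" "distinct [i, j, k]"
    and conn: "mg_connected (clade_graph_vertices T1 T2) (insert {i, j} E) (clade_graph_ends T1 T2)"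
  obtains x y z u w where "{x, y, z} = {i, j, k}" "distinct [x, y, z]"
    "clade_graph_ends T1 T2 {i, j} = {u, w}"
    "mg_conn E (clade_graph_ends T1 T2) u (Inl (clade_of T1 {x, z}))"
    "mg_conn E (clade_graph_ends T1 T2) w (Inr (clade_of T2 {y, z}))"
proof -
  let ?c1 = "\<lambda>a b. Inl (clade_of T1 {a, b}) :: nat set + nat set"
    and ?c2 = "\<lambda>a b. Inr (clade_of T2 {a, b}) :: nat set + nat set"
  let ?conn = "mg_conn E (clade_graph_ends T1 T2)"
  have ends: "clade_graph_ends T1 T2 {i, j} = {?c1 i j, ?c2 i j}" by (simp add: clade_graph_ends_def)
  have in_W: "?c1 a b \<in> clade_graph_vertices T1 T2" "?c2 a b \<in> clade_graph_vertices T1 T2"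
    if "{a, b} \<subseteq> V" "a \<noteq> b" for a b
    using clade_of_in_clade_graph_vertices[OF trees that(1)] that(2) by auto
  have split: "?conn (?c1 i j) s \<or> ?conn (?c2 i j) s" if "s \<in> clade_graph_vertices T1 T2" for s
    using conn that in_W(1)[of i j]
      ijk mg_conn_insert_iff[of "clade_graph_ends T1 T2", OF ends, of E "?c1 i j" s]
    unfolding mg_connected_def by auto
  consider "?conn (?c1 i j) (?c1 i k)" | "?conn (?c2 i j) (?c2 j k)"
    | "?conn (?c2 i j) (?c1 i k)" "?conn (?c1 i j) (?c2 j k)"
    using split[OF in_W(1)[of i k]] split[OF in_W(2)[of j k]] ijk by auto
  then show thesis
  proof cases
    case 1
    then show thesis using that[of k j i "?c1 i j" "?c2 i j"] ends ijk(2)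
      by (auto simp: insert_commute)
  next
    case 2
    then show thesis using that[of i k j "?c1 i j" "?c2 i j"] ends ijk(2)
      by (auto simp: insert_commute)
  next
    case 3
    then show thesis using that[of i j k "?c2 i j" "?c1 i j"] ends ijk(2)
      by (auto simp: insert_commute)
  qed
qed

lemma has_clade_trees_move2:
  assumes "has_clade_trees V E" and H: "henneberg V E" and v: "v \<notin> V"
    and ij: "{i, j} \<in> E" "i \<noteq> j" and k: "k \<in> V" "k \<noteq> i" "k \<noteq> j"
  shows "has_clade_trees (insert v V) (E - {{i, j}} \<union> {{v, i}, {v, j}, {v, k}})"
proof -
  obtain T1 T2 where trees: "binary_tree_on T1 V" "binary_tree_on T2 V"
    "restricted_clade_graph_is_tree E T1 T2"
    using assms(1) by (auto simp: has_clade_trees_def)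
  note graph = henneberg_simple_graph(2)[OF H] and moved = henneberg.move2[OF H ij k v]
  let ?E = "E - {{i, j}}" and ?W = "clade_graph_vertices T1 T2" and ?ends = "clade_graph_ends T1 T2"
  have fresh: "v \<notin> e" if "e \<in> E" for e using simple_graph_edge_subset[OF graph that] v by blast
  have E: "insert {i, j} ?E = E" using ij(1) by blast
  have conn: "mg_connected ?W (insert {i, j} ?E) ?ends"
    unfolding E using restricted_clade_graph_is_tree_iff[OF graph trees(1,2)] trees(3) by blast
  have ijk: "{i, j, k} \<subseteq> V" "distinct [i, j, k]" using simple_graph_endpoints[OF graph ij(1)] k
    by auto
  obtain x y z u w where xyz: "{x, y, z} = {i, j, k}" "distinct [x, y, z]"
    and uw: "?ends {i, j} = {u, w}"
    "mg_conn ?E ?ends u (Inl (clade_of T1 {x, z}))" "mg_conn ?E ?ends w (Inr (clade_of T2 {y, z}))"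
    using clade_graph_reconnecting_triple[OF trees(1,2) ijk conn] .
  let ?ends' = "attach_ends x y v T1 T2"
  have V: "x \<in> V" "y \<in> V" "z \<in> V" using xyz(1) ijk(1) by auto
  have "(\<lambda>u. {v, u}) ` {x, y, z} = (\<lambda>u. {v, u}) ` {i, j, k}" using xyz(1) by simp
  then have "{{v, i}, {v, j}, {v, k}} = {{v, x}, {v, y}, {v, z}}" by simp
  then have "?E \<union> {{v, i}, {v, j}, {v, k}} = ?E \<union> {{v, x}, {v, y}, {v, z}}" by (rule arg_cong)
  also have "\<dots> = insert {v, z} ?E \<union> {{v, x}, {v, y}}" by blast
  finally have edges: "?E \<union> {{v, i}, {v, j}, {v, k}} = insert {v, z} ?E \<union> {{v, x}, {v, y}}" .
  have old: "?ends' e = ?ends e" if "e \<in> E" for e using attach_ends_old[OF fresh[OF that]] .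
  have "z \<noteq> v" using V(3) v by blast
  then have "?ends' {v, z} = {Inl (clade_of T1 {x, z}), Inr (clade_of T2 {y, z})}"
    by (simp only: attach_ends_def contract_image_pair[OF \<open>z \<noteq> v\<close>])
  then have "mg_connected ?W (insert {v, z} ?E) ?ends'"
    using mg_connected_exchange[of ?W "{i, j}" ?E ?ends' u w "{v, z}"] conn uw old[OF ij(1)] E
      mg_connected_cong[of E ?ends' ?ends] mg_connected_cong[of ?E ?ends' ?ends] old by auto
  then have "restricted_clade_graph_is_tree (insert {v, z} ?E \<union> {{v, x}, {v, y}})
      (attach x v T1) (attach y v T2)"
    using henneberg_simple_graph(2)[OF moved] henneberg_card_edges[OF moved] xyz(2) fresh
      unfolding edges
    by (intro clade_tree_attach[OF trees(1,2) V(1,2) _ v]) (auto simp: doubleton_eq_iff)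
  then show ?thesis
    using binary_tree_on_attach[OF trees(1) v V(1)] binary_tree_on_attach[OF trees(2) v V(2)] edges
    unfolding has_clade_trees_def by metis
qed

lemma henneberg_imp_has_clade_trees:
  assumes "henneberg V E"
  shows "has_clade_trees V E"
  using assms
proof (induction rule: henneberg.induct)
  case (K2 a b)
  then show ?case by (rule has_clade_trees_K2)
next
  case (move1 V E v a b)
  then show ?case by (intro has_clade_trees_move1)
next
  case (move2 V E i j k v)
  then show ?case by (intro has_clade_trees_move2)
qed

theorem theorem4p7:
  fixes n :: nat and E :: "nat set set"
  assumes "n \<ge> 2" and "simple_graph {1..n} E"
  shows "(laman {1..n} E \<longleftrightarrow> henneberg {1..n} E)
       \<and> (henneberg {1..n} E \<longleftrightarrow>
            (\<exists>T1 T2. binary_tree_on T1 {1..n} \<and> binary_tree_on T2 {1..n} \<and>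
                     restricted_clade_graph_is_tree E T1 T2))
       \<and> ((\<exists>T1 T2. binary_tree_on T1 {1..n} \<and> binary_tree_on T2 {1..n} \<and>
                     restricted_clade_graph_is_tree E T1 T2)
            \<longleftrightarrow> generically_minimally_rigid_2 {1..n} E)"
proof -
  have V: "finite {1..n}" "card {1..n} \<ge> 2" using assms(1) by simp_all
  have "laman {1..n} E \<Longrightarrow> henneberg {1..n} E"
    by (rule laman_imp_henneberg[OF _ assms(2) V(2)])
  moreover have "henneberg {1..n} E \<Longrightarrow> has_clade_trees {1..n} E"
    by (rule henneberg_imp_has_clade_trees)
  moreover have "has_clade_trees {1..n} E \<Longrightarrow> laman {1..n} E"
    by (rule has_clade_trees_imp_laman[OF assms(2)])
  moreover have "henneberg {1..n} E \<Longrightarrow> generically_minimally_rigid_2 {1..n} E"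
    by (rule henneberg_imp_generically_minimally_rigid)
  moreover have "generically_minimally_rigid_2 {1..n} E \<Longrightarrow> henneberg {1..n} E"
    by (rule generically_minimally_rigid_imp_henneberg[OF V(1) assms(2) V(2)])
  ultimately show ?thesis unfolding has_clade_trees_def by blast
qed

end
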